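(* Let $A=KQ/I$ be an almost gentle algebra. Then the trivial extension $T(A)=A\rtimes\operatorname{Hom}_K(A,K)$ is a symmetric special multiserial algebra, that is, $T(A)$ is a Brauer configuration algebra.
   Context: $K$ is a field; all algebras are indecomposable and finite dimensional over $K$. Quivers are finite, $Q_0$ and $Q_1$ denote vertices and arrows; $ab$ denotes the arrow $a$ followed by the arrow $b$ (and is $0$ if not composable). For a presentation $KQ/I$ the ideal $I$ is admissible. An algebra is special multiserial if it is Morita equivalent to some $KQ/I$ satisfying (S1): for every $a\in Q_1$ there is at most one arrow $b$ with $ab\notin I$ and at most one arrow $c$ with $ca\notin I$. An algebra is almost gentle if it is Morita equivalent to some $KQ/I$ satisfying (S1) and (S0): $I$ is generated by paths of length 2. "Let $A=KQ/I$ be almost gentle" means that the presentation satisfies (S0) and (S1). With $D(A)=\operatorname{Hom}_K(A,K)$, $T(A)$ is the vector space $A\oplus D(A)$ with multiplication $(a,f)(b,g)=(ab,ag+fb)$, where $(afb)(x)=f(bxa)$. An algebra $\Lambda$ is symmetric if $\Lambda\cong\operatorname{Hom}_K(\Lambda,K)$ as $\Lambda$-$\Lambda$-bimodules. Brauer configuration: a tuple $\Gamma=(\Gamma_0,\Gamma_1,\nu,\mathfrak o)$ with $\Gamma_0$ a finite set of vertices, $\Gamma_1$ a finite collection of polygons, each a finite multiset of vertices with at least two elements counted with multiplicity, $\nu\colon\Gamma_0\to\mathbb Z_{>0}$ the multiplicity function, and $\mathfrak o$ an orientation, i.e. for each vertex $\alpha$ a cyclic ordering of the occurrences of $\alpha$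 in the polygons. Let $\mathrm{val}(\alpha)$ be the total number of occurrences of $\alpha$ in polygons. Every vertex lies in some polygon and every polygon contains a vertex $\alpha$ with $\mathrm{val}(\alpha)\nu(\alpha)>1$. A vertex is truncated if $\mathrm{val}(\alpha)\nu(\alpha)=1$. The Brauer configuration algebra of $\Gamma$ is $KQ_\Gamma/I_\Gamma$: $Q_\Gamma$ has one vertex $v$ for each polygon $V$; for each non-truncated $\alpha$ with cyclic ordering $V_1<\cdots<V_n<V_1$, $n=\mathrm{val}(\alpha)$, there are arrows $a_i\colon v_i\to v_{i+1}$ ($1\le i\le n$, indices mod $n$), and the special $\alpha$-cycles are $a_i\cdots a_na_1\cdots a_{i-1}$. $I_\Gamma$ is generated by: $C^{\nu(\alpha)}-C'^{\nu(\beta)}$ for a special $\alpha$-cycle $C$ and a special $\beta$-cycle $C'$ at the same vertex; $C^{\nu(\alpha)}a$ for a special $\alpha$-cycle $C$ with first arrow $a$; and $ab$ for arrows $a,b$ with $ab$ not a subpath of any special cycle, except when $a=b$ is a loop that is itself a special cycle. By convention $K[x]/(x^2)$ is the Brauer configuration algebra of a single 2-gon with two distinct truncated vertices. *)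

theory Defs
  imports
    "HOL-Library.Multiset"
    "HOL-Library.Sublist"
    "HOL-Library.FuncSet"
    "HOL-Algebra.QuotRing"
    "HOL-Algebra.Algebraic_Closure_Type"
    "Graph_Theory.Arc_Walk"
    "Jordan_Normal_Form.Matrix"
begin

section \<open>Algebras over a field\<close>

text \<open>
  The ground field is a type \<open>'k\<close> of class \<open>field\<close>. The library's \<open>algebra\<close> locale is
  restricted to commutative algebras; only its record type is used here.
\<close>

locale K_algebra = module "ring_of_type_algebra :: 'k::field ring" A + A?: ring A
  for A :: "('k::field, 'a) module" (structure) +
  assumes smult_mult_left:
      "\<lbrakk>x \<in> carrier A; y \<in> carrier A\<rbrakk> \<Longrightarrow> (c \<odot> x) \<otimes> y = c \<odot> (x \<otimes> y)"
    and smult_mult_right: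
      "\<lbrakk>x \<in> carrier A; y \<in> carrier A\<rbrakk> \<Longrightarrow> x \<otimes> (c \<odot> y) = c \<odot> (x \<otimes> y)"

definition finite_dimensional :: "('k::field, 'a) module \<Rightarrow> bool" where
  "finite_dimensional A \<longleftrightarrow>
    (\<exists>S. finite S \<and> S \<subseteq> carrier A \<and>
      (\<forall>x\<in>carrier A. \<exists>c. x = (\<Oplus>\<^bsub>A\<^esub>b\<in>S. c b \<odot>\<^bsub>A\<^esub> b)))"

text \<open>
  A decomposition of a unital algebra as a product of two algebras is the same thing as a
  decomposition as a direct sum of two two-sided ideals.
\<close>

definition indecomposable :: "('k, 'a) module \<Rightarrow> bool" where
  "indecomposable A \<longleftrightarrow>
    carrier A \<noteq> {\<zero>\<^bsub>A\<^esub>} \<and>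
    (\<forall>I J. ideal I A \<longrightarrow> ideal J A \<longrightarrow> I \<inter> J = {\<zero>\<^bsub>A\<^esub>} \<longrightarrow> I <+>\<^bsub>A\<^esub> J = carrier A \<longrightarrow>
      I = {\<zero>\<^bsub>A\<^esub>} \<or> J = {\<zero>\<^bsub>A\<^esub>})"

definition algebra_isomorphic :: "('k, 'a) module \<Rightarrow> ('k, 'b) module \<Rightarrow> bool" where
  "algebra_isomorphic A B \<longleftrightarrow>
    (\<exists>h\<in>ring_iso A B. \<forall>c. \<forall>x\<in>carrier A. h (c \<odot>\<^bsub>A\<^esub> x) = c \<odot>\<^bsub>B\<^esub> h x)"

definition quotient_algebra :: "('k, 'a) module \<Rightarrow> 'a set \<Rightarrow> ('k, 'a set) module" where
  "quotient_algebra A I =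
    \<lparr>carrier = carrier (A Quot I),
     monoid.mult = monoid.mult (A Quot I),
     monoid.one = monoid.one (A Quot I),
     ring.zero = ring.zero (A Quot I),
     ring.add = ring.add (A Quot I),
     module.smult = (\<lambda>c U. \<Union>x\<in>U. I +>\<^bsub>A\<^esub> (c \<odot>\<^bsub>A\<^esub> x))\<rparr>"


section \<open>The dual bimodule, symmetric algebras and trivial extensions\<close>

text \<open>
  Elements of the dual are made unique as HOL functions by being \<open>undefined\<close> off the carrier.
\<close>

definition dual :: "('k::field, 'a) module \<Rightarrow> ('a \<Rightarrow> 'k) set" where
  "dual A = {f \<in> extensional (carrier A).
     (\<forall>x\<in>carrier A. \<forall>y\<in>carrier A. f (x \<oplus>\<^bsub>A\<^esub> y) = f x + f y) \<and>
     (\<forall>c. \<forall>x\<in>carrier A. f (c \<odot>\<^bsub>A\<^esub> x) = c * f x)}"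

definition dual_add :: "('k::field, 'a) module \<Rightarrow> ('a \<Rightarrow> 'k) \<Rightarrow> ('a \<Rightarrow> 'k) \<Rightarrow> 'a \<Rightarrow> 'k" where
  "dual_add A f g = (\<lambda>x\<in>carrier A. f x + g x)"

definition dual_smult :: "('k::field, 'a) module \<Rightarrow> 'k \<Rightarrow> ('a \<Rightarrow> 'k) \<Rightarrow> 'a \<Rightarrow> 'k" where
  "dual_smult A c f = (\<lambda>x\<in>carrier A. c * f x)"

text \<open>\<open>dual_act A a f b\<close> is the functional \<open>a f b\<close>.\<close>

definition dual_act :: "('k::field, 'a) module \<Rightarrow> 'a \<Rightarrow> ('a \<Rightarrow> 'k) \<Rightarrow> 'a \<Rightarrow> 'a \<Rightarrow> 'k" where
  "dual_act A a f b = (\<lambda>x\<in>carrier A. f (b \<otimes>\<^bsub>A\<^esub> x \<otimes>\<^bsub>A\<^esub> a))"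

definition symmetric_algebra :: "('k::field, 'a) module \<Rightarrow> bool" where
  "symmetric_algebra A \<longleftrightarrow>
    (\<exists>\<phi>. bij_betw \<phi> (carrier A) (dual A) \<and>
      (\<forall>x\<in>carrier A. \<forall>y\<in>carrier A. \<phi> (x \<oplus>\<^bsub>A\<^esub> y) = dual_add A (\<phi> x) (\<phi> y)) \<and>
      (\<forall>c. \<forall>x\<in>carrier A. \<phi> (c \<odot>\<^bsub>A\<^esub> x) = dual_smult A c (\<phi> x)) \<and>
      (\<forall>a\<in>carrier A. \<forall>x\<in>carrier A. \<forall>b\<in>carrier A.
        \<phi> (a \<otimes>\<^bsub>A\<^esub> x \<otimes>\<^bsub>A\<^esub> b) = dual_act A a (\<phi> x) b))"

definition trivial_extension :: "('k::field, 'a) module \<Rightarrow> ('k, 'a \<times> ('a \<Rightarrow> 'k)) module" where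
  "trivial_extension A =
    \<lparr>carrier = carrier A \<times> dual A,
     monoid.mult = (\<lambda>(a, f) (b, g).
       (a \<otimes>\<^bsub>A\<^esub> b, dual_add A (dual_act A a g \<one>\<^bsub>A\<^esub>) (dual_act A \<one>\<^bsub>A\<^esub> f b))),
     monoid.one = (\<one>\<^bsub>A\<^esub>, \<lambda>x\<in>carrier A. 0),
     ring.zero = (\<zero>\<^bsub>A\<^esub>, \<lambda>x\<in>carrier A. 0),
     ring.add = (\<lambda>(a, f) (b, g). (a \<oplus>\<^bsub>A\<^esub> b, dual_add A f g)),
     module.smult = (\<lambda>c (a, f). (c \<odot>\<^bsub>A\<^esub> a, dual_smult A c f))\<rparr>"


section \<open>Morita equivalence\<close>

text \<open>
  Morita equivalence of finite dimensional algebras is \<open>K\<close>-linear equivalence of their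
  categories of finite dimensional modules. These categories are replaced by their full dense
  subcategories of modules with underlying space \<open>K\<^sup>n\<close>: an object is a pair of \<open>n\<close> and a
  representation of \<open>A\<close> by \<open>n \<times> n\<close> matrices, a morphism is an intertwining matrix. The values of
  a representation off the carrier are not constrained, so an object may occur in several
  isomorphic copies.
\<close>

type_synonym ('k, 'a) rep = "nat \<times> ('a \<Rightarrow> 'k mat)"

definition reps :: "('k::field, 'a) module \<Rightarrow> ('k, 'a) rep set" where
  "reps A = {(n, \<rho>). \<rho> \<in> Ring.ring_hom A (ring_mat TYPE('k) n ()) \<and>
     (\<forall>c. \<forall>x\<in>carrier A. \<rho> (c \<odot>\<^bsub>A\<^esub> x) = c \<cdot>\<^sub>m \<rho> x)}"

definition rep_hom ::
  "('k::field, 'a) module \<Rightarrow> ('k, 'a) rep \<Rightarrow> ('k, 'a) rep \<Rightarrow> 'k mat set" where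
  "rep_hom A M N =
    {T \<in> carrier_mat (fst N) (fst M). \<forall>a\<in>carrier A. T * snd M a = snd N a * T}"

definition linear_functor ::
  "('k::field, 'a) module \<Rightarrow> ('k, 'b) module \<Rightarrow> (('k, 'a) rep \<Rightarrow> ('k, 'b) rep) \<Rightarrow>
   (('k, 'a) rep \<Rightarrow> ('k, 'a) rep \<Rightarrow> 'k mat \<Rightarrow> 'k mat) \<Rightarrow> bool" where
  "linear_functor A B F \<Phi> \<longleftrightarrow>
    (\<forall>M\<in>reps A. F M \<in> reps B \<and> \<Phi> M M (1\<^sub>m (fst M)) = 1\<^sub>m (fst (F M))) \<and>
    (\<forall>M\<in>reps A. \<forall>N\<in>reps A. \<forall>T\<in>rep_hom A M N.
      \<Phi> M N T \<in> rep_hom B (F M) (F N) \<and>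
      (\<forall>c. \<Phi> M N (c \<cdot>\<^sub>m T) = c \<cdot>\<^sub>m \<Phi> M N T) \<and>
      (\<forall>U\<in>rep_hom A M N. \<Phi> M N (T + U) = \<Phi> M N T + \<Phi> M N U)) \<and>
    (\<forall>L\<in>reps A. \<forall>M\<in>reps A. \<forall>N\<in>reps A. \<forall>T\<in>rep_hom A L M. \<forall>U\<in>rep_hom A M N.
      \<Phi> L N (U * T) = \<Phi> M N U * \<Phi> L M T)"

definition naturally_isomorphic ::
  "('k::field, 'a) module \<Rightarrow> ('k, 'b) module \<Rightarrow>
   (('k, 'a) rep \<Rightarrow> ('k, 'b) rep) \<Rightarrow> (('k, 'a) rep \<Rightarrow> ('k, 'a) rep \<Rightarrow> 'k mat \<Rightarrow> 'k mat) \<Rightarrow>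
   (('k, 'a) rep \<Rightarrow> ('k, 'b) rep) \<Rightarrow> (('k, 'a) rep \<Rightarrow> ('k, 'a) rep \<Rightarrow> 'k mat \<Rightarrow> 'k mat) \<Rightarrow>
   bool" where
  "naturally_isomorphic A B F \<Phi> G \<Psi> \<longleftrightarrow>
    (\<exists>\<eta>.
      (\<forall>M\<in>reps A. \<eta> M \<in> rep_hom B (F M) (G M) \<and>
        (\<exists>Z\<in>rep_hom B (G M) (F M).
          Z * \<eta> M = 1\<^sub>m (fst (F M)) \<and> \<eta> M * Z = 1\<^sub>m (fst (G M)))) \<and>
      (\<forall>M\<in>reps A. \<forall>N\<in>reps A. \<forall>T\<in>rep_hom A M N. \<Psi> M N T * \<eta> M = \<eta> N * \<Phi> M N T))"

definition morita_equivalent :: "('k::field, 'a) module \<Rightarrow> ('k, 'b) module \<Rightarrow> bool" where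
  "morita_equivalent A B \<longleftrightarrow>
    (\<exists>F \<Phi> G \<Psi>. linear_functor A B F \<Phi> \<and> linear_functor B A G \<Psi> \<and>
      naturally_isomorphic A A (\<lambda>M. G (F M)) (\<lambda>M N T. \<Psi> (F M) (F N) (\<Phi> M N T))
        (\<lambda>M. M) (\<lambda>M N T. T) \<and>
      naturally_isomorphic B B (\<lambda>M. F (G M)) (\<lambda>M N T. \<Phi> (G M) (G N) (\<Psi> M N T))
        (\<lambda>M. M) (\<lambda>M N T. T))"


section \<open>Path algebras\<close>

text \<open>
  A quiver is a \<open>fin_digraph\<close>. A path is a pair of its first vertex and its list of arrows in
  the order of traversal, \<open>(v, [])\<close> being the trivial path at \<open>v\<close>.
\<close>

type_synonym ('v, 'e) path = "'v \<times> 'e list"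

definition paths :: "('v, 'e) pre_digraph \<Rightarrow> ('v, 'e) path set" where
  "paths Q = {(u, p). \<exists>v. pre_digraph.awalk Q u p v}"

definition path_end :: "('v, 'e) pre_digraph \<Rightarrow> ('v, 'e) path \<Rightarrow> 'v" where
  "path_end Q p = pre_digraph.awlast Q (fst p) (snd p)"

definition path_algebra ::
  "('v, 'e) pre_digraph \<Rightarrow> ('k::field, ('v, 'e) path \<Rightarrow> 'k) module" where
  "path_algebra Q =
    \<lparr>carrier = {f. finite {p. f p \<noteq> 0} \<and> {p. f p \<noteq> 0} \<subseteq> paths Q},
     monoid.mult = (\<lambda>f g r. \<Sum>(p, q) | p \<in> paths Q \<and> q \<in> paths Q \<and> path_end Q p = fst q \<and>
                          r = (fst p, snd p @ snd q). f p * g q),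
     monoid.one = (\<lambda>p. if fst p \<in> verts Q \<and> snd p = [] then 1 else 0),
     ring.zero = (\<lambda>p. 0),
     ring.add = (\<lambda>f g p. f p + g p),
     module.smult = (\<lambda>c f p. c * f p)\<rparr>"

definition path_elem :: "('v, 'e) path \<Rightarrow> ('v, 'e) path \<Rightarrow> 'k::field" where
  "path_elem p = (\<lambda>q. if q = p then 1 else 0)"

definition arrow_elem :: "('v, 'e) pre_digraph \<Rightarrow> 'e \<Rightarrow> ('v, 'e) path \<Rightarrow> 'k::field" where
  "arrow_elem Q a = path_elem (tail Q a, [a])"

text \<open>The \<open>m\<close>-th power of the arrow ideal is the span of the paths of length at least \<open>m\<close>.\<close>

definition arrow_ideal_power ::
  "('v, 'e) pre_digraph \<Rightarrow> nat \<Rightarrow> (('v, 'e) path \<Rightarrow> 'k::field) set" where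
  "arrow_ideal_power Q m =
    {f \<in> carrier (path_algebra Q). \<forall>p. f p \<noteq> 0 \<longrightarrow> m \<le> length (snd p)}"

definition admissible ::
  "('v, 'e) pre_digraph \<Rightarrow> (('v, 'e) path \<Rightarrow> 'k::field) set \<Rightarrow> bool" where
  "admissible Q I \<longleftrightarrow>
    ideal I (path_algebra Q) \<and>
    (\<exists>m\<ge>2. arrow_ideal_power Q m \<subseteq> I) \<and> I \<subseteq> arrow_ideal_power Q 2"

text \<open>A product of non-composable arrows is zero, hence lies in \<open>I\<close>.\<close>

definition cond_S1 ::
  "('v, 'e) pre_digraph \<Rightarrow> (('v, 'e) path \<Rightarrow> 'k::field) set \<Rightarrow> bool" where
  "cond_S1 Q I \<longleftrightarrow>
    (\<forall>a\<in>arcs Q.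
      (\<exists>\<^sub>\<le>\<^sub>1b. b \<in> arcs Q \<and> arrow_elem Q a \<otimes>\<^bsub>path_algebra Q\<^esub> arrow_elem Q b \<notin> I) \<and>
      (\<exists>\<^sub>\<le>\<^sub>1c. c \<in> arcs Q \<and> arrow_elem Q c \<otimes>\<^bsub>path_algebra Q\<^esub> arrow_elem Q a \<notin> I))"

definition cond_S0 ::
  "('v, 'e) pre_digraph \<Rightarrow> (('v, 'e) path \<Rightarrow> 'k::field) set \<Rightarrow> bool" where
  "cond_S0 Q I \<longleftrightarrow>
    (\<exists>S. S \<subseteq> {p \<in> paths Q. length (snd p) = 2} \<and>
      I = Idl\<^bsub>path_algebra Q\<^esub> (path_elem ` S))"

definition almost_gentle_presentation ::
  "('v, 'e) pre_digraph \<Rightarrow> (('v, 'e) path \<Rightarrow> 'k::field) set \<Rightarrow> bool" where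
  "almost_gentle_presentation Q I \<longleftrightarrow>
    fin_digraph Q \<and> admissible Q I \<and> cond_S0 Q I \<and> cond_S1 Q I"

text \<open>
  Every finite quiver is isomorphic to one with vertices in \<open>nat\<close> and arrows in \<open>nat \<times> nat\<close>,
  the labels used below for the quivers of Brauer configurations.
\<close>

definition special_multiserial :: "('k::field, 'a) module \<Rightarrow> bool" where
  "special_multiserial A \<longleftrightarrow>
    (\<exists>(Q :: (nat, nat \<times> nat) pre_digraph) I.
      fin_digraph Q \<and> admissible Q I \<and> cond_S1 Q I \<and>
      morita_equivalent A (quotient_algebra (path_algebra Q) I))"


section \<open>Brauer configuration algebras\<close>

text \<open>
  Polygons are labels with a multiset of vertices attached, so that two polygons may have the same
  vertices. The cyclic ordering at a vertex \<open>\<alpha>\<close> is the list \<open>orient \<alpha>\<close>, read cyclically, of the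
  polygons of the successive occurrences of \<open>\<alpha>\<close>.
\<close>

record ('a, 'p) brauer_config =
  bverts :: "'a set"
  bpolys :: "'p set"
  polygon :: "'p \<Rightarrow> 'a multiset"
  bmult :: "'a \<Rightarrow> nat"
  orient :: "'a \<Rightarrow> 'p list"

definition val :: "('a, 'p) brauer_config \<Rightarrow> 'a \<Rightarrow> nat" where
  "val \<Gamma> \<alpha> = (\<Sum>V\<in>bpolys \<Gamma>. count (polygon \<Gamma> V) \<alpha>)"

definition brauer_configuration :: "('a, 'p) brauer_config \<Rightarrow> bool" where
  "brauer_configuration \<Gamma> \<longleftrightarrow>
    finite (bverts \<Gamma>) \<and> finite (bpolys \<Gamma>) \<and>
    (\<forall>V\<in>bpolys \<Gamma>. set_mset (polygon \<Gamma> V) \<subseteq> bverts \<Gamma> \<and> 2 \<le> size (polygon \<Gamma> V)) \<and>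
    (\<forall>\<alpha>\<in>bverts \<Gamma>. 0 < bmult \<Gamma> \<alpha>) \<and>
    (\<forall>\<alpha>\<in>bverts \<Gamma>. set (orient \<Gamma> \<alpha>) \<subseteq> bpolys \<Gamma> \<and>
      (\<forall>V\<in>bpolys \<Gamma>. count_list (orient \<Gamma> \<alpha>) V = count (polygon \<Gamma> V) \<alpha>)) \<and>
    (\<forall>\<alpha>\<in>bverts \<Gamma>. \<exists>V\<in>bpolys \<Gamma>. \<alpha> \<in># polygon \<Gamma> V) \<and>
    (\<forall>V\<in>bpolys \<Gamma>. \<exists>\<alpha>. \<alpha> \<in># polygon \<Gamma> V \<and> 1 < val \<Gamma> \<alpha> * bmult \<Gamma> \<alpha>)"

definition nontruncated :: "('a, 'p) brauer_config \<Rightarrow> 'a set" where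
  "nontruncated \<Gamma> = {\<alpha> \<in> bverts \<Gamma>. val \<Gamma> \<alpha> * bmult \<Gamma> \<alpha> \<noteq> 1}"

text \<open>The arrow \<open>(\<alpha>, i)\<close> leads from the \<open>i\<close>-th occurrence of \<open>\<alpha>\<close> to the next one, counting from 0.\<close>

definition brauer_quiver :: "('a, 'p) brauer_config \<Rightarrow> ('p, 'a \<times> nat) pre_digraph" where
  "brauer_quiver \<Gamma> =
    \<lparr>verts = bpolys \<Gamma>,
     arcs = {(\<alpha>, i). \<alpha> \<in> nontruncated \<Gamma> \<and> i < val \<Gamma> \<alpha>},
     tail = (\<lambda>(\<alpha>, i). orient \<Gamma> \<alpha> ! i),
     head = (\<lambda>(\<alpha>, i). orient \<Gamma> \<alpha> ! (Suc i mod val \<Gamma> \<alpha>))\<rparr>"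

definition special_cycles ::
  "('a, 'p) brauer_config \<Rightarrow> 'a \<Rightarrow> ('p, 'a \<times> nat) path set" where
  "special_cycles \<Gamma> \<alpha> =
    (\<lambda>i. (orient \<Gamma> \<alpha> ! i, rotate i (map (Pair \<alpha>) [0..<val \<Gamma> \<alpha>]))) ` {..<val \<Gamma> \<alpha>}"

definition brauer_relations ::
  "('a, 'p) brauer_config \<Rightarrow> (('p, 'a \<times> nat) path \<Rightarrow> 'k::field) set" where
  "brauer_relations \<Gamma> = (let R = path_algebra (brauer_quiver \<Gamma>); arr = arrow_elem (brauer_quiver \<Gamma>) in
    {path_elem C [^]\<^bsub>R\<^esub> bmult \<Gamma> \<alpha> \<ominus>\<^bsub>R\<^esub> path_elem C' [^]\<^bsub>R\<^esub> bmult \<Gamma> \<beta> | \<alpha> \<beta> C C'.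
       \<alpha> \<in> nontruncated \<Gamma> \<and> \<beta> \<in> nontruncated \<Gamma> \<and>
       C \<in> special_cycles \<Gamma> \<alpha> \<and> C' \<in> special_cycles \<Gamma> \<beta> \<and> fst C = fst C'} \<union>
    {path_elem C [^]\<^bsub>R\<^esub> bmult \<Gamma> \<alpha> \<otimes>\<^bsub>R\<^esub> arr (hd (snd C)) | \<alpha> C.
       \<alpha> \<in> nontruncated \<Gamma> \<and> C \<in> special_cycles \<Gamma> \<alpha>} \<union>
    {arr a \<otimes>\<^bsub>R\<^esub> arr b | a b.
       a \<in> arcs (brauer_quiver \<Gamma>) \<and> b \<in> arcs (brauer_quiver \<Gamma>) \<and>
       (\<forall>\<alpha>\<in>nontruncated \<Gamma>. \<forall>C\<in>special_cycles \<Gamma> \<alpha>. \<not> sublist [a, b] (snd C)) \<and>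
       \<not> (a = b \<and> (\<exists>\<alpha>\<in>nontruncated \<Gamma>. \<exists>C\<in>special_cycles \<Gamma> \<alpha>. snd C = [a]))})"

definition brauer_ideal ::
  "('a, 'p) brauer_config \<Rightarrow> (('p, 'a \<times> nat) path \<Rightarrow> 'k::field) set" where
  "brauer_ideal \<Gamma> = Idl\<^bsub>path_algebra (brauer_quiver \<Gamma>)\<^esub> (brauer_relations \<Gamma>)"

text \<open>
  \<open>K[x]/(x\<^sup>2)\<close>, where \<open>K[x]\<close> is the path algebra of the quiver with one vertex and one loop \<open>x\<close>.
\<close>

definition loop_quiver :: "(nat, nat \<times> nat) pre_digraph" where
  "loop_quiver = \<lparr>verts = {0}, arcs = {(0, 0)}, tail = (\<lambda>_. 0), head = (\<lambda>_. 0)\<rparr>"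

definition dual_numbers ::
  "('k::field, ((nat, nat \<times> nat) path \<Rightarrow> 'k) set) module" where
  "dual_numbers = (let R = path_algebra loop_quiver; x = arrow_elem loop_quiver (0, 0) in
    quotient_algebra R (Idl\<^bsub>R\<^esub> {x \<otimes>\<^bsub>R\<^esub> x}))"

text \<open>
  The second disjunct is the convention for the 2-gon with two distinct truncated vertices, which
  \<open>brauer_configuration\<close> excludes.
\<close>

definition brauer_configuration_algebra :: "('k::field, 'a) module \<Rightarrow> bool" where
  "brauer_configuration_algebra A \<longleftrightarrow>
    (\<exists>\<Gamma> :: (nat, nat) brauer_config. brauer_configuration \<Gamma> \<and>
      algebra_isomorphic A
        (quotient_algebra (path_algebra (brauer_quiver \<Gamma>)) (brauer_ideal \<Gamma>))) \<or>
    algebra_isomorphic A dual_numbers"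

end

(* Let A = KQ/I be almost gentle. By (S0) and (S1) the arrows of Q form disjoint chains, the maximal
   nonzero paths, and A has as basis the trivial paths and the nontrivial subpaths of these chains.
   The Brauer configuration has one vertex for each maximal path; its polygons are the vertices of Q,
   and the special cycle of a maximal path p closes p up by one new arrow. Sending the new arrow to
   the dual basis element p* maps the path algebra of the Brauer quiver onto T(A): a path that avoids
   the new arrow goes to the corresponding subpath of p, and a path through it goes to the dual of
   the part of p that the path leaves out. In particular all full cycles at a vertex v go to the dual
   of the trivial path at v, and the kernel is the ideal of the Brauer relations. A vertex of Q on no
   arrow splits off, so for indecomposable A the only exception is A = K, with T(A) = K[x]/(x^2).
   The form that evaluates the functional part of a product at 1 makes T(A) symmetric. *)

theory Submission
  imports Defs
begin

section \<open>Algebras, quotients and Morita equivalence\<close>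

text \<open>The obstacle is the kernel of the map onto T(A). No dimensions are counted: every path
  of the Brauer quiver is brought to a normal form modulo the Brauer ideal, namely it lies in the
  ideal, is trivial, or runs at most once around one special cycle. Two normal forms with the same
  image differ only if both are full cycles at one vertex, and then their difference is a relation.
  This argument needs only combinatorial data, so KQ/I is traded for a basis of segments with
  numbered vertices and chains (\<open>chain_algebra\<close>). A maximal path may visit a vertex
  several times; hence segments are indexed by positions on the path, not by vertices. Chains are
  finite because admissibility bounds the length of nonzero paths. Each chain has at least one
  arrow, so the special cycle made from it has at least two arrows and is never a loop; this keeps
  the vertices coming from chains nontruncated although all multiplicities are one.\<close>

lemma ring_of_type_algebra_simps [simp]:
  "carrier ring_of_type_algebra = UNIV"
  "monoid.mult ring_of_type_algebra = (*)"
  "monoid.one ring_of_type_algebra = 1"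
  "ring.add ring_of_type_algebra = (+)"
  "ring.zero ring_of_type_algebra = 0"
  by (auto simp: ring_of_type_algebra_def)

text \<open>Flattens the locale hierarchy into plain identities, so that concrete algebras and
  homomorphic images can be checked axiom by axiom with the simplifier.\<close>

lemma K_algebraI:
  fixes A :: "('k::field, 'a) module" (structure)
  assumes add_closed: "\<And>x y. \<lbrakk>x \<in> carrier A; y \<in> carrier A\<rbrakk> \<Longrightarrow> x \<oplus> y \<in> carrier A"
    and add_assoc: "\<And>x y z. \<lbrakk>x \<in> carrier A; y \<in> carrier A; z \<in> carrier A\<rbrakk> \<Longrightarrow> (x \<oplus> y) \<oplus> z = x \<oplus> (y \<oplus> z)"
    and add_comm: "\<And>x y. \<lbrakk>x \<in> carrier A; y \<in> carrier A\<rbrakk> \<Longrightarrow> x \<oplus> y = y \<oplus> x"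
    and zero_closed: "\<zero> \<in> carrier A"
    and add_zero: "\<And>x. x \<in> carrier A \<Longrightarrow> \<zero> \<oplus> x = x"
    and add_inv: "\<And>x. x \<in> carrier A \<Longrightarrow> \<exists>y\<in>carrier A. y \<oplus> x = \<zero>"
    and mult_closed: "\<And>x y. \<lbrakk>x \<in> carrier A; y \<in> carrier A\<rbrakk> \<Longrightarrow> x \<otimes> y \<in> carrier A"
    and mult_assoc: "\<And>x y z. \<lbrakk>x \<in> carrier A; y \<in> carrier A; z \<in> carrier A\<rbrakk> \<Longrightarrow> (x \<otimes> y) \<otimes> z = x \<otimes> (y \<otimes> z)"
    and one_closed: "\<one> \<in> carrier A"
    and one_mult: "\<And>x. x \<in> carrier A \<Longrightarrow> \<one> \<otimes> x = x"
    and mult_one: "\<And>x. x \<in> carrier A \<Longrightarrow> x \<otimes> \<one> = x"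
    and distr: "\<And>x y z. \<lbrakk>x \<in> carrier A; y \<in> carrier A; z \<in> carrier A\<rbrakk> \<Longrightarrow> (x \<oplus> y) \<otimes> z = x \<otimes> z \<oplus> y \<otimes> z"
      "\<And>x y z. \<lbrakk>x \<in> carrier A; y \<in> carrier A; z \<in> carrier A\<rbrakk> \<Longrightarrow> z \<otimes> (x \<oplus> y) = z \<otimes> x \<oplus> z \<otimes> y"
    and smult_closed: "\<And>c x. x \<in> carrier A \<Longrightarrow> c \<odot> x \<in> carrier A"
    and smult_distr: "\<And>c d x. x \<in> carrier A \<Longrightarrow> (c + d) \<odot> x = c \<odot> x \<oplus> d \<odot> x"
      "\<And>c x y. \<lbrakk>x \<in> carrier A; y \<in> carrier A\<rbrakk> \<Longrightarrow> c \<odot> (x \<oplus> y) = c \<odot> x \<oplus> c \<odot> y"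
    and smult_assoc: "\<And>c d x. x \<in> carrier A \<Longrightarrow> (c * d) \<odot> x = c \<odot> (d \<odot> x)"
    and smult_one: "\<And>x. x \<in> carrier A \<Longrightarrow> 1 \<odot> x = x"
    and smult_mult: "\<And>c x y. \<lbrakk>x \<in> carrier A; y \<in> carrier A\<rbrakk> \<Longrightarrow> (c \<odot> x) \<otimes> y = c \<odot> (x \<otimes> y)"
      "\<And>c x y. \<lbrakk>x \<in> carrier A; y \<in> carrier A\<rbrakk> \<Longrightarrow> x \<otimes> (c \<odot> y) = c \<odot> (x \<otimes> y)"
  shows "K_algebra A"
proof -
  have ag: "abelian_group A"
    by (rule abelian_groupI) (use assms in auto)
  have mon: "monoid A"
    by (rule monoidI) (use assms in auto)
  show ?thesis
    by (intro K_algebra.intro K_algebra_axioms.intro moduleI ringI cring_from_type_algebra)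
       (use ag mon assms in auto)
qed

context K_algebra
begin

lemma K_smult_closed [simp, intro]: "x \<in> carrier A \<Longrightarrow> c \<odot> x \<in> carrier A"
  using smult_closed by simp

lemma K_smult_distr:
  "x \<in> carrier A \<Longrightarrow> (c + d) \<odot> x = c \<odot> x \<oplus> d \<odot> x"
  "\<lbrakk>x \<in> carrier A; y \<in> carrier A\<rbrakk> \<Longrightarrow> c \<odot> (x \<oplus> y) = c \<odot> x \<oplus> c \<odot> y"
  using smult_l_distr smult_r_distr by auto

lemma K_smult_assoc: "x \<in> carrier A \<Longrightarrow> (c * d) \<odot> x = c \<odot> (d \<odot> x)"
  using smult_assoc1 by auto

lemma K_smult_one [simp]: "x \<in> carrier A \<Longrightarrow> 1 \<odot> x = x"
  using smult_one by auto

lemma K_smult_null [simp]: "x \<in> carrier A \<Longrightarrow> 0 \<odot> x = \<zero>" "c \<odot> \<zero> = \<zero>"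
  using smult_l_null smult_r_null by auto

lemma K_smult_minus: "x \<in> carrier A \<Longrightarrow> (- 1) \<odot> x = \<ominus> x"
proof -
  assume x: "x \<in> carrier A"
  have "(-1) \<odot> x \<oplus> 1 \<odot> x = \<zero>"
    using x by (simp add: K_smult_distr(1)[symmetric] del: K_smult_one)
  then show ?thesis
    using x by (simp add: M.minus_equality)
qed

text \<open>A scalar acts as multiplication by \<open>c \<odot> \<one>\<close>, so a ring ideal is
  automatically a subspace and the ring-theoretic \<open>ideal\<close> serves for algebras.\<close>

lemma ideal_smult_closed:
  assumes "ideal I A" "x \<in> I"
  shows "c \<odot> x \<in> I"
proof -
  interpret ideal I A by fact
  have "(c \<odot> \<one>) \<otimes> x \<in> I"
    using assms by (intro I_l_closed) auto
  then show ?thesis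
    using Icarr[OF assms(2)] by (simp add: smult_mult_left)
qed

lemma ideal_zero: "ideal I A \<Longrightarrow> \<zero> \<in> I"
  using additive_subgroup.zero_closed[OF ideal.axioms(1)] .

end

section \<open>Quotient algebras and the first isomorphism theorem\<close>

lemma quotient_algebra_simps [simp]:
  "carrier (quotient_algebra A I) = carrier (A Quot I)"
  "monoid.mult (quotient_algebra A I) = monoid.mult (A Quot I)"
  "monoid.one (quotient_algebra A I) = monoid.one (A Quot I)"
  "ring.add (quotient_algebra A I) = ring.add (A Quot I)"
  "ring.zero (quotient_algebra A I) = ring.zero (A Quot I)"
  "module.smult (quotient_algebra A I) c U = (\<Union>x\<in>U. I +>\<^bsub>A\<^esub> (c \<odot>\<^bsub>A\<^esub> x))"
  by (auto simp: quotient_algebra_def)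

text \<open>Apart from the existence of negatives, which \<open>h\<close> carries over from
  \<open>A\<close>, all axioms are identities and pass to a surjective image. This is how quotients
  become algebras.\<close>

lemma K_algebra_image:
  assumes "K_algebra A" "h ` carrier A = carrier B"
    and "\<And>x y. \<lbrakk>x \<in> carrier A; y \<in> carrier A\<rbrakk> \<Longrightarrow> h (x \<oplus>\<^bsub>A\<^esub> y) = h x \<oplus>\<^bsub>B\<^esub> h y"
    and "\<And>x y. \<lbrakk>x \<in> carrier A; y \<in> carrier A\<rbrakk> \<Longrightarrow> h (x \<otimes>\<^bsub>A\<^esub> y) = h x \<otimes>\<^bsub>B\<^esub> h y"
    and "h \<zero>\<^bsub>A\<^esub> = \<zero>\<^bsub>B\<^esub>" "h \<one>\<^bsub>A\<^esub> = \<one>\<^bsub>B\<^esub>"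
    and "\<And>c x. x \<in> carrier A \<Longrightarrow> h (c \<odot>\<^bsub>A\<^esub> x) = c \<odot>\<^bsub>B\<^esub> h x"
  shows "K_algebra B"
proof -
  interpret K_algebra A by fact
  have ex: "\<exists>x\<in>carrier A. y = h x" if "y \<in> carrier B" for y
    using that assms(2) by auto
  have cl: "h x \<in> carrier B" if "x \<in> carrier A" for x
    using that assms(2) by auto
  note h = assms(3-7)[symmetric]
  have inv: "\<exists>y\<in>carrier B. y \<oplus>\<^bsub>B\<^esub> h x = h \<zero>\<^bsub>A\<^esub>" if "x \<in> carrier A" for x
    using that by (intro bexI[of _ "h (\<ominus>\<^bsub>A\<^esub> x)"]) (simp_all only: h cl M.a_inv_closed M.l_neg)
  note closed = imageI cl A.m_closed M.a_closed K_smult_closed A.one_closed M.zero_closed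
  show ?thesis
    by (rule K_algebraI; (elim ex[THEN bexE])?; simp only: h closed inv M.a_ac A.m_assoc M.r_zero
          A.l_one A.r_one A.l_distr A.r_distr K_smult_distr K_smult_assoc K_smult_one
          smult_mult_left smult_mult_right)
qed

context K_algebra
begin

context
  fixes I assumes I: "ideal I A"
begin

lemma coset_eq_iff:
  assumes "x \<in> carrier A" "y \<in> carrier A"
  shows "I +> x = I +> y \<longleftrightarrow> x \<ominus> y \<in> I"
  using A.quotient_eq_iff_same_a_r_cos[OF I assms] by auto

lemma quotient_carrier: "carrier (A Quot I) = (+>) I ` carrier A"
  by (auto simp: FactRing_simps)

text \<open>Two representatives differ by an element of \<open>I\<close>, and \<open>I\<close>
  absorbs scalars; so the union over representatives in the scalar action is a single coset.\<close>

lemma quotient_smult: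
  assumes "x \<in> carrier A"
  shows "c \<odot>\<^bsub>quotient_algebra A I\<^esub> (I +> x) = I +> (c \<odot> x)"
proof -
  interpret I: ideal I A by (rule I)
  have eq: "I +> (c \<odot> y) = I +> (c \<odot> x)" if "y \<in> I +> x" for y
  proof -
    from that obtain i where i: "i \<in> I" "y = i \<oplus> x"
      by (auto simp: a_r_coset_def')
    have ic: "i \<in> carrier A" using i I.Icarr by auto
    have "c \<odot> y \<ominus> c \<odot> x = c \<odot> i"
      using ic assms i by (simp add: K_smult_distr M.minus_eq M.a_assoc M.r_neg)
    then show ?thesis
      using ic i assms ideal_smult_closed[OF I] by (subst coset_eq_iff) auto
  qed
  have "x \<in> I +> x"
    using assms I.a_rcos_self by auto
  then have "(\<Union>y\<in>I +> x. I +> (c \<odot> y)) = I +> (c \<odot> x)"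
    using eq by blast
  then show ?thesis
    by simp
qed

lemma quotient_hom:
  shows "\<lbrakk>x \<in> carrier A; y \<in> carrier A\<rbrakk> \<Longrightarrow> I +> (x \<oplus> y) = (I +> x) \<oplus>\<^bsub>quotient_algebra A I\<^esub> (I +> y)"
    and "\<lbrakk>x \<in> carrier A; y \<in> carrier A\<rbrakk> \<Longrightarrow> I +> (x \<otimes> y) = (I +> x) \<otimes>\<^bsub>quotient_algebra A I\<^esub> (I +> y)"
    and "I +> \<zero> = \<zero>\<^bsub>quotient_algebra A I\<^esub>"
    and "I +> \<one> = \<one>\<^bsub>quotient_algebra A I\<^esub>"
proof -
  interpret h: ring_hom_ring A "A Quot I" "(+>) I"
    using ideal.rcos_ring_hom_ring[OF I] .
  show "\<lbrakk>x \<in> carrier A; y \<in> carrier A\<rbrakk> \<Longrightarrow> I +> (x \<oplus> y) = (I +> x) \<oplus>\<^bsub>quotient_algebra A I\<^esub> (I +> y)"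
    "\<lbrakk>x \<in> carrier A; y \<in> carrier A\<rbrakk> \<Longrightarrow> I +> (x \<otimes> y) = (I +> x) \<otimes>\<^bsub>quotient_algebra A I\<^esub> (I +> y)"
    "I +> \<zero> = \<zero>\<^bsub>quotient_algebra A I\<^esub>"
    "I +> \<one> = \<one>\<^bsub>quotient_algebra A I\<^esub>"
    by auto
qed

lemma quotient_K_algebra: "K_algebra (quotient_algebra A I)"
  by (rule K_algebra_image[of A "(+>) I"])
     (auto simp: quotient_carrier quotient_hom quotient_smult K_algebra_axioms simp del: quotient_algebra_simps(2-))

end

lemma first_isomorphism:
  assumes I: "ideal I A" and B: "K_algebra B" and surj: "h ` carrier A = carrier B"
    and add: "\<And>x y. \<lbrakk>x \<in> carrier A; y \<in> carrier A\<rbrakk> \<Longrightarrow> h (x \<oplus> y) = h x \<oplus>\<^bsub>B\<^esub> h y"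
    and mult: "\<And>x y. \<lbrakk>x \<in> carrier A; y \<in> carrier A\<rbrakk> \<Longrightarrow> h (x \<otimes> y) = h x \<otimes>\<^bsub>B\<^esub> h y"
    and one: "h \<one> = \<one>\<^bsub>B\<^esub>"
    and smult: "\<And>c x. x \<in> carrier A \<Longrightarrow> h (c \<odot> x) = c \<odot>\<^bsub>B\<^esub> h x"
    and ker: "\<And>x. x \<in> carrier A \<Longrightarrow> h x = \<zero>\<^bsub>B\<^esub> \<longleftrightarrow> x \<in> I"
  shows "algebra_isomorphic B (quotient_algebra A I)"
proof -
  interpret B: K_algebra B by (rule B)
  \<comment> \<open>The inverse of the induced map sends \<open>t\<close> to its fibre under
    \<open>h\<close>. This fibre is itself a coset of \<open>I\<close>, so no preimage has to be
    chosen.\<close>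
  define k where "k = (\<lambda>t. {x \<in> carrier A. h x = t})"
  have hc: "h x \<in> carrier B" if "x \<in> carrier A" for x
    using that surj by auto
  have heq: "h x = h y \<longleftrightarrow> I +> x = I +> y" if "x \<in> carrier A" "y \<in> carrier A" for x y
  proof -
    have "h (x \<ominus> y) = h x \<ominus>\<^bsub>B\<^esub> h y"
      using that smult[of y "-1"] add[of x "\<ominus> y"] hc
      by (simp add: K_smult_minus B.K_smult_minus M.minus_eq B.M.minus_eq)
    then have "h x = h y \<longleftrightarrow> h (x \<ominus> y) = \<zero>\<^bsub>B\<^esub>"
      using that hc by simp
    then show ?thesis
      using that ker coset_eq_iff[OF I] by simp
  qed
  have k: "k (h a) = I +> a" if "a \<in> carrier A" for a
  proof -
    have "x \<in> I +> a \<longleftrightarrow> x \<in> carrier A \<and> x \<ominus> a \<in> I" for x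
    proof
      assume "x \<in> I +> a"
      then obtain i where i: "i \<in> I" "x = i \<oplus> a"
        by (auto simp: a_r_coset_def')
      moreover have "i \<in> carrier A"
        using i ideal.Icarr[OF I] by auto
      ultimately show "x \<in> carrier A \<and> x \<ominus> a \<in> I"
        using that by (simp add: M.minus_eq M.a_assoc M.r_neg)
    next
      assume *: "x \<in> carrier A \<and> x \<ominus> a \<in> I"
      then have "x = (x \<ominus> a) \<oplus> a"
        using that by (simp add: M.minus_eq M.a_assoc M.l_neg)
      then show "x \<in> I +> a"
        using * by (auto simp: a_r_coset_def')
    qed
    then show ?thesis
      using that heq coset_eq_iff[OF I] by (auto simp: k_def)
  qed
  have ex: "\<exists>x\<in>carrier A. y = h x" if "y \<in> carrier B" for y
    using that surj by auto
  note q = quotient_hom[OF I] quotient_smult[OF I]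
  have "k \<in> Ring.ring_hom B (quotient_algebra A I)"
    by (rule ring_hom_memI)
       (auto dest!: ex simp: add[symmetric] mult[symmetric] one[symmetric] k quotient_carrier[OF I] q
         simp del: quotient_algebra_simps(2-))
  moreover have "bij_betw k (carrier B) (carrier (quotient_algebra A I))"
  proof (rule bij_betwI')
    show "(k x = k y) = (x = y)" if "x \<in> carrier B" "y \<in> carrier B" for x y
      using that heq by (auto dest!: ex simp: k)
    show "k x \<in> carrier (quotient_algebra A I)" if "x \<in> carrier B" for x
      using that by (auto dest!: ex simp: k quotient_carrier[OF I])
    show "\<exists>x\<in>carrier B. y = k x" if "y \<in> carrier (quotient_algebra A I)" for y
      using that k hc by (force simp: quotient_carrier[OF I])
  qed
  moreover have "k (c \<odot>\<^bsub>B\<^esub> x) = c \<odot>\<^bsub>quotient_algebra A I\<^esub> k x" if "x \<in> carrier B" for c x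
    using that by (auto dest!: ex simp: smult[symmetric] k q simp del: quotient_algebra_simps)
  ultimately show ?thesis
    unfolding algebra_isomorphic_def ring_iso_def by (intro bexI[of _ k]) blast+
qed

end

section \<open>Pulling back representations, and Morita equivalence of isomorphic algebras\<close>

context
  fixes A :: "('k::field, 'a) module" and B :: "('k, 'b) module" and h :: "'b \<Rightarrow> 'a"
  assumes hom: "h \<in> Ring.ring_hom B A"
    and lin: "\<And>c x. x \<in> carrier B \<Longrightarrow> h (c \<odot>\<^bsub>B\<^esub> x) = c \<odot>\<^bsub>A\<^esub> h x"
begin

lemma pullback_reps:
  assumes "M \<in> reps A"
  shows "(fst M, snd M \<circ> h) \<in> reps B"
proof -
  have "snd M \<in> Ring.ring_hom A (ring_mat TYPE('k) (fst M) ())"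
    using assms by (auto simp: reps_def)
  with hom have "snd M \<circ> h \<in> Ring.ring_hom B (ring_mat TYPE('k) (fst M) ())"
    by (rule ring_hom_trans)
  moreover have "h x \<in> carrier A" if "x \<in> carrier B" for x
    using that hom by (auto simp: Ring.ring_hom_def)
  ultimately show ?thesis
    using assms lin by (auto simp: reps_def)
qed

lemma pullback_rep_hom:
  assumes "T \<in> rep_hom A M N"
  shows "T \<in> rep_hom B (fst M, snd M \<circ> h) (fst N, snd N \<circ> h)"
  using assms hom by (auto simp: rep_hom_def Ring.ring_hom_def)

lemma pullback_linear_functor:
  "linear_functor A B (\<lambda>M. (fst M, snd M \<circ> h)) (\<lambda>M N T. T)"
  using pullback_reps pullback_rep_hom unfolding linear_functor_def by simp

end

lemma algebra_isomorphic_imp_morita_equivalent: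
  fixes A :: "('k::field, 'a) module" and B :: "('k, 'b) module"
  assumes iso: "algebra_isomorphic A B" and A: "K_algebra A"
  shows "morita_equivalent A B"
proof -
  interpret K_algebra A by (rule A)
  obtain h where h: "h \<in> ring_iso A B" "\<And>c x. x \<in> carrier A \<Longrightarrow> h (c \<odot>\<^bsub>A\<^esub> x) = c \<odot>\<^bsub>B\<^esub> h x"
    using iso unfolding algebra_isomorphic_def by auto
  have bij: "bij_betw h (carrier A) (carrier B)"
    using h(1) by (auto simp: ring_iso_def)
  define g where "g = inv_into (carrier A) h"
  have g: "g \<in> ring_iso B A"
    unfolding g_def using ring_iso_set_sym[OF A.ring_axioms h(1)] .
  have gh: "g (h x) = x" if "x \<in> carrier A" for x
    using that bij by (simp add: g_def bij_betw_def)
  have hg: "h (g y) = y" if "y \<in> carrier B" for y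
    using that bij by (simp add: g_def bij_betw_def f_inv_into_f)
  have glin: "g (c \<odot>\<^bsub>B\<^esub> y) = c \<odot>\<^bsub>A\<^esub> g y" if y: "y \<in> carrier B" for c y
  proof -
    obtain x where x: "x \<in> carrier A" "y = h x"
      using y bij_betw_imp_surj_on[OF bij] by blast
    then show ?thesis
      by (simp only: h(2)[OF x(1), symmetric] gh K_smult_closed)
  qed
  have homs: "h \<in> Ring.ring_hom A B" "g \<in> Ring.ring_hom B A"
    using h g by (auto simp: ring_iso_def)
  \<comment> \<open>Going back and forth along \<open>g\<close> and \<open>h\<close> restores a
    representation only on the carrier. The round trip is therefore not the identity on objects, but
    identity matrices give a natural isomorphism to it.\<close>
  have nat: "naturally_isomorphic C C F (\<lambda>M N T. T) (\<lambda>M. M) (\<lambda>M N T. T)"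
    if F: "\<And>M. M \<in> reps C \<Longrightarrow> fst (F M) = fst M \<and> (\<forall>a\<in>carrier C. snd (F M) a = snd M a)"
    for C :: "('k, 'c) module" and F
  proof -
    have cm: "snd M a \<in> carrier_mat (fst M) (fst M)" if "M \<in> reps C" "a \<in> carrier C" for M a
      using that by (auto simp: reps_def Ring.ring_hom_def ring_mat_def)
    have tm: "T \<in> carrier_mat (fst N) (fst M)" if "T \<in> rep_hom C M N" for T M N
      using that by (auto simp: rep_hom_def)
    have id: "1\<^sub>m (fst M) \<in> rep_hom C (F M) M" "1\<^sub>m (fst M) \<in> rep_hom C M (F M)"
      if "M \<in> reps C" for M
      using F[OF that] left_mult_one_mat[OF cm[OF that]] right_mult_one_mat[OF cm[OF that]]
      by (simp_all add: rep_hom_def)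
    show ?thesis
      unfolding naturally_isomorphic_def
    proof (intro exI[of _ "\<lambda>M. 1\<^sub>m (fst M)"] conjI ballI)
      fix M assume M: "M \<in> reps C"
      show "1\<^sub>m (fst M) \<in> rep_hom C (F M) M" using id M by auto
      show "\<exists>Z\<in>rep_hom C M (F M). Z * 1\<^sub>m (fst M) = 1\<^sub>m (fst (F M)) \<and> 1\<^sub>m (fst M) * Z = 1\<^sub>m (fst M)"
        using id(2)[OF M] F[OF M] by (intro bexI[of _ "1\<^sub>m (fst M)"]) auto
    next
      fix M N T assume "M \<in> reps C" "N \<in> reps C" and T: "T \<in> rep_hom C M N"
      show "T * 1\<^sub>m (fst M) = 1\<^sub>m (fst N) * T"
        by (simp add: left_mult_one_mat[OF tm[OF T]] right_mult_one_mat[OF tm[OF T]])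
    qed
  qed
  show ?thesis
    unfolding morita_equivalent_def
  proof (intro exI conjI)
    show "linear_functor A B (\<lambda>M. (fst M, snd M \<circ> g)) (\<lambda>M N T. T)"
      by (rule pullback_linear_functor[OF homs(2)]) (rule glin)
    show "linear_functor B A (\<lambda>M. (fst M, snd M \<circ> h)) (\<lambda>M N T. T)"
      by (rule pullback_linear_functor[OF homs(1)]) (rule h(2))
  qed (rule nat, simp add: gh hg)+
qed

section \<open>Path algebras\<close>

locale quiver = fin_digraph Q for Q :: "('v, 'e) pre_digraph"
begin

lemma path_end_simps [simp]:
  "path_end Q (u, []) = u"
  "path_end Q (u, p @ [a]) = head Q a"
  "path_end Q (u, [a]) = head Q a"
  by (simp_all add: path_end_def awalk_verts_conv)

lemma path_end_append: "path_end Q (u, p @ q) = path_end Q (path_end Q (u, p), q)"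
  by (simp add: path_end_def awlast_append)

lemma paths_append_iff:
  "(u, p @ q) \<in> paths Q \<longleftrightarrow> (u, p) \<in> paths Q \<and> (path_end Q (u, p), q) \<in> paths Q"
  by (auto simp: paths_def path_end_def)

lemma paths_Nil_iff [simp]: "(u, []) \<in> paths Q \<longleftrightarrow> u \<in> verts Q"
  by (auto simp: paths_def awalk_Nil_iff)

lemma paths_single_iff [simp]: "(u, [a]) \<in> paths Q \<longleftrightarrow> a \<in> arcs Q \<and> u = tail Q a"
  by (auto simp: paths_def awalk_simps)

lemma paths_snoc_iff:
  "(u, p @ [a]) \<in> paths Q \<longleftrightarrow> (u, p) \<in> paths Q \<and> a \<in> arcs Q \<and> path_end Q (u, p) = tail Q a"
  by (auto simp: paths_append_iff)

lemma path_end_in_verts: "p \<in> paths Q \<Longrightarrow> path_end Q p \<in> verts Q"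
  by (cases p) (auto simp: paths_def path_end_def)

lemma fst_path_in_verts: "p \<in> paths Q \<Longrightarrow> fst p \<in> verts Q"
  by (cases p) (auto simp: paths_def awalk_def)

definition splits :: "('v, 'e) path \<Rightarrow> (('v, 'e) path \<times> ('v, 'e) path) set" where
  "splits r = {(p, q). p \<in> paths Q \<and> q \<in> paths Q \<and> path_end Q p = fst q \<and> r = (fst p, snd p @ snd q)}"

text \<open>A splitting of \<open>r\<close> is determined by the place of the cut. So the product in
  the path algebra is a finite sum at each path, also for quivers with oriented cycles.\<close>

lemma finite_splits [simp]: "finite (splits r)"
proof (rule finite_subset)
  show "splits r \<subseteq> (\<lambda>i. ((fst r, take i (snd r)), (path_end Q (fst r, take i (snd r)), drop i (snd r))))
      ` {..length (snd r)}"
  proof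
    fix x assume "x \<in> splits r"
    then obtain u as v bs where x: "x = ((u, as), (v, bs))" "path_end Q (u, as) = v" "r = (u, as @ bs)"
      by (cases x) (auto simp: splits_def)
    then show "x \<in> (\<lambda>i. ((fst r, take i (snd r)), (path_end Q (fst r, take i (snd r)), drop i (snd r))))
      ` {..length (snd r)}"
      by (intro image_eqI[of _ _ "length as"]) auto
  qed
qed auto

lemma path_algebra_simps:
  "carrier (path_algebra Q) = {f :: _ \<Rightarrow> 'k::field. finite {p. f p \<noteq> 0} \<and> {p. f p \<noteq> 0} \<subseteq> paths Q}"
  "(f \<otimes>\<^bsub>path_algebra Q\<^esub> g) r = (\<Sum>(p, q)\<in>splits r. f p * (g q :: 'k))"
  "\<one>\<^bsub>path_algebra Q\<^esub> = (\<lambda>p. if fst p \<in> verts Q \<and> snd p = [] then (1 :: 'k) else 0)"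
  "\<zero>\<^bsub>path_algebra Q\<^esub> = (\<lambda>p. 0 :: 'k)"
  "f \<oplus>\<^bsub>path_algebra Q\<^esub> g = (\<lambda>p. f p + g p)"
  "c \<odot>\<^bsub>path_algebra Q\<^esub> g = (\<lambda>p. c * g p)"
  by (simp_all add: path_algebra_def splits_def)

abbreviation PA :: "('k::field, ('v, 'e) path \<Rightarrow> 'k) module" where
  "PA \<equiv> path_algebra Q"

lemma path_elem_closed [simp]: "p \<in> paths Q \<Longrightarrow> path_elem p \<in> carrier PA"
  by (auto simp: path_algebra_simps path_elem_def)

lemma path_elem_mult:
  assumes "p \<in> paths Q" "q \<in> paths Q"
  shows "path_elem p \<otimes>\<^bsub>PA\<^esub> path_elem q
    = (if path_end Q p = fst q then path_elem (fst p, snd p @ snd q) else \<zero>\<^bsub>PA\<^esub> :: _ \<Rightarrow> 'k::field)"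
proof
  fix r
  have "(path_elem p \<otimes>\<^bsub>PA\<^esub> path_elem q) r
      = (\<Sum>x\<in>splits r. if x = (p, q) then (1 :: 'k) else 0)"
    unfolding path_algebra_simps by (rule sum.cong) (auto simp: path_elem_def split: if_splits)
  also have "\<dots> = (if (p, q) \<in> splits r then 1 else 0)"
    by simp
  also have "\<dots> = (if path_end Q p = fst q then path_elem (fst p, snd p @ snd q) else \<zero>\<^bsub>PA\<^esub>) r"
    using assms by (auto simp: splits_def path_algebra_simps path_elem_def)
  finally show "(path_elem p \<otimes>\<^bsub>PA\<^esub> path_elem q) r
    = (if path_end Q p = fst q then path_elem (fst p, snd p @ snd q) else \<zero>\<^bsub>PA\<^esub> :: _ \<Rightarrow> 'k) r" .
qed

lemma path_algebra_bilinear: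
  fixes f g h :: "('v, 'e) path \<Rightarrow> 'k::field"
  shows "(f \<oplus>\<^bsub>PA\<^esub> g) \<otimes>\<^bsub>PA\<^esub> h = f \<otimes>\<^bsub>PA\<^esub> h \<oplus>\<^bsub>PA\<^esub> g \<otimes>\<^bsub>PA\<^esub> h"
    and "h \<otimes>\<^bsub>PA\<^esub> (f \<oplus>\<^bsub>PA\<^esub> g) = h \<otimes>\<^bsub>PA\<^esub> f \<oplus>\<^bsub>PA\<^esub> h \<otimes>\<^bsub>PA\<^esub> g"
    and "(c \<odot>\<^bsub>PA\<^esub> f) \<otimes>\<^bsub>PA\<^esub> h = c \<odot>\<^bsub>PA\<^esub> (f \<otimes>\<^bsub>PA\<^esub> h)"
    and "h \<otimes>\<^bsub>PA\<^esub> (c \<odot>\<^bsub>PA\<^esub> f) = c \<odot>\<^bsub>PA\<^esub> (h \<otimes>\<^bsub>PA\<^esub> f)"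
    and "\<zero>\<^bsub>PA\<^esub> \<otimes>\<^bsub>PA\<^esub> h = \<zero>\<^bsub>PA\<^esub>"
    and "h \<otimes>\<^bsub>PA\<^esub> \<zero>\<^bsub>PA\<^esub> = \<zero>\<^bsub>PA\<^esub>"
  by (auto simp: fun_eq_iff path_algebra_simps algebra_simps case_prod_unfold sum.distrib sum_distrib_left)

lemma path_algebra_closed:
  fixes f g :: "('v, 'e) path \<Rightarrow> 'k::field"
  shows "\<lbrakk>f \<in> carrier PA; g \<in> carrier PA\<rbrakk> \<Longrightarrow> f \<oplus>\<^bsub>PA\<^esub> g \<in> carrier PA"
    and "f \<in> carrier PA \<Longrightarrow> c \<odot>\<^bsub>PA\<^esub> f \<in> carrier PA"
    and "\<zero>\<^bsub>PA\<^esub> \<in> carrier (PA :: ('k, _) module)"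
    and "\<one>\<^bsub>PA\<^esub> \<in> carrier (PA :: ('k, _) module)"
proof -
  assume fg: "f \<in> carrier PA" "g \<in> carrier PA"
  have "{p. f p + g p \<noteq> 0} \<subseteq> {p. f p \<noteq> 0} \<union> {p. g p \<noteq> 0}"
    by auto
  with fg show "f \<oplus>\<^bsub>PA\<^esub> g \<in> carrier PA"
    unfolding path_algebra_simps mem_Collect_eq by (meson finite_UnI finite_subset le_sup_iff subset_trans)
next
  assume f: "f \<in> carrier PA"
  have "{p. c * f p \<noteq> 0} \<subseteq> {p. f p \<noteq> 0}"
    by auto
  with f show "c \<odot>\<^bsub>PA\<^esub> f \<in> carrier PA"
    unfolding path_algebra_simps mem_Collect_eq by (meson finite_subset subset_trans)
next
  show "\<zero>\<^bsub>PA\<^esub> \<in> carrier (PA :: ('k, _) module)"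
    by (simp add: path_algebra_simps)
  have "{p. \<one>\<^bsub>PA\<^esub> p \<noteq> (0 :: 'k)} = (\<lambda>v. (v, [])) ` verts Q"
    by (auto simp: path_algebra_simps split: if_splits)
  then show "\<one>\<^bsub>PA\<^esub> \<in> carrier (PA :: ('k, _) module)"
    by (auto simp: path_algebra_simps(1))
qed

text \<open>Reduces linear statements to single paths, where they concern concatenation. The premise
  \<open>f p \<noteq> 0\<close> refers to the original \<open>f\<close>, which lets the induction
  also use conditions on its support.\<close>

lemma path_algebra_induct [consumes 1, case_names zero add]:
  fixes f :: "('v, 'e) path \<Rightarrow> 'k::field"
  assumes f: "f \<in> carrier PA"
    and zero: "P \<zero>\<^bsub>PA\<^esub>"
    and add: "\<And>c p g. \<lbrakk>p \<in> paths Q; f p \<noteq> 0; g \<in> carrier PA; P g\<rbrakk> \<Longrightarrow> P (c \<odot>\<^bsub>PA\<^esub> path_elem p \<oplus>\<^bsub>PA\<^esub> g)"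
  shows "P f"
proof -
  \<comment> \<open>Removing a path from the support changes the element, so the claim is proved for
    every \<open>g\<close> supported in a subset \<open>S\<close> of the support of
    \<open>f\<close>.\<close>
  have "P g" if "finite S" "{p. g p \<noteq> 0} \<subseteq> S" "S \<subseteq> {p. f p \<noteq> 0}" for S g
    using that
  proof (induction S arbitrary: g rule: finite_induct)
    case empty
    then have "g = \<zero>\<^bsub>PA\<^esub>"
      by (auto simp: path_algebra_simps)
    then show ?case
      using zero by simp
  next
    case (insert p S)
    define h where "h = g(p := 0)"
    have "{q. h q \<noteq> 0} \<subseteq> S" "S \<subseteq> paths Q"
      using insert.prems f by (auto simp: h_def path_algebra_simps(1))
    then have "P h" "h \<in> carrier PA"
      using insert by (auto simp: path_algebra_simps(1) intro: finite_subset)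
    then have "P (g p \<odot>\<^bsub>PA\<^esub> path_elem p \<oplus>\<^bsub>PA\<^esub> h)"
      using insert.prems f by (intro add) (auto simp: path_algebra_simps(1))
    also have "g p \<odot>\<^bsub>PA\<^esub> path_elem p \<oplus>\<^bsub>PA\<^esub> h = g"
      by (auto simp: path_algebra_simps h_def path_elem_def)
    finally show ?case .
  qed
  then show ?thesis
    using f by (auto simp: path_algebra_simps(1))
qed

lemma path_algebra_mult_closed:
  fixes f g :: "('v, 'e) path \<Rightarrow> 'k::field"
  assumes "f \<in> carrier PA" "g \<in> carrier PA"
  shows "f \<otimes>\<^bsub>PA\<^esub> g \<in> carrier PA"
  using assms(1)
proof (induction rule: path_algebra_induct)
  case zero
  show ?case by (simp add: path_algebra_bilinear path_algebra_closed)
next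
  case (add c p h)
  have "path_elem p \<otimes>\<^bsub>PA\<^esub> g \<in> carrier PA"
    using assms(2)
  proof (induction rule: path_algebra_induct)
    case zero
    show ?case by (simp add: path_algebra_bilinear path_algebra_closed)
  next
    case (add d q k)
    have "path_elem p \<otimes>\<^bsub>PA\<^esub> path_elem q \<in> carrier (PA :: ('k, _) module)"
      using \<open>p \<in> paths Q\<close> add(1)
      by (cases p; cases q) (auto simp: path_elem_mult path_algebra_closed paths_append_iff)
    then show ?case
      using add by (auto simp: path_algebra_bilinear path_algebra_closed)
  qed
  then show ?case
    using add by (auto simp: path_algebra_bilinear path_algebra_closed)
qed

lemma path_elem_assoc:
  assumes "p \<in> paths Q" "q \<in> paths Q" "r \<in> paths Q"
  shows "(path_elem p \<otimes>\<^bsub>PA\<^esub> path_elem q) \<otimes>\<^bsub>PA\<^esub> path_elem r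
    = (path_elem p \<otimes>\<^bsub>PA\<^esub> (path_elem q \<otimes>\<^bsub>PA\<^esub> path_elem r) :: _ \<Rightarrow> 'k::field)"
proof -
  obtain u as v bs w cs where pqr: "p = (u, as)" "q = (v, bs)" "r = (w, cs)"
    by (metis surj_pair)
  show ?thesis
    using assms by (auto simp: path_elem_mult path_algebra_bilinear paths_append_iff path_end_append pqr)
qed

lemma path_algebra_assoc:
  fixes f g h :: "('v, 'e) path \<Rightarrow> 'k::field"
  assumes "f \<in> carrier PA" "g \<in> carrier PA" "h \<in> carrier PA"
  shows "(f \<otimes>\<^bsub>PA\<^esub> g) \<otimes>\<^bsub>PA\<^esub> h = f \<otimes>\<^bsub>PA\<^esub> (g \<otimes>\<^bsub>PA\<^esub> h)"
  using assms(1)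
proof (induction rule: path_algebra_induct)
  case (add c p f)
  have "(path_elem p \<otimes>\<^bsub>PA\<^esub> g) \<otimes>\<^bsub>PA\<^esub> h = path_elem p \<otimes>\<^bsub>PA\<^esub> (g \<otimes>\<^bsub>PA\<^esub> h)"
    using assms(2)
  proof (induction rule: path_algebra_induct)
    case (add d q g)
    have "(path_elem p \<otimes>\<^bsub>PA\<^esub> path_elem q) \<otimes>\<^bsub>PA\<^esub> h = path_elem p \<otimes>\<^bsub>PA\<^esub> (path_elem q \<otimes>\<^bsub>PA\<^esub> h)"
      using assms(3)
    proof (induction rule: path_algebra_induct)
      case (add e r h)
      then show ?case
        using path_elem_assoc[OF \<open>p \<in> paths Q\<close> \<open>q \<in> paths Q\<close> add(1), where 'k = 'k]
        by (simp add: path_algebra_bilinear)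
    qed (simp add: path_algebra_bilinear)
    with add show ?case
      by (simp add: path_algebra_bilinear)
  qed (simp add: path_algebra_bilinear)
  with add show ?case
    by (simp add: path_algebra_bilinear)
qed (simp add: path_algebra_bilinear)

lemma path_algebra_one:
  fixes f :: "('v, 'e) path \<Rightarrow> 'k::field"
  assumes "f \<in> carrier PA"
  shows "\<one>\<^bsub>PA\<^esub> \<otimes>\<^bsub>PA\<^esub> f = f" "f \<otimes>\<^bsub>PA\<^esub> \<one>\<^bsub>PA\<^esub> = f"
proof -
  have f0: "f r = 0" if "r \<notin> paths Q" for r
    using assms that by (auto simp: path_algebra_simps(1))
  show "\<one>\<^bsub>PA\<^esub> \<otimes>\<^bsub>PA\<^esub> f = f"
  proof
    fix r
    have "(\<one>\<^bsub>PA\<^esub> \<otimes>\<^bsub>PA\<^esub> f) r = (\<Sum>x\<in>splits r. if x = ((fst r, []), r) then f r else 0)"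
      unfolding path_algebra_simps(2) by (rule sum.cong) (auto simp: splits_def path_algebra_simps split: if_splits)
    also have "\<dots> = (if ((fst r, []), r) \<in> splits r then f r else 0)"
      by simp
    also have "\<dots> = f r"
      using f0[of r] fst_path_in_verts[of r] by (auto simp: splits_def)
    finally show "(\<one>\<^bsub>PA\<^esub> \<otimes>\<^bsub>PA\<^esub> f) r = f r" .
  qed
  show "f \<otimes>\<^bsub>PA\<^esub> \<one>\<^bsub>PA\<^esub> = f"
  proof
    fix r
    have "(f \<otimes>\<^bsub>PA\<^esub> \<one>\<^bsub>PA\<^esub>) r = (\<Sum>x\<in>splits r. if x = (r, (path_end Q r, [])) then f r else 0)"
      unfolding path_algebra_simps(2) by (rule sum.cong) (auto simp: splits_def path_algebra_simps split: if_splits)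
    also have "\<dots> = (if (r, (path_end Q r, [])) \<in> splits r then f r else 0)"
      by simp
    also have "\<dots> = f r"
      using f0[of r] path_end_in_verts[of r] by (auto simp: splits_def)
    finally show "(f \<otimes>\<^bsub>PA\<^esub> \<one>\<^bsub>PA\<^esub>) r = f r" .
  qed
qed

lemma path_algebra_K_algebra: "K_algebra (PA :: ('k::field, _) module)"
proof (rule K_algebraI)
  fix f :: "('v, 'e) path \<Rightarrow> 'k" assume f: "f \<in> carrier PA"
  show "\<exists>g\<in>carrier PA. g \<oplus>\<^bsub>PA\<^esub> f = \<zero>\<^bsub>PA\<^esub>"
    by (intro bexI[of _ "(-1) \<odot>\<^bsub>PA\<^esub> f"] path_algebra_closed f) (simp add: path_algebra_simps)
qed (simp_all add: path_algebra_closed path_algebra_mult_closed path_algebra_assoc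
  path_algebra_bilinear path_algebra_one, simp_all add: path_algebra_simps algebra_simps)

lemma path_elem_append:
  assumes "(u, p @ q) \<in> paths Q"
  shows "path_elem (u, p @ q) = (path_elem (u, p) \<otimes>\<^bsub>PA\<^esub> path_elem (path_end Q (u, p), q) :: _ \<Rightarrow> 'k::field)"
  using assms by (simp add: path_elem_mult paths_append_iff)

text \<open>Makes membership in an ideal checkable path by path; this yields the hard inclusion both
  for \<open>I_eq\<close> and for admissibility.\<close>

lemma ideal_supported_on:
  fixes J :: "(('v, 'e) path \<Rightarrow> 'k::field) set"
  assumes J: "ideal J PA" and f: "f \<in> carrier PA" and "\<And>p. \<lbrakk>p \<in> paths Q; f p \<noteq> 0\<rbrakk> \<Longrightarrow> path_elem p \<in> J"
  shows "f \<in> J"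
proof -
  interpret K_algebra "PA :: ('k, _) module" by (rule path_algebra_K_algebra)
  interpret J: ideal J "PA :: ('k, _) module" by (rule J)
  show ?thesis
    using f
  proof (induction rule: path_algebra_induct)
    case (add c p g)
    then show ?case
      using assms(3) ideal_smult_closed[OF J] J.a_closed by blast
  qed (rule J.zero_closed)
qed

text \<open>A monomial ideal: a path with nonzero coefficient in a product is a concatenation of
  paths from the two supports. It covers the powers of the arrow ideal as well as ideals of zero
  relations.\<close>

lemma ideal_of_paths:
  fixes P :: "('v, 'e) path \<Rightarrow> bool"
  assumes P: "\<And>u as v bs. P (u, as) \<or> P (v, bs) \<Longrightarrow> P (u, as @ bs)"
  shows "ideal {f \<in> carrier PA. \<forall>p. f p \<noteq> (0 :: 'k::field) \<longrightarrow> P p} PA"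
proof -
  interpret K_algebra "PA :: ('k, _) module" by (rule path_algebra_K_algebra)
  let ?Z = "{f \<in> carrier PA. \<forall>p. f p \<noteq> (0 :: 'k) \<longrightarrow> P p}"
  have prod: "f \<otimes>\<^bsub>PA\<^esub> g \<in> ?Z" if fg: "f \<in> carrier PA" "g \<in> carrier PA" "f \<in> ?Z \<or> g \<in> ?Z" for f g
  proof -
    have "P r" if "(f \<otimes>\<^bsub>PA\<^esub> g) r \<noteq> 0" for r
    proof -
      have "(\<Sum>(p, q)\<in>splits r. f p * g q) \<noteq> 0"
        using that unfolding path_algebra_simps(2) .
      then obtain x where "x \<in> splits r" "(case x of (p, q) \<Rightarrow> f p * g q) \<noteq> 0"
        by (rule sum.not_neutral_contains_not_neutral) (rule that; assumption)
      then obtain u as v bs where "((u, as), (v, bs)) \<in> splits r" "f (u, as) * g (v, bs) \<noteq> 0"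
        by (cases x) auto
      then show ?thesis
        using fg(3) P[of u as v bs] by (auto simp: splits_def)
    qed
    then show ?thesis
      using path_algebra_mult_closed[OF fg(1,2)] by blast
  qed
  show ?thesis
  proof (rule idealI[OF A.ring_axioms])
    show "subgroup ?Z (add_monoid PA)"
    proof (rule M.add.subgroupI)
      show "f \<oplus>\<^bsub>PA\<^esub> g \<in> ?Z" if "f \<in> ?Z" "g \<in> ?Z" for f g
      proof -
        have "f p \<noteq> 0 \<or> g p \<noteq> 0" if "(f \<oplus>\<^bsub>PA\<^esub> g) p \<noteq> 0" for p
          using that by (auto simp: path_algebra_simps)
        then show ?thesis
          using that path_algebra_closed(1)[of f g] by blast
      qed
      show "\<ominus>\<^bsub>PA\<^esub> f \<in> ?Z" if "f \<in> ?Z" for f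
      proof -
        have "\<ominus>\<^bsub>PA\<^esub> f = (-1) \<odot>\<^bsub>PA\<^esub> f"
          using that K_smult_minus by simp
        then show ?thesis
          using that path_algebra_closed(2)[of f "-1"] by (simp add: path_algebra_simps(6))
      qed
      show "?Z \<noteq> {}"
        using path_algebra_closed(3) by (auto simp: path_algebra_simps(4))
    qed auto
  qed (use prod in blast)+
qed

lemma arrow_ideal_power_ideal: "ideal (arrow_ideal_power Q m :: (_ \<Rightarrow> 'k::field) set) PA"
  unfolding arrow_ideal_power_def by (rule ideal_of_paths) auto

lemma path_elem_in_arrow_ideal_power:
  "p \<in> paths Q \<Longrightarrow> m \<le> length (snd p) \<Longrightarrow> path_elem p \<in> arrow_ideal_power Q m"
  by (auto simp: arrow_ideal_power_def path_elem_def path_algebra_simps(1))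

lemma arrow_elem_closed: "a \<in> arcs Q \<Longrightarrow> arrow_elem Q a \<in> carrier PA"
  by (simp add: arrow_elem_def)

lemma arrow_mult_in_arrow_ideal:
  assumes "a \<in> arcs Q" "c \<in> arcs Q"
  shows "arrow_elem Q a \<otimes>\<^bsub>PA\<^esub> arrow_elem Q c \<in> (arrow_ideal_power Q 2 :: (_ \<Rightarrow> 'k::field) set)"
proof -
  interpret K_algebra "PA :: ('k, _) module" by (rule path_algebra_K_algebra)
  have "arrow_elem Q a \<otimes>\<^bsub>PA\<^esub> arrow_elem Q c =
      (if head Q a = tail Q c then path_elem (tail Q a, [a, c]) else \<zero>\<^bsub>PA\<^esub> :: _ \<Rightarrow> 'k)"
    using assms by (simp add: arrow_elem_def path_elem_mult)
  moreover have "(tail Q a, [a, c]) \<in> paths Q" if "head Q a = tail Q c"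
    using assms that paths_append_iff[of "tail Q a" "[a]" "[c]"] by simp
  ultimately show ?thesis
    using path_elem_in_arrow_ideal_power[of "(tail Q a, [a, c])" 2] ideal_zero[OF arrow_ideal_power_ideal]
    by auto
qed

end

section \<open>Trivial extensions\<close>

lemma dualI:
  assumes "f \<in> extensional (carrier A)"
    and "\<And>x y. \<lbrakk>x \<in> carrier A; y \<in> carrier A\<rbrakk> \<Longrightarrow> f (x \<oplus>\<^bsub>A\<^esub> y) = f x + f y"
    and "\<And>c x. x \<in> carrier A \<Longrightarrow> f (c \<odot>\<^bsub>A\<^esub> x) = c * f x"
  shows "f \<in> dual A"
  using assms by (simp add: dual_def)

lemma dual_eqI:
  assumes "f \<in> dual A" "g \<in> dual A" "\<And>x. x \<in> carrier A \<Longrightarrow> f x = g x"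
  shows "f = g"
  using assms by (auto simp: dual_def intro: extensionalityI)

context K_algebra
begin

lemma dual_add_apply: "f \<in> dual A \<Longrightarrow> x \<in> carrier A \<Longrightarrow> y \<in> carrier A \<Longrightarrow> f (x \<oplus> y) = f x + f y"
  and dual_smult_apply: "f \<in> dual A \<Longrightarrow> x \<in> carrier A \<Longrightarrow> f (c \<odot> x) = c * f x"
  by (auto simp: dual_def)

lemma dual_zero_apply: "f \<in> dual A \<Longrightarrow> f \<zero> = 0"
  using dual_smult_apply[of f \<zero> 0] by simp

lemma dual_finsum:
  assumes "f \<in> dual A" "finite S" "F \<in> S \<rightarrow> carrier A"
  shows "f (\<Oplus>i\<in>S. F i) = (\<Sum>i\<in>S. f (F i))"
  using assms(2,3)
proof (induction S rule: finite_induct)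
  case empty
  then show ?case using assms(1) by (simp add: dual_zero_apply)
next
  case (insert i S)
  then have "F i \<in> carrier A" "F \<in> S \<rightarrow> carrier A" by auto
  then show ?case
    using insert assms(1) by (simp add: dual_add_apply M.finsum_closed)
qed

text \<open>The functionals \<open>x f\<close> and \<open>f x\<close> of the bimodule structure on
  the dual, with the unit on the other side already removed.\<close>

lemma dual_extend:
  "x \<in> carrier A \<Longrightarrow> f \<in> dual A \<Longrightarrow> (\<lambda>z\<in>carrier A. f (z \<otimes> x)) \<in> dual A"
  "x \<in> carrier A \<Longrightarrow> f \<in> dual A \<Longrightarrow> (\<lambda>z\<in>carrier A. f (x \<otimes> z)) \<in> dual A"
  by (rule dualI; simp add: A.l_distr A.r_distr smult_mult_left smult_mult_right dual_add_apply dual_smult_apply)+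

lemma dual_add_closed: "f \<in> dual A \<Longrightarrow> g \<in> dual A \<Longrightarrow> dual_add A f g \<in> dual A"
  unfolding dual_add_def
  by (rule dualI) (simp_all add: dual_add_apply dual_smult_apply algebra_simps)

lemma dual_smult_closed: "f \<in> dual A \<Longrightarrow> dual_smult A c f \<in> dual A"
  unfolding dual_smult_def
  by (rule dualI) (simp_all add: dual_add_apply dual_smult_apply algebra_simps)

lemma dual_add_value: "x \<in> carrier A \<Longrightarrow> dual_add A f g x = f x + g x"
  and dual_smult_value: "x \<in> carrier A \<Longrightarrow> dual_smult A c f x = c * f x"
  by (simp_all add: dual_add_def dual_smult_def)

lemma zero_dual: "(\<lambda>x\<in>carrier A. 0) \<in> dual A"
  by (rule dualI) simp_all

lemma trivial_extension_simps:
  "carrier (trivial_extension A) = carrier A \<times> dual A"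
  "\<one>\<^bsub>trivial_extension A\<^esub> = (\<one>, \<lambda>x\<in>carrier A. 0)"
  "\<zero>\<^bsub>trivial_extension A\<^esub> = (\<zero>, \<lambda>x\<in>carrier A. 0)"
  "(x, f) \<oplus>\<^bsub>trivial_extension A\<^esub> (y, g) = (x \<oplus> y, dual_add A f g)"
  "c \<odot>\<^bsub>trivial_extension A\<^esub> (x, f) = (c \<odot> x, dual_smult A c f)"
  by (simp_all add: trivial_extension_def)

lemma trivial_extension_mult:
  assumes "x \<in> carrier A" "y \<in> carrier A"
  shows "(x, f) \<otimes>\<^bsub>trivial_extension A\<^esub> (y, g) = (x \<otimes> y, \<lambda>z\<in>carrier A. g (z \<otimes> x) + f (y \<otimes> z))"
  using assms by (auto simp: trivial_extension_def dual_add_def dual_act_def intro!: restrict_ext)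

lemma trivial_extension_mult_closed:
  assumes "x \<in> carrier A" "y \<in> carrier A" "f \<in> dual A" "g \<in> dual A"
  shows "(\<lambda>z\<in>carrier A. g (z \<otimes> x) + f (y \<otimes> z)) \<in> dual A"
  using dual_add_closed[OF dual_extend(1)[OF assms(1,4)] dual_extend(2)[OF assms(2,3)]]
  by (simp add: dual_add_def cong: restrict_cong)

lemma trivial_extension_K_algebra: "K_algebra (trivial_extension A)"
proof -
  note simps = trivial_extension_simps trivial_extension_mult trivial_extension_mult_closed
    dual_add_closed dual_smult_closed zero_dual
  note eq = dual_add_def dual_smult_def
  have inv: "\<exists>y\<in>carrier (trivial_extension A). y \<oplus>\<^bsub>trivial_extension A\<^esub> x = \<zero>\<^bsub>trivial_extension A\<^esub>"
    if "x \<in> carrier (trivial_extension A)" for x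
  proof -
    obtain a f where x: "x = (a, f)" "a \<in> carrier A" "f \<in> dual A"
      using \<open>x \<in> _\<close> by (auto simp: simps)
    have "dual_add A (dual_smult A (-1) f) f = (\<lambda>x\<in>carrier A. 0)"
      by (simp add: eq cong: restrict_cong)
    then show ?thesis
      using x by (intro bexI[of _ "(\<ominus> a, dual_smult A (-1) f)"]) (simp_all add: simps M.l_neg)
  qed
  have und: "f x = undefined" if "f \<in> dual A" "x \<notin> carrier A" for f x
    using that by (simp add: dual_def extensional_def)
  note ring = M.a_ac A.m_assoc A.l_distr A.r_distr K_smult_distr K_smult_assoc smult_mult_left
    smult_mult_right
  note field = fun_eq_iff restrict_def und dual_add_apply dual_smult_apply dual_add_def
    dual_smult_def algebra_simps
  show ?thesis
    by (rule K_algebraI; (unfold trivial_extension_simps(1))?;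
        (rule inv[unfolded trivial_extension_simps(1)], assumption)?; (elim SigmaE)?;
        (simp only: simps mem_Sigma_iff M.a_closed A.m_closed K_smult_closed A.one_closed
          M.zero_closed prod.inject simp_thms)?; (intro conjI)?; (simp add: ring field)?)
qed

lemma fst_image_ideal:
  assumes "ideal I (trivial_extension A)"
  shows "ideal (fst ` I) A"
proof -
  interpret T: K_algebra "trivial_extension A" by (rule trivial_extension_K_algebra)
  interpret I: ideal I "trivial_extension A" by fact
  have mem: "x \<in> carrier A" "f \<in> dual A" if "(x, f) \<in> I" for x f
    using I.Icarr[OF that] by (auto simp: trivial_extension_simps)
  show ?thesis
  proof (rule idealI[OF A.ring_axioms])
    show "subgroup (fst ` I) (add_monoid A)"
    proof (rule M.add.subgroupI)
      show "fst ` I \<subseteq> carrier A" using mem by auto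
      show "fst ` I \<noteq> {}" using T.ideal_zero[OF assms] by blast
      show "\<ominus> x \<in> fst ` I" if "x \<in> fst ` I" for x
      proof -
        obtain f where f: "(x, f) \<in> I" using \<open>x \<in> fst ` I\<close> by auto
        then have "(-1) \<odot>\<^bsub>trivial_extension A\<^esub> (x, f) \<in> I"
          by (rule T.ideal_smult_closed[OF assms])
        then show ?thesis
          using mem(1)[OF f] by (force simp: trivial_extension_simps K_smult_minus)
      qed
      show "x \<oplus> y \<in> fst ` I" if "x \<in> fst ` I" "y \<in> fst ` I" for x y
      proof -
        obtain f g where "(x, f) \<in> I" "(y, g) \<in> I" using \<open>x \<in> _\<close> \<open>y \<in> _\<close> by auto
        then have "(x, f) \<oplus>\<^bsub>trivial_extension A\<^esub> (y, g) \<in> I"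
          by (rule I.a_closed)
        then show ?thesis
          by (force simp: trivial_extension_simps)
      qed
    qed
  next
    fix x y assume "x \<in> fst ` I" and y: "y \<in> carrier A"
    then obtain f where f: "(x, f) \<in> I" by auto
    have yT: "(y, \<lambda>x\<in>carrier A. 0) \<in> carrier (trivial_extension A)"
      using y by (simp add: trivial_extension_simps zero_dual)
    show "y \<otimes> x \<in> fst ` I" "x \<otimes> y \<in> fst ` I"
      using I.I_l_closed[OF f yT] I.I_r_closed[OF f yT] mem[OF f] y
      by (force simp: trivial_extension_mult)+
  qed
qed

text \<open>The summand \<open>D(A)\<close> squares to zero, so it contains no idempotent: an ideal summand of
  \<open>T(A)\<close> that vanishes in \<open>A\<close> is zero.\<close>

lemma trivial_extension_indecomposable:
  assumes "indecomposable A"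
  shows "indecomposable (trivial_extension A)"
proof -
  let ?T = "trivial_extension A"
  interpret T: K_algebra ?T by (rule trivial_extension_K_algebra)
  have nz: "carrier A \<noteq> {\<zero>}" and
    ind: "\<And>I J. \<lbrakk>ideal I A; ideal J A; I \<inter> J = {\<zero>}; I <+>\<^bsub>A\<^esub> J = carrier A\<rbrakk> \<Longrightarrow> I = {\<zero>} \<or> J = {\<zero>}"
    using assms unfolding indecomposable_def by auto
  have "carrier ?T \<noteq> {\<zero>\<^bsub>?T\<^esub>}"
    using nz zero_dual M.zero_closed by (auto simp: trivial_extension_simps)
  moreover have "I = {\<zero>\<^bsub>?T\<^esub>} \<or> J = {\<zero>\<^bsub>?T\<^esub>}"
    if I: "ideal I ?T" and J: "ideal J ?T" and IJ: "I \<inter> J = {\<zero>\<^bsub>?T\<^esub>}" and sum: "I <+>\<^bsub>?T\<^esub> J = carrier ?T" for I J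
  proof -
    interpret I: ideal I ?T by (rule I)
    interpret J: ideal J ?T by (rule J)
    have "\<one>\<^bsub>?T\<^esub> \<in> I <+>\<^bsub>?T\<^esub> J"
      using sum by simp
    then obtain e e' where e: "e \<in> I" "e' \<in> J" "\<one>\<^bsub>?T\<^esub> = e \<oplus>\<^bsub>?T\<^esub> e'"
      by (auto simp: set_add_def')
    have ec: "e \<in> carrier ?T" "e' \<in> carrier ?T"
      using e I.Icarr J.Icarr by auto
    \<comment> \<open>Both products lie in the intersection of the two ideals. Consequently the
      components of the unit act as identities on their own summands.\<close>
    have zero: "x \<otimes>\<^bsub>?T\<^esub> y = \<zero>\<^bsub>?T\<^esub>" "y \<otimes>\<^bsub>?T\<^esub> x = \<zero>\<^bsub>?T\<^esub>" if "x \<in> I" "y \<in> J" for x y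
    proof -
      note closed = I.I_r_closed[OF that(1)] J.I_l_closed[OF that(2)] I.I_l_closed[OF that(1)]
        J.I_r_closed[OF that(2)] I.Icarr[OF that(1)] J.Icarr[OF that(2)]
      show "x \<otimes>\<^bsub>?T\<^esub> y = \<zero>\<^bsub>?T\<^esub>" "y \<otimes>\<^bsub>?T\<^esub> x = \<zero>\<^bsub>?T\<^esub>"
        using closed IJ by blast+
    qed
    have Ie: "x = x \<otimes>\<^bsub>?T\<^esub> e" if "x \<in> I" for x
    proof -
      have "x \<otimes>\<^bsub>?T\<^esub> \<one>\<^bsub>?T\<^esub> = x \<otimes>\<^bsub>?T\<^esub> e \<oplus>\<^bsub>?T\<^esub> x \<otimes>\<^bsub>?T\<^esub> e'"
        using I.Icarr[OF that] ec by (simp add: e(3) T.A.r_distr)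
      then show ?thesis
        using zero[OF that e(2)] I.Icarr[OF that] ec by simp
    qed
    have Je: "x = x \<otimes>\<^bsub>?T\<^esub> e'" if "x \<in> J" for x
    proof -
      have "x \<otimes>\<^bsub>?T\<^esub> \<one>\<^bsub>?T\<^esub> = x \<otimes>\<^bsub>?T\<^esub> e \<oplus>\<^bsub>?T\<^esub> x \<otimes>\<^bsub>?T\<^esub> e'"
        using J.Icarr[OF that] ec by (simp add: e(3) T.A.r_distr)
      then show ?thesis
        using zero[OF e(1) that] J.Icarr[OF that] ec by simp
    qed
    have fst_mult: "fst (x \<otimes>\<^bsub>?T\<^esub> y) = fst x \<otimes> fst y" if "x \<in> carrier ?T" "y \<in> carrier ?T" for x y
      using that by (cases x; cases y) (simp add: trivial_extension_simps trivial_extension_mult)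
    have fst_add: "fst (x \<oplus>\<^bsub>?T\<^esub> y) = fst x \<oplus> fst y" for x y
      by (cases x; cases y) (simp add: trivial_extension_simps)
    have fst_zero: "fst \<zero>\<^bsub>?T\<^esub> = \<zero>"
      by (simp add: trivial_extension_simps)
    have square: "x \<otimes>\<^bsub>?T\<^esub> y = \<zero>\<^bsub>?T\<^esub>"
      if "x \<in> carrier ?T" "y \<in> carrier ?T" "fst x = \<zero>" "fst y = \<zero>" for x y
      using that by (cases x; cases y)
        (auto simp: trivial_extension_simps trivial_extension_mult dual_zero_apply intro!: restrict_ext)
    \<comment> \<open>A common element of the two images is fixed by the first component of
      \<open>e\<close>, since it lifts to \<open>I\<close>, and killed by it, since it also lifts to
      \<open>J\<close>.\<close>
    have "x = \<zero>" if xI: "x \<in> fst ` I" and xJ: "x \<in> fst ` J" for x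
    proof -
      obtain i j where ij: "i \<in> I" "fst i = x" "j \<in> J" "fst j = x"
        using xI xJ by auto
      have "x = fst i \<otimes> fst e"
        using Ie[OF ij(1)] fst_mult[of i e] I.Icarr[OF ij(1)] ec ij(2) by simp
      also have "\<dots> = fst (j \<otimes>\<^bsub>?T\<^esub> e)"
        using fst_mult[of j e] J.Icarr[OF ij(3)] ec ij by simp
      also have "\<dots> = \<zero>"
        using zero(2)[OF e(1) ij(3)] fst_zero by simp
      finally show ?thesis .
    qed
    moreover have "\<zero> \<in> fst ` I" "\<zero> \<in> fst ` J"
      using imageI[OF T.ideal_zero[OF I], of fst] imageI[OF T.ideal_zero[OF J], of fst]
      unfolding fst_zero .
    ultimately have int: "fst ` I \<inter> fst ` J = {\<zero>}"
      by blast
    have "x \<in> fst ` I <+>\<^bsub>A\<^esub> fst ` J" if "x \<in> carrier A" for x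
    proof -
      have "(x, \<lambda>x\<in>carrier A. 0) \<in> I <+>\<^bsub>?T\<^esub> J"
        unfolding sum using that zero_dual by (simp add: trivial_extension_simps)
      then obtain i j where "i \<in> I" "j \<in> J" "(x, \<lambda>x\<in>carrier A. 0) = i \<oplus>\<^bsub>?T\<^esub> j"
        by (auto simp: set_add_def')
      then have "x = fst i \<oplus> fst j" "fst i \<in> fst ` I" "fst j \<in> fst ` J"
        using fst_add[of i j] by (auto simp: prod_eq_iff)
      then show ?thesis
        unfolding set_add_def' by blast
    qed
    moreover have "fst ` I <+>\<^bsub>A\<^esub> fst ` J \<subseteq> carrier A"
      using I.Icarr J.Icarr by (fastforce simp: set_add_def' trivial_extension_simps)
    ultimately have "fst ` I = {\<zero>} \<or> fst ` J = {\<zero>}"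
      using ind[OF fst_image_ideal[OF I] fst_image_ideal[OF J] int] by blast
    then show ?thesis
    proof
      assume "fst ` I = {\<zero>}"
      then have "x = \<zero>\<^bsub>?T\<^esub>" if "x \<in> I" for x
        using Ie[OF that] square[of x e] that e(1) I.Icarr by auto
      then show ?thesis
        using T.ideal_zero[OF I] by auto
    next
      assume "fst ` J = {\<zero>}"
      then have "x = \<zero>\<^bsub>?T\<^esub>" if "x \<in> J" for x
        using Je[OF that] square[of x e'] that e(2) J.Icarr by auto
      then show ?thesis
        using T.ideal_zero[OF J] by auto
    qed
  qed
  ultimately show ?thesis
    unfolding indecomposable_def by blast
qed

end

section \<open>Algebras with a finite basis, and the symmetric form on the trivial extension\<close>

locale based_algebra = K_algebra A for A :: "('k::field, 'a) module" (structure) +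
  fixes B :: "'x set" and b :: "'x \<Rightarrow> 'a" and co :: "'x \<Rightarrow> 'a \<Rightarrow> 'k"
  assumes finite_B: "finite B"
    and b_closed: "x \<in> B \<Longrightarrow> b x \<in> carrier A"
    and co_dual: "x \<in> B \<Longrightarrow> co x \<in> dual A"
    and co_b: "\<lbrakk>x \<in> B; y \<in> B\<rbrakk> \<Longrightarrow> co x (b y) = (if x = y then 1 else 0)"
    and coords_zero: "\<lbrakk>a \<in> carrier A; \<And>x. x \<in> B \<Longrightarrow> co x a = 0\<rbrakk> \<Longrightarrow> a = \<zero>"
begin

lemma coords_eqI:
  assumes "a \<in> carrier A" "c \<in> carrier A" "\<And>x. x \<in> B \<Longrightarrow> co x a = co x c"
  shows "a = c"
proof -
  have "co x (a \<oplus> (-1) \<odot> c) = 0" if "x \<in> B" for x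
    using assms co_dual[OF that] that by (simp add: dual_add_apply dual_smult_apply)
  then have "a \<oplus> (-1) \<odot> c = \<zero>"
    using assms by (intro coords_zero) auto
  then show ?thesis
    using assms by (simp add: K_smult_minus flip: M.minus_eq)
qed

lemma co_lincomb: "y \<in> B \<Longrightarrow> co y (\<Oplus>x\<in>B. c x \<odot> b x) = c y"
proof -
  assume y: "y \<in> B"
  have "co y (\<Oplus>x\<in>B. c x \<odot> b x) = (\<Sum>x\<in>B. if x = y then c x else 0)"
    using y by (subst dual_finsum[OF co_dual finite_B])
      (auto simp: b_closed co_b dual_smult_apply[OF co_dual] intro!: sum.cong)
  also have "\<dots> = c y"
    using y finite_B by simp
  finally show ?thesis .
qed

lemma lincomb_closed: "(\<Oplus>x\<in>B. c x \<odot> b x) \<in> carrier A"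
  by (rule M.finsum_closed) (auto simp: b_closed)

text \<open>Spanning is not an axiom of \<open>based_algebra\<close>: it follows because both sides
  have the same coordinates and coordinates determine an element.\<close>

lemma expansion: "a \<in> carrier A \<Longrightarrow> a = (\<Oplus>x\<in>B. co x a \<odot> b x)"
  by (rule coords_eqI) (simp_all add: lincomb_closed co_lincomb)

lemma dual_basis_eqI:
  assumes "f \<in> dual A" "g \<in> dual A" "\<And>x. x \<in> B \<Longrightarrow> f (b x) = g (b x)"
  shows "f = g"
proof (rule dual_eqI[OF assms(1,2)])
  fix a assume a: "a \<in> carrier A"
  have eq: "h a = (\<Sum>x\<in>B. co x a * h (b x))" if "h \<in> dual A" for h
    by (subst expansion[OF a], subst dual_finsum[OF that finite_B])
      (auto simp: b_closed dual_smult_apply[OF that])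
  show "f a = g a"
    unfolding eq[OF assms(1)] eq[OF assms(2)] using assms(3) by simp
qed

lemma inj_on_b: "inj_on b B"
proof (rule inj_onI)
  fix x y assume "x \<in> B" "y \<in> B" "b x = b y"
  then show "x = y"
    using co_b[of x y] co_b[of x x] by (auto split: if_splits)
qed

lemma finite_dimensional: "finite_dimensional A"
  unfolding finite_dimensional_def
proof (intro exI[of _ "b ` B"] conjI ballI)
  fix a assume a: "a \<in> carrier A"
  have "a = (\<Oplus>x\<in>B. co (inv_into B b (b x)) a \<odot> b x)"
    by (subst expansion[OF a], rule M.finsum_cong) (auto simp: b_closed inj_on_b inv_into_f_f simp_implies_def)
  also have "\<dots> = (\<Oplus>s\<in>b ` B. co (inv_into B b s) a \<odot> s)"
    by (rule M.finsum_reindex[symmetric]) (auto simp: b_closed inj_on_b)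
  finally show "\<exists>c. a = (\<Oplus>s\<in>b ` B. c s \<odot> s)"
    by (rule exI[of _ "\<lambda>s. co (inv_into B b s) a"])
qed (auto simp: finite_B b_closed)

definition T_basis :: "'x + 'x \<Rightarrow> 'a \<times> ('a \<Rightarrow> 'k)" where
  "T_basis = case_sum (\<lambda>x. (b x, \<lambda>a\<in>carrier A. 0)) (\<lambda>x. (\<zero>, co x))"

definition T_coord :: "'x + 'x \<Rightarrow> 'a \<times> ('a \<Rightarrow> 'k) \<Rightarrow> 'k" where
  "T_coord = case_sum (\<lambda>x. \<lambda>(a, f)\<in>carrier A \<times> dual A. co x a) (\<lambda>x. \<lambda>(a, f)\<in>carrier A \<times> dual A. f (b x))"

lemma T_based: "based_algebra (trivial_extension A) (B <+> B) T_basis T_coord"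
proof -
  interpret T: K_algebra "trivial_extension A" by (rule trivial_extension_K_algebra)
  show ?thesis
  proof
    show "finite (B <+> B)" using finite_B by simp
    show "T_basis x \<in> carrier (trivial_extension A)" if "x \<in> B <+> B" for x
      using that by (auto simp: T_basis_def trivial_extension_simps b_closed zero_dual co_dual)
    show "T_coord x \<in> dual (trivial_extension A)" if "x \<in> B <+> B" for x
      using that
      by (auto simp: T_coord_def trivial_extension_simps dual_add_closed dual_smult_closed b_closed
          dual_add_value dual_smult_value dual_add_apply[OF co_dual] dual_smult_apply[OF co_dual]
          intro!: dualI)
    show "T_coord x (T_basis y) = (if x = y then 1 else 0)" if "x \<in> B <+> B" "y \<in> B <+> B" for x y
      using that by (auto simp: T_coord_def T_basis_def b_closed zero_dual co_dual co_b
          dual_zero_apply[OF co_dual] split: if_splits)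
    show "a = \<zero>\<^bsub>trivial_extension A\<^esub>"
      if a: "a \<in> carrier (trivial_extension A)" and zero: "\<And>x. x \<in> B <+> B \<Longrightarrow> T_coord x a = 0" for a
    proof -
      obtain c f where cf: "a = (c, f)" "c \<in> carrier A" "f \<in> dual A"
        using a by (auto simp: trivial_extension_simps)
      have "co x c = 0" "f (b x) = 0" if "x \<in> B" for x
        using zero[of "Inl x"] zero[of "Inr x"] that cf by (auto simp: T_coord_def)
      then have "c = \<zero>" "f = (\<lambda>x\<in>carrier A. 0)"
        using cf by (auto intro!: coords_zero dual_basis_eqI simp: zero_dual b_closed)
      then show ?thesis
        using cf by (simp add: trivial_extension_simps)
    qed
  qed
qed

text \<open>The form pairs \<open>(a, f)\<close> with \<open>(c, g)\<close> to
  \<open>g a + f c\<close>, which is symmetric in the two arguments. Symmetry makes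
  \<open>\<phi>\<close> a bimodule map, and the finite basis makes it bijective.\<close>

lemma T_symmetric: "symmetric_algebra (trivial_extension A)"
proof -
  let ?T = "trivial_extension A"
  interpret T: based_algebra ?T "B <+> B" T_basis T_coord by (rule T_based)
  define \<tau> where "\<tau> = (\<lambda>(a :: 'a, f). f \<one> :: 'k)"
  define \<phi> where "\<phi> = (\<lambda>x. \<lambda>y\<in>carrier ?T. \<tau> (x \<otimes>\<^bsub>?T\<^esub> y))"
  have \<tau>_mult: "\<tau> ((a, f) \<otimes>\<^bsub>?T\<^esub> (c, g)) = g a + f c"
    if "a \<in> carrier A" "c \<in> carrier A" for a c f g
    using that by (simp add: \<tau>_def trivial_extension_mult)
  have \<tau>_comm: "\<tau> (x \<otimes>\<^bsub>?T\<^esub> y) = \<tau> (y \<otimes>\<^bsub>?T\<^esub> x)" if "x \<in> carrier ?T" "y \<in> carrier ?T" for x y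
    using that by (cases x; cases y) (simp add: \<tau>_mult trivial_extension_simps)
  have \<tau>_lin: "\<tau> (x \<oplus>\<^bsub>?T\<^esub> y) = \<tau> x + \<tau> y" "\<tau> (c \<odot>\<^bsub>?T\<^esub> x) = c * \<tau> x"
    if "x \<in> carrier ?T" "y \<in> carrier ?T" for x y c
    using that by (cases x; cases y; simp add: \<tau>_def trivial_extension_simps dual_add_def dual_smult_def)+
  have \<phi>_dual: "\<phi> x \<in> dual ?T" if "x \<in> carrier ?T" for x
    unfolding \<phi>_def using that
    by (intro dualI) (simp_all add: T.A.r_distr T.smult_mult_right \<tau>_lin)
  have "\<phi> (x \<oplus>\<^bsub>?T\<^esub> y) = dual_add ?T (\<phi> x) (\<phi> y)" if "x \<in> carrier ?T" "y \<in> carrier ?T" for x y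
    using that by (auto simp: \<phi>_def dual_add_def T.A.l_distr \<tau>_lin intro!: restrict_ext)
  moreover have "\<phi> (c \<odot>\<^bsub>?T\<^esub> x) = dual_smult ?T c (\<phi> x)" if "x \<in> carrier ?T" for x c
    using that by (auto simp: \<phi>_def dual_smult_def T.smult_mult_left \<tau>_lin intro!: restrict_ext)
  moreover have "\<phi> (a \<otimes>\<^bsub>?T\<^esub> x \<otimes>\<^bsub>?T\<^esub> c) = dual_act ?T a (\<phi> x) c"
    if "a \<in> carrier ?T" "x \<in> carrier ?T" "c \<in> carrier ?T" for a x c
  proof -
    \<comment> \<open>Symmetry of the form gives invariance of \<open>\<tau>\<close> under cyclic
      rotation, which moves \<open>a\<close> from the front to the end.\<close>
    have "\<tau> (a \<otimes>\<^bsub>?T\<^esub> x \<otimes>\<^bsub>?T\<^esub> c \<otimes>\<^bsub>?T\<^esub> y) = \<tau> (x \<otimes>\<^bsub>?T\<^esub> (c \<otimes>\<^bsub>?T\<^esub> y \<otimes>\<^bsub>?T\<^esub> a))" if "y \<in> carrier ?T" for y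
      using \<tau>_comm[of a "x \<otimes>\<^bsub>?T\<^esub> c \<otimes>\<^bsub>?T\<^esub> y"] that \<open>a \<in> _\<close> \<open>x \<in> _\<close> \<open>c \<in> _\<close> by (simp add: T.A.m_assoc)
    then show ?thesis
      using that by (auto simp: \<phi>_def dual_act_def intro!: restrict_ext)
  qed
  moreover have "bij_betw \<phi> (carrier ?T) (dual ?T)"
  proof (rule bij_betwI')
    show "(\<phi> x = \<phi> y) = (x = y)" if xy: "x \<in> carrier ?T" "y \<in> carrier ?T" for x y
    proof
      assume eq: "\<phi> x = \<phi> y"
      obtain a f c g where x: "x = (a, f)" "a \<in> carrier A" "f \<in> dual A"
        and y: "y = (c, g)" "c \<in> carrier A" "g \<in> dual A"
        using xy by (auto simp: trivial_extension_simps)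
      \<comment> \<open>Testing against \<open>(z, h)\<close> separates the two parts:
        \<open>h = 0\<close> recovers the functional, while \<open>z = 0\<close> with a coordinate
        functional \<open>h\<close> recovers the coordinates of the element.\<close>
      have ev: "h a + f z = h c + g z" if "z \<in> carrier A" "h \<in> dual A" for h z
        using fun_cong[OF eq, of "(z, h)"] x y that
        by (simp add: \<phi>_def \<tau>_mult trivial_extension_simps)
      have "f z = g z" if "z \<in> carrier A" for z
        using ev[OF that zero_dual] x y by simp
      moreover have "co i a = co i c" if "i \<in> B" for i
        using ev[OF M.zero_closed co_dual[OF that]] x y by (simp add: dual_zero_apply)
      ultimately show "x = y"
        using x y by (auto intro: coords_eqI dual_eqI)
    qed simp
    show "\<phi> x \<in> dual ?T" if "x \<in> carrier ?T" for x
      by (rule \<phi>_dual[OF that])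
    show "\<exists>x\<in>carrier ?T. F = \<phi> x" if F: "F \<in> dual ?T" for F
    proof -
      \<comment> \<open>The preimage of \<open>F\<close>: its restriction to \<open>A\<close> is the
        functional part. Its restriction to the dual is evaluation at an element, whose coordinates
        are the values of \<open>F\<close> on the dual basis.\<close>
      define f where "f = (\<lambda>a\<in>carrier A. F (a, \<lambda>x\<in>carrier A. 0))"
      define a where "a = (\<Oplus>x\<in>B. F (\<zero>, co x) \<odot> b x)"
      have add0: "dual_add A (\<lambda>x\<in>carrier A. 0) (\<lambda>x\<in>carrier A. 0) = (\<lambda>x\<in>carrier A. 0)"
        "dual_smult A c (\<lambda>x\<in>carrier A. 0) = (\<lambda>x\<in>carrier A. 0)" for c
        by (simp_all add: dual_add_def dual_smult_def cong: restrict_cong)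
      have f: "f \<in> dual A"
      proof (rule dualI)
        show "f (x \<oplus> y) = f x + f y" if "x \<in> carrier A" "y \<in> carrier A" for x y
          using T.dual_add_apply[OF F, of "(x, \<lambda>x\<in>carrier A. 0)" "(y, \<lambda>x\<in>carrier A. 0)"] that
          by (simp add: f_def trivial_extension_simps zero_dual add0)
        show "f (c \<odot> x) = c * f x" if "x \<in> carrier A" for x c
          using T.dual_smult_apply[OF F, of "(x, \<lambda>x\<in>carrier A. 0)" c] that
          by (simp add: f_def trivial_extension_simps zero_dual add0)
      qed (simp add: f_def)
      have a: "a \<in> carrier A"
        unfolding a_def by (rule lincomb_closed)
      have af: "(a, f) \<in> carrier ?T"
        using a f by (simp add: trivial_extension_simps)
      have "F = \<phi> (a, f)"
      proof (rule T.dual_basis_eqI[OF F \<phi>_dual[OF af]])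
        fix x assume x: "x \<in> B <+> B"
        have Tb: "T_basis x \<in> carrier ?T"
          using T.b_closed[OF x] .
        have F0: "F (\<zero>, \<lambda>x\<in>carrier A. 0) = 0"
          using T.dual_zero_apply[OF F] by (simp add: trivial_extension_simps)
        have co_a: "co i a = F (\<zero>, co i)" if "i \<in> B" for i
          unfolding a_def by (rule co_lincomb[OF that])
        from x show "F (T_basis x) = \<phi> (a, f) (T_basis x)"
        proof
          fix i assume "x = Inl i" "i \<in> B"
          then show ?thesis
            using Tb a b_closed[of i] by (simp add: \<phi>_def T_basis_def \<tau>_mult f_def)
        next
          fix i assume "x = Inr i" "i \<in> B"
          then show ?thesis
            using Tb a co_a[of i] F0 by (simp add: \<phi>_def T_basis_def \<tau>_mult f_def)
        qed
      qed
      then show ?thesis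
        using af by blast
    qed
  qed
  ultimately show ?thesis
    unfolding symmetric_algebra_def by (intro exI[of _ \<phi>] conjI) blast+
qed

end

section \<open>Presentations of algebras by quivers\<close>

text \<open>Orthogonal idempotents with sum one and arrow images lying between them are the data in
  the universal property of the path algebra; \<open>lin\<close> is the resulting
  homomorphism.\<close>

locale path_representation = quiver Q + based_algebra T B b co
  for Q :: "('v, 'e) pre_digraph" and T :: "('k::field, 't) module" (structure)
    and B :: "'x set" and b co +
  fixes E :: "'v \<Rightarrow> 't" and ar :: "'e \<Rightarrow> 't"
  assumes E_closed: "v \<in> verts Q \<Longrightarrow> E v \<in> carrier T"
    and ar_closed: "a \<in> arcs Q \<Longrightarrow> ar a \<in> carrier T"
    and E_mult: "\<lbrakk>u \<in> verts Q; v \<in> verts Q\<rbrakk> \<Longrightarrow> E u \<otimes> E v = (if u = v then E u else \<zero>)"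
    and E_ar: "a \<in> arcs Q \<Longrightarrow> E (tail Q a) \<otimes> ar a = ar a"
    and ar_E: "a \<in> arcs Q \<Longrightarrow> ar a \<otimes> E (head Q a) = ar a"
    and E_sum: "(\<Oplus>v\<in>verts Q. E v) = \<one>"
begin

definition path_image :: "('v, 'e) path \<Rightarrow> 't" where
  "path_image p = foldl (\<otimes>) (E (fst p)) (map ar (snd p))"

lemma path_image_Nil [simp]: "path_image (u, []) = E u"
  and path_image_snoc: "path_image (u, p @ [a]) = path_image (u, p) \<otimes> ar a"
  by (simp_all add: path_image_def)

lemma path_image_closed: "p \<in> paths Q \<Longrightarrow> path_image p \<in> carrier T"
proof (cases p)
  case (Pair u as)
  show "p \<in> paths Q \<Longrightarrow> path_image p \<in> carrier T"
    unfolding Pair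
    by (induction as rule: rev_induct) (auto simp: E_closed ar_closed path_image_snoc paths_snoc_iff)
qed

lemma path_image_single: "a \<in> arcs Q \<Longrightarrow> path_image (tail Q a, [a]) = ar a"
  by (simp add: path_image_def E_ar)

lemma path_image_end:
  assumes "(u, as) \<in> paths Q"
  shows "path_image (u, as) \<otimes> E (path_end Q (u, as)) = path_image (u, as)"
proof (cases as rule: rev_cases)
  case Nil
  then show ?thesis using assms by (simp add: E_mult)
next
  case (snoc bs a)
  then show ?thesis
    using assms by (simp add: path_image_snoc paths_snoc_iff A.m_assoc path_image_closed
      ar_closed E_closed ar_E)
qed

text \<open>The image of a path absorbs the idempotent at its end, so orthogonality of the
  idempotents kills exactly the products of paths that do not compose.\<close>

lemma path_image_mult:
  assumes "(u, as) \<in> paths Q" "(v, bs) \<in> paths Q"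
  shows "path_image (u, as) \<otimes> path_image (v, bs)
    = (if path_end Q (u, as) = v then path_image (u, as @ bs) else \<zero>)"
  using assms(2)
proof (induction bs rule: rev_induct)
  case Nil
  let ?w = "path_end Q (u, as)"
  have w: "?w \<in> verts Q" "v \<in> verts Q"
    using assms(1) Nil path_end_in_verts by auto
  have "path_image (u, as) \<otimes> E v = path_image (u, as) \<otimes> (E ?w \<otimes> E v)"
    using path_image_end[OF assms(1)] w path_image_closed[OF assms(1)]
    by (simp add: E_closed flip: A.m_assoc)
  also have "\<dots> = (if ?w = v then path_image (u, as) else \<zero>)"
    using path_image_end[OF assms(1)] w path_image_closed[OF assms(1)] by (auto simp: E_mult)
  finally show ?case by simp
next
  case (snoc a bs)
  then have *: "(v, bs) \<in> paths Q" "a \<in> arcs Q"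
    by (auto simp: paths_snoc_iff)
  have "path_image (u, as) \<otimes> path_image (v, bs @ [a]) = (path_image (u, as) \<otimes> path_image (v, bs)) \<otimes> ar a"
    using * path_image_closed assms(1) by (simp add: path_image_snoc A.m_assoc ar_closed)
  also have "\<dots> = (if path_end Q (u, as) = v then path_image (u, as @ bs @ [a]) else \<zero>)"
    using snoc.IH * path_image_snoc[of u "as @ bs" a] by (simp add: ar_closed)
  finally show ?case .
qed

definition lin :: "(('v, 'e) path \<Rightarrow> 'k) \<Rightarrow> 't" where
  "lin f = (\<Oplus>p\<in>{p. f p \<noteq> 0}. f p \<odot> path_image p)"

lemma lin_eq:
  assumes "finite S" "S \<subseteq> paths Q" "{p. f p \<noteq> 0} \<subseteq> S"
  shows "lin f = (\<Oplus>p\<in>S. f p \<odot> path_image p)"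
  unfolding lin_def
  by (rule M.add.finprod_mono_neutral_cong_left) (use assms path_image_closed in auto)

lemma lin_closed: "f \<in> carrier PA \<Longrightarrow> lin f \<in> carrier T"
  unfolding lin_def by (rule M.finsum_closed) (auto simp: path_algebra_simps(1) path_image_closed)

lemma lin_add:
  assumes "f \<in> carrier PA" "g \<in> carrier PA"
  shows "lin (f \<oplus>\<^bsub>PA\<^esub> g) = lin f \<oplus> lin g"
proof -
  define S where "S = {p. f p \<noteq> 0} \<union> {p. g p \<noteq> 0}"
  have S: "finite S" "S \<subseteq> paths Q"
    using assms by (auto simp: S_def path_algebra_simps(1))
  have "lin (f \<oplus>\<^bsub>PA\<^esub> g) = (\<Oplus>p\<in>S. (f \<oplus>\<^bsub>PA\<^esub> g) p \<odot> path_image p)"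
    by (rule lin_eq[OF S]) (auto simp: S_def path_algebra_simps)
  also have "\<dots> = (\<Oplus>p\<in>S. f p \<odot> path_image p \<oplus> g p \<odot> path_image p)"
    by (rule M.finsum_cong') (use S path_image_closed in \<open>auto simp: K_smult_distr path_algebra_simps\<close>)
  also have "\<dots> = (\<Oplus>p\<in>S. f p \<odot> path_image p) \<oplus> (\<Oplus>p\<in>S. g p \<odot> path_image p)"
    by (rule M.finsum_addf) (use S path_image_closed in auto)
  also have "\<dots> = lin f \<oplus> lin g"
    by (subst (1 2) lin_eq[OF S]) (auto simp: S_def)
  finally show ?thesis .
qed

lemma lin_smult:
  assumes "f \<in> carrier PA"
  shows "lin (c \<odot>\<^bsub>PA\<^esub> f) = c \<odot> lin f"
proof -
  define S where "S = {p. f p \<noteq> 0}"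
  have S: "finite S" "S \<subseteq> paths Q"
    using assms by (auto simp: S_def path_algebra_simps(1))
  have "lin (c \<odot>\<^bsub>PA\<^esub> f) = (\<Oplus>p\<in>S. (c \<odot>\<^bsub>PA\<^esub> f) p \<odot> path_image p)"
    by (rule lin_eq[OF S]) (auto simp: S_def path_algebra_simps)
  also have "\<dots> = (\<Oplus>p\<in>S. c \<odot> (f p \<odot> path_image p))"
    by (rule M.finsum_cong') (use S path_image_closed in \<open>auto simp: K_smult_assoc path_algebra_simps\<close>)
  also have "\<dots> = c \<odot> lin f"
    unfolding lin_def S_def[symmetric]
    by (rule finsum_smult_ldistr[symmetric]) (use S path_image_closed in auto)
  finally show ?thesis .
qed

lemma lin_zero: "lin \<zero>\<^bsub>PA\<^esub> = \<zero>"
  by (simp add: lin_def path_algebra_simps)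

lemma lin_path_elem: "p \<in> paths Q \<Longrightarrow> lin (path_elem p) = path_image p"
  by (subst lin_eq[of "{p}"]) (auto simp: path_elem_def path_image_closed)

lemma lin_one: "lin \<one>\<^bsub>PA\<^esub> = \<one>"
proof -
  have "lin \<one>\<^bsub>PA\<^esub> = (\<Oplus>p\<in>(\<lambda>v. (v, [])) ` verts Q. \<one>\<^bsub>PA\<^esub> p \<odot> path_image p)"
    by (rule lin_eq) (auto simp: path_algebra_simps split: if_splits)
  also have "\<dots> = (\<Oplus>v\<in>verts Q. \<one>\<^bsub>PA\<^esub> (v, []) \<odot> path_image (v, []))"
    by (rule M.finsum_reindex) (auto simp: path_image_closed E_closed inj_on_def)
  also have "\<dots> = (\<Oplus>v\<in>verts Q. E v)"
    by (rule M.finsum_cong') (auto simp: E_closed path_algebra_simps)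
  finally show ?thesis
    by (simp add: E_sum)
qed

lemma lin_mult:
  assumes "f \<in> carrier PA" "g \<in> carrier PA"
  shows "lin (f \<otimes>\<^bsub>PA\<^esub> g) = lin f \<otimes> lin g"
  using assms(1)
proof (induction rule: path_algebra_induct)
  case zero
  show ?case
    using assms lin_closed by (simp add: path_algebra_bilinear lin_zero)
next
  case (add c p f)
  have "lin (path_elem p \<otimes>\<^bsub>PA\<^esub> g) = lin (path_elem p) \<otimes> lin g"
    using assms(2)
  proof (induction rule: path_algebra_induct)
    case zero
    show ?case
      using \<open>p \<in> paths Q\<close> lin_closed by (simp add: path_algebra_bilinear lin_zero)
  next
    case (add d q g)
    have "lin (path_elem p \<otimes>\<^bsub>PA\<^esub> path_elem q) = lin (path_elem p) \<otimes> lin (path_elem q)"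
      using \<open>p \<in> paths Q\<close> \<open>q \<in> paths Q\<close> path_image_mult
      by (cases p; cases q) (auto simp: path_elem_mult lin_path_elem lin_zero paths_append_iff)
    with add \<open>p \<in> paths Q\<close> show ?case
      by (simp add: path_algebra_bilinear lin_add lin_smult path_algebra_closed path_algebra_mult_closed
        lin_closed A.r_distr smult_mult_right)
  qed
  with add assms(2) show ?case
    by (simp add: path_algebra_bilinear lin_add lin_smult path_algebra_closed path_algebra_mult_closed
        lin_closed A.l_distr smult_mult_left)
qed

lemma lin_kernel_ideal: "ideal {f \<in> carrier PA. lin f = \<zero>} PA"
proof -
  interpret P: K_algebra "PA :: ('k, _) module" by (rule path_algebra_K_algebra)
  show ?thesis
  proof (rule idealI[OF P.A.ring_axioms])
    show "subgroup {f \<in> carrier PA. lin f = \<zero>} (add_monoid PA)"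
      by (rule P.M.add.subgroupI)
        (auto simp: lin_add lin_zero lin_smult lin_closed path_algebra_closed simp flip: P.K_smult_minus)
  qed (auto simp: lin_mult lin_closed path_algebra_mult_closed)
qed

text \<open>To see that \<open>J\<close> contains the kernel, lift \<open>lin f\<close> back to the span of chosen paths that
  represent the basis: modulo \<open>J\<close> this lift agrees with \<open>f\<close> on every path, hence on all of the
  path algebra.\<close>

theorem presentation:
  fixes J :: "(('v, 'e) path \<Rightarrow> 'k) set" and \<beta> :: "('v, 'e) path \<Rightarrow> 'x"
  assumes J: "ideal J PA" and J_lin: "\<And>f. f \<in> J \<Longrightarrow> lin f = \<zero>"
    and N: "N \<subseteq> paths Q" and notN: "\<And>p. \<lbrakk>p \<in> paths Q; p \<notin> N\<rbrakk> \<Longrightarrow> path_elem p \<in> J"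
    and \<beta>: "\<beta> ` N = B" and image: "\<And>p. p \<in> N \<Longrightarrow> path_image p = b (\<beta> p)"
    and same: "\<And>p q. \<lbrakk>p \<in> N; q \<in> N; \<beta> p = \<beta> q\<rbrakk> \<Longrightarrow> path_elem p \<ominus>\<^bsub>PA\<^esub> path_elem q \<in> J"
  shows "algebra_isomorphic T (quotient_algebra PA J)"
proof -
  interpret P: K_algebra "PA :: ('k, _) module" by (rule path_algebra_K_algebra)
  interpret J: ideal J "PA :: ('k, _) module" by (rule J)
  define rep where "rep x = (SOME p. p \<in> N \<and> \<beta> p = x)" for x
  have rep: "rep x \<in> N" "\<beta> (rep x) = x" if "x \<in> B" for x
    using someI_ex[of "\<lambda>p. p \<in> N \<and> \<beta> p = x"] that \<beta> by (auto simp: rep_def)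
  \<comment> \<open>The linear section that sends each basis element to its chosen path. Since
    \<open>\<sigma>\<close> is linear, the claim \<open>lift\<close> below reduces to single
    paths.\<close>
  define \<sigma> where "\<sigma> t = (\<lambda>q. \<Sum>x\<in>B. co x t * path_elem (rep x) q)" for t
  have \<sigma>_add: "\<sigma> (s \<oplus> t) = \<sigma> s \<oplus>\<^bsub>PA\<^esub> \<sigma> t" if "s \<in> carrier T" "t \<in> carrier T" for s t
    using that by (auto simp: \<sigma>_def path_algebra_simps fun_eq_iff dual_add_apply[OF co_dual]
        algebra_simps sum.distrib)
  have \<sigma>_smult: "\<sigma> (c \<odot> t) = c \<odot>\<^bsub>PA\<^esub> \<sigma> t" if "t \<in> carrier T" for c t
    using that by (auto simp: \<sigma>_def path_algebra_simps fun_eq_iff dual_smult_apply[OF co_dual]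
        sum_distrib_left mult.assoc intro!: sum.cong)
  have \<sigma>_zero: "\<sigma> \<zero> = \<zero>\<^bsub>PA\<^esub>"
    by (auto simp: \<sigma>_def path_algebra_simps dual_zero_apply[OF co_dual])
  have \<sigma>_b: "\<sigma> (b y) = path_elem (rep y)" if y: "y \<in> B" for y
  proof
    fix q
    have "\<sigma> (b y) q = (\<Sum>x\<in>B. if x = y then path_elem (rep y) q else 0)"
      unfolding \<sigma>_def using y by (intro sum.cong) (auto simp: co_b)
    then show "\<sigma> (b y) q = path_elem (rep y) q"
      using y finite_B by simp
  qed
  have lift: "f \<oplus>\<^bsub>PA\<^esub> (-1) \<odot>\<^bsub>PA\<^esub> \<sigma> (lin f) \<in> J" if "f \<in> carrier PA" for f
    using that
  proof (induction rule: path_algebra_induct)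
    case zero
    have "\<zero>\<^bsub>PA\<^esub> \<oplus>\<^bsub>PA\<^esub> (-1) \<odot>\<^bsub>PA\<^esub> \<sigma> (lin \<zero>\<^bsub>PA\<^esub>) = \<zero>\<^bsub>PA\<^esub>"
      by (simp add: lin_zero \<sigma>_zero)
    then show ?case
      using P.ideal_zero[OF J] by simp
  next
    case (add c p g)
    \<comment> \<open>For \<open>p\<close> in \<open>N\<close> the lift is another path with the
      same label, equal to \<open>p\<close> modulo \<open>J\<close> by \<open>same\<close>. For the
      remaining paths both \<open>p\<close> and its image are negligible.\<close>
    have "path_elem p \<oplus>\<^bsub>PA\<^esub> (-1) \<odot>\<^bsub>PA\<^esub> \<sigma> (path_image p) \<in> J"
    proof (cases "p \<in> N")
      case True
      then have x: "\<beta> p \<in> B"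
        using \<beta> by auto
      have "path_elem p \<ominus>\<^bsub>PA\<^esub> path_elem (rep (\<beta> p)) \<in> J"
        using same[OF True rep(1)[OF x]] rep(2)[OF x] by simp
      moreover have "path_elem (rep (\<beta> p)) \<in> carrier (PA :: ('k, _) module)"
        using rep(1)[OF x] N by auto
      ultimately show ?thesis
        using image[OF True] \<sigma>_b[OF x] by (simp add: P.K_smult_minus P.M.minus_eq)
    next
      case False
      then have "path_elem p \<in> J"
        using notN add by simp
      moreover have "path_image p = \<zero>"
        using J_lin[OF calculation] lin_path_elem add by simp
      ultimately show ?thesis
        using add by (simp add: \<sigma>_zero)
    qed
    then have "c \<odot>\<^bsub>PA\<^esub> (path_elem p \<oplus>\<^bsub>PA\<^esub> (-1) \<odot>\<^bsub>PA\<^esub> \<sigma> (path_image p)) \<oplus>\<^bsub>PA\<^esub>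
        (g \<oplus>\<^bsub>PA\<^esub> (-1) \<odot>\<^bsub>PA\<^esub> \<sigma> (lin g)) \<in> J"
      using add.IH P.ideal_smult_closed[OF J] J.a_closed by blast
    also have "c \<odot>\<^bsub>PA\<^esub> (path_elem p \<oplus>\<^bsub>PA\<^esub> (-1) \<odot>\<^bsub>PA\<^esub> \<sigma> (path_image p)) \<oplus>\<^bsub>PA\<^esub>
        (g \<oplus>\<^bsub>PA\<^esub> (-1) \<odot>\<^bsub>PA\<^esub> \<sigma> (lin g))
      = (c \<odot>\<^bsub>PA\<^esub> path_elem p \<oplus>\<^bsub>PA\<^esub> g) \<oplus>\<^bsub>PA\<^esub>
        (-1) \<odot>\<^bsub>PA\<^esub> \<sigma> (lin (c \<odot>\<^bsub>PA\<^esub> path_elem p \<oplus>\<^bsub>PA\<^esub> g))"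
      using add by (simp add: lin_add lin_smult lin_path_elem path_algebra_closed \<sigma>_add \<sigma>_smult
          path_image_closed lin_closed) (simp add: path_algebra_simps algebra_simps fun_eq_iff)
    finally show ?case .
  qed
  have "\<exists>f\<in>carrier PA. lin f = (\<Oplus>x\<in>S. c x \<odot> b x)" if "finite S" "S \<subseteq> B" for S c
    using that
  proof (induction S rule: finite_induct)
    case empty
    then show ?case
      by (intro bexI[of _ "\<zero>\<^bsub>PA\<^esub>"]) (simp_all add: lin_zero path_algebra_closed)
  next
    case (insert x S)
    then obtain f where f: "f \<in> carrier PA" "lin f = (\<Oplus>x\<in>S. c x \<odot> b x)"
      by auto
    have x: "x \<in> B" "rep x \<in> N" "rep x \<in> paths Q"
      using insert rep N by auto
    have "(\<Oplus>x\<in>insert x S. c x \<odot> b x) = c x \<odot> b x \<oplus> lin f"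
      using insert b_closed by (subst M.finsum_insert) (auto simp: f)
    also have "\<dots> = lin (c x \<odot>\<^bsub>PA\<^esub> path_elem (rep x) \<oplus>\<^bsub>PA\<^esub> f)"
      using x f image[OF x(2)] rep(2)[OF x(1)]
      by (simp add: lin_add lin_smult lin_path_elem path_algebra_closed)
    finally show ?case
      using x f by (intro bexI[of _ "c x \<odot>\<^bsub>PA\<^esub> path_elem (rep x) \<oplus>\<^bsub>PA\<^esub> f"])
        (simp_all add: path_algebra_closed)
  qed
  from this[OF finite_B subset_refl] have "\<exists>f\<in>carrier PA. t = lin f" if "t \<in> carrier T" for t
    using expansion[OF that] by metis
  then have surj: "lin ` carrier PA = carrier T"
    using lin_closed unfolding image_def by blast
  \<comment> \<open>If \<open>lin f\<close> vanishes, its lift vanishes too, and \<open>lift\<close>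
    leaves \<open>f\<close> itself in \<open>J\<close>.\<close>
  have ker: "lin f = \<zero> \<longleftrightarrow> f \<in> J" if "f \<in> carrier PA" for f
    using lift[OF that] J_lin[of f] that by (auto simp: \<sigma>_zero)
  show ?thesis
    by (rule P.first_isomorphism[OF J K_algebra_axioms surj])
      (simp_all add: lin_add lin_mult lin_one lin_smult ker)
qed

end

section \<open>Almost gentle algebras\<close>

lemma not_successivelyE:
  assumes "\<not> successively P xs"
  obtains ys a b zs where "xs = ys @ a # b # zs" "\<not> P a b"
proof -
  have "\<exists>ys a b zs. xs = ys @ a # b # zs \<and> \<not> P a b"
    using assms
  proof (induction P xs rule: successively.induct)
    case (3 P x y xs)
    show ?case
    proof (cases "P x y")
      case True
      then obtain ys a b zs where "y # xs = ys @ a # b # zs" "\<not> P a b"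
        using 3 by auto
      then have "x # y # xs = (x # ys) @ a # b # zs" by simp
      with \<open>\<not> P a b\<close> show ?thesis by blast
    next
      case False
      then have "x # y # xs = [] @ x # y # xs \<and> \<not> P x y" by simp
      then show ?thesis by blast
    qed
  qed auto
  then show ?thesis using that by blast
qed

text \<open>The relation is a partial injection without cycles. Following it from an element without
  predecessor must stop, and chains from different starting points cannot merge. The last conclusion
  is maximality: a chain ends only where no successor exists.\<close>

lemma chain_decomposition:
  fixes R :: "'e rel"
  assumes fin: "finite S" and R: "R \<subseteq> S \<times> S" and sv: "single_valued R" and inj: "single_valued (R\<inverse>)"
    and acyc: "acyclic R"
  obtains M :: nat and L c
  where "\<forall>k<M. 0 < L k"
    and "bij_betw (\<lambda>(k, i). c k i) {(k, i). k < M \<and> i < L k} S"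
    and "\<forall>k<M. \<forall>i. Suc i < L k \<longrightarrow> (c k i, c k (Suc i)) \<in> R"
    and "\<forall>k<M. \<forall>i<L k. \<forall>b. (c k i, b) \<in> R \<longrightarrow> Suc i < L k \<and> b = c k (Suc i)"
proof -
  have finR: "finite R"
    using R fin by (meson finite_SigmaI finite_subset)
  have wfR: "wf R" and wfR': "wf (R\<inverse>)"
    using finR acyc by (auto intro: finite_acyclic_wf finite_acyclic_wf_converse)
  define nx where "nx a = (SOME b. (a, b) \<in> R)" for a
  have nx: "(a, nx a) \<in> R" if "a \<in> Domain R" for a
    using that someI_ex[of "\<lambda>b. (a, b) \<in> R"] by (auto simp: nx_def)
  have nx_eq: "b = nx a" if "(a, b) \<in> R" for a b
    using nx[of a] that sv by (auto simp: single_valued_def)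
  define d where "d a i = (nx ^^ i) a" for a i
  have ex: "\<exists>i. d a i \<notin> Domain R" for a
    using wfR'
  proof (induction a rule: wf_induct_rule)
    case (less a)
    show ?case
    proof (cases "a \<in> Domain R")
      case True
      then obtain i where "d (nx a) i \<notin> Domain R"
        using less nx by blast
      then have "d a (Suc i) \<notin> Domain R"
        by (simp add: d_def funpow_swap1)
      then show ?thesis ..
    next
      case False
      then have "d a 0 \<notin> Domain R" by (simp add: d_def)
      then show ?thesis ..
    qed
  qed
  \<comment> \<open>\<open>l a\<close> counts steps, not elements: the chain starting at
    \<open>a\<close> has \<open>Suc (l a)\<close> members.\<close>
  define l where "l a = (LEAST i. d a i \<notin> Domain R)" for a
  have l: "d a (l a) \<notin> Domain R" and less_l: "i < l a \<Longrightarrow> d a i \<in> Domain R" for a i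
    using LeastI_ex[OF ex[of a]] not_less_Least[of i "\<lambda>i. d a i \<notin> Domain R"] by (auto simp: l_def)
  have step: "(d a i, d a (Suc i)) \<in> R" if "i < l a" for a i
    using nx[OF less_l[OF that]] by (simp add: d_def)
  have step': "i < l a \<and> b = d a (Suc i)" if "(d a i, b) \<in> R" "i \<le> l a" for a b i
    using that l[of a] nx_eq[OF that(1)] by (cases "i = l a") (auto simp: d_def)
  \<comment> \<open>The starting points. Two equal chain members are traced back in parallel by
    injectivity; a starting point has no predecessor, so both traces stop at the same
    moment.\<close>
  define S0 where "S0 = S - Range R"
  have d_inj: "s = t \<and> i = j" if "s \<in> S0" "t \<in> S0" "i \<le> l s" "j \<le> l t" "d s i = d t j" for s t i j
    using that
  proof (induction i arbitrary: j)
    case 0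
    show ?case
    proof (cases j)
      case (Suc j')
      then have "(d t j', s) \<in> R" using step[of j' t] 0 by (simp add: d_def)
      then show ?thesis using 0 by (auto simp: S0_def)
    qed (use 0 in \<open>simp add: d_def\<close>)
  next
    case (Suc i)
    have si: "(d s i, d s (Suc i)) \<in> R" using step[of i s] Suc by simp
    show ?case
    proof (cases j)
      case 0
      then have "(d s i, t) \<in> R" using si Suc by (simp add: d_def)
      then show ?thesis using Suc by (auto simp: S0_def)
    next
      case (Suc j')
      then have "(d t j', d t j) \<in> R" using step[of j' t] Suc.prems by simp
      then have "d s i = d t j'"
        using si Suc.prems(5) inj by (auto simp: single_valued_def)
      then show ?thesis
        using Suc.IH[of j'] Suc.prems Suc by simp
    qed
  qed
  \<comment> \<open>Well-founded induction along predecessors: an element either starts a chain or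
    is the next member after its predecessor.\<close>
  have d_surj: "\<exists>s\<in>S0. \<exists>i\<le>l s. a = d s i" if "a \<in> S" for a
    using wfR that
  proof (induction a rule: wf_induct_rule)
    case (less a)
    show ?case
    proof (cases "a \<in> Range R")
      case True
      then obtain p where p: "(p, a) \<in> R" by auto
      then obtain s i where s: "s \<in> S0" "i \<le> l s" "p = d s i"
        using less R by blast
      then have "i < l s \<and> a = d s (Suc i)"
        using step'[of s i a] p by simp
      then show ?thesis
        using s(1) by (intro bexI[of _ s] exI[of _ "Suc i"]) auto
    next
      case False
      then show ?thesis
        using less.prems by (intro bexI[of _ a] exI[of _ 0]) (auto simp: S0_def d_def)
    qed
  qed
  have d_mem: "d s i \<in> S" if "s \<in> S0" "i \<le> l s" for s i
  proof (cases i)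
    case 0
    then show ?thesis using that by (simp add: d_def S0_def)
  next
    case (Suc j)
    then show ?thesis using step[of j s] that R by auto
  qed
  have "finite S0" using fin by (simp add: S0_def)
  then obtain h where h: "bij_betw h {0..<card S0} S0"
    using ex_bij_betw_nat_finite by blast
  have hS: "h k \<in> S0" if "k < card S0" for k
    using h that by (auto simp: bij_betw_def)
  have h_inj: "k = k'" if "h k = h k'" "k < card S0" "k' < card S0" for k k'
    using h that by (auto simp: bij_betw_def inj_on_def)
  have h_surj: "\<exists>k<card S0. s = h k" if "s \<in> S0" for s
    using h that unfolding bij_betw_def by (metis atLeastLessThan_iff imageE)
  show ?thesis
  proof (rule that[of "card S0" "\<lambda>k. Suc (l (h k))" "\<lambda>k. d (h k)"])
    show "bij_betw (\<lambda>(k, i). d (h k) i) {(k, i). k < card S0 \<and> i < Suc (l (h k))} S"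
      unfolding bij_betw_def
    proof (intro conjI equalityI subsetI)
      show "inj_on (\<lambda>(k, i). d (h k) i) {(k, i). k < card S0 \<and> i < Suc (l (h k))}"
      proof (rule inj_onI, clarify)
        fix k i k' i'
        assume "k < card S0" "k' < card S0" "i < Suc (l (h k))" "i' < Suc (l (h k'))" "d (h k) i = d (h k') i'"
        then show "k = k' \<and> i = i'"
          using d_inj[of "h k" "h k'" i i'] hS h_inj by simp
      qed
    next
      fix a assume "a \<in> S"
      then obtain k i where "k < card S0" "i \<le> l (h k)" "a = d (h k) i"
        using d_surj h_surj by blast
      then show "a \<in> (\<lambda>(k, i). d (h k) i) ` {(k, i). k < card S0 \<and> i < Suc (l (h k))}"
        by (intro image_eqI[of _ _ "(k, i)"]) auto
    qed (use d_mem hS in \<open>auto simp: less_Suc_eq_le\<close>)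
  qed (use step step' in \<open>auto simp: less_Suc_eq_le Suc_le_eq\<close>)
qed

text \<open>\<open>Vtx v\<close> stands for a trivial path, \<open>Seg k i j\<close> for the part of the \<open>k\<close>-th maximal path between
  its \<open>i\<close>-th and \<open>j\<close>-th vertex, and \<open>w k i\<close> is the \<open>i\<close>-th vertex of that maximal path.\<close>

datatype segment = Vtx nat | Seg nat nat nat

fun segment_mult :: "(nat \<Rightarrow> nat \<Rightarrow> nat) \<Rightarrow> segment \<Rightarrow> segment \<Rightarrow> segment option" where
  "segment_mult w (Vtx u) (Vtx v) = (if u = v then Some (Vtx u) else None)"
| "segment_mult w (Vtx v) (Seg k i j) = (if v = w k i then Some (Seg k i j) else None)"
| "segment_mult w (Seg k i j) (Vtx v) = (if v = w k j then Some (Seg k i j) else None)"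
| "segment_mult w (Seg k i j) (Seg k' i' j') = (if k = k' \<and> j = i' then Some (Seg k i j') else None)"

definition segments :: "nat \<Rightarrow> nat \<Rightarrow> (nat \<Rightarrow> nat) \<Rightarrow> segment set" where
  "segments N M len = Vtx ` {..<N} \<union> {Seg k i j | k i j. k < M \<and> i < j \<and> j \<le> len k}"

lemma finite_segments: "finite (segments N M len)"
proof -
  have "{Seg k i j | k i j. k < M \<and> i < j \<and> j \<le> len k}
      \<subseteq> (\<lambda>(k, i, j). Seg k i j) ` (SIGMA k:{..<M}. {..len k} \<times> {..len k})"
    by (auto simp: image_iff)
  then have "finite {Seg k i j | k i j. k < M \<and> i < j \<and> j \<le> len k}"
    by (rule finite_subset) auto
  then show ?thesis
    by (simp add: segments_def)
qed

text \<open>The combinatorial content of an almost gentle algebra. The map \<open>w k\<close> need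
  not be injective, since a maximal path may revisit a vertex, and a vertex below \<open>N\<close>
  may lie on no maximal path at all.\<close>

locale chain_algebra = based_algebra A "segments N M len" b co
  for A :: "('k::field, 'a) module" (structure) and N M :: nat and len b co +
  fixes w :: "nat \<Rightarrow> nat \<Rightarrow> nat"
  assumes len_pos: "k < M \<Longrightarrow> 0 < len k"
    and w_less: "\<lbrakk>k < M; i \<le> len k\<rbrakk> \<Longrightarrow> w k i < N"
    and b_mult: "\<lbrakk>x \<in> segments N M len; y \<in> segments N M len\<rbrakk> \<Longrightarrow>
      b x \<otimes> b y = (case segment_mult w x y of None \<Rightarrow> \<zero> | Some z \<Rightarrow> b z)"
    and co_one: "x \<in> segments N M len \<Longrightarrow> co x \<one> = (case x of Vtx v \<Rightarrow> 1 | Seg k i j \<Rightarrow> 0)"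

section \<open>Nonzero paths of an almost gentle presentation\<close>

locale almost_gentle = quiver Q for Q :: "('v, 'e) pre_digraph" +
  fixes I :: "(('v, 'e) path \<Rightarrow> 'k::field) set"
  assumes presentation: "almost_gentle_presentation Q I"
begin

abbreviation PI :: "('k, ('v, 'e) path \<Rightarrow> 'k) module" where
  "PI \<equiv> path_algebra Q"

lemma ideal_I: "ideal I PI"
  using presentation by (simp add: almost_gentle_presentation_def admissible_def)

definition R :: "'e rel" where
  "R = {(a, b). a \<in> arcs Q \<and> b \<in> arcs Q \<and> head Q a = tail Q b \<and> path_elem (tail Q a, [a, b]) \<notin> I}"

abbreviation "nonzero_path p \<equiv> successively (\<lambda>a b. (a, b) \<in> R) (snd p)"

lemma path2_iff: "(u, [a, b]) \<in> paths Q \<longleftrightarrow> a \<in> arcs Q \<and> b \<in> arcs Q \<and> head Q a = tail Q b \<and> u = tail Q a"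
  using paths_append_iff[of u "[a]" "[b]"] by auto

text \<open>The generators are paths of length two, so \<open>I\<close> is monomial: it is spanned
  by the paths with two consecutive arrows outside \<open>R\<close>. One inclusion is minimality of
  the generated ideal; for the other, a path is cut around such a pair.\<close>

lemma I_eq: "I = {f \<in> carrier PI. \<forall>p. f p \<noteq> 0 \<longrightarrow> \<not> nonzero_path p}"
proof -
  interpret P: K_algebra PI by (rule path_algebra_K_algebra)
  interpret I: ideal I PI by (rule ideal_I)
  obtain S where S: "S \<subseteq> {p \<in> paths Q. length (snd p) = 2}" and IS: "I = Idl\<^bsub>PI\<^esub> (path_elem ` S)"
    using presentation by (auto simp: almost_gentle_presentation_def cond_S0_def)
  have SP: "path_elem ` S \<subseteq> carrier PI"
    using S by auto
  let ?Z = "{f \<in> carrier PI. \<forall>p. f p \<noteq> 0 \<longrightarrow> \<not> nonzero_path p}"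
  have "ideal ?Z PI"
    by (rule ideal_of_paths) (auto simp: successively_append_iff)
  moreover have "path_elem ` S \<subseteq> ?Z"
  proof
    fix f :: "('v, 'e) path \<Rightarrow> 'k" assume "f \<in> path_elem ` S"
    then obtain p where p: "p \<in> S" "f = path_elem p" by auto
    then obtain u a c where "p = (u, [a, c])" "p \<in> paths Q"
      using S by (cases p) (auto simp: length_Suc_conv numeral_2_eq_2)
    moreover have "path_elem p \<in> I"
      using p P.genideal_self[OF SP] IS by auto
    ultimately show "f \<in> ?Z"
      using p by (auto simp: path_elem_def path2_iff R_def path_algebra_simps(1))
  qed
  ultimately have "I \<subseteq> ?Z"
    unfolding IS by (rule P.genideal_minimal)
  moreover have "?Z \<subseteq> I"
  proof
    fix f assume f: "f \<in> ?Z"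
    show "f \<in> I"
    proof (rule ideal_supported_on[OF ideal_I])
      fix p assume p: "p \<in> paths Q" "f p \<noteq> 0"
      obtain u as where ua: "p = (u, as)" by (cases p) blast
      have "\<not> successively (\<lambda>a b. (a, b) \<in> R) as"
        using f p ua by auto
      then obtain xs a c ys where as: "as = xs @ a # c # ys" "(a, c) \<notin> R"
        by (rule not_successivelyE)
      have "(u, xs @ [a, c] @ ys) \<in> paths Q"
        using p ua as by simp
      then have pp: "(u, xs) \<in> paths Q" "(path_end Q (u, xs), [a, c]) \<in> paths Q"
        "(path_end Q (path_end Q (u, xs), [a, c]), ys) \<in> paths Q"
        by (simp_all add: paths_append_iff del: append.simps)
      then have ac: "path_elem (path_end Q (u, xs), [a, c]) \<in> I"
        using as(2) by (auto simp: R_def path2_iff)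
      have "path_elem p = path_elem (u, xs) \<otimes>\<^bsub>PI\<^esub>
          (path_elem (path_end Q (u, xs), [a, c]) \<otimes>\<^bsub>PI\<^esub>
           path_elem (path_end Q (path_end Q (u, xs), [a, c]), ys))"
        using p ua as pp by (simp add: path_elem_mult) (simp add: paths_append_iff[of _ "[a, c]" ys, simplified] path_elem_mult)
      then show "path_elem p \<in> I"
        using ac pp by (simp add: I.I_l_closed I.I_r_closed)
    qed (use f in auto)
  qed
  ultimately show ?thesis by blast
qed

lemma in_I_iff: "f \<in> I \<longleftrightarrow> f \<in> carrier PI \<and> (\<forall>p. f p \<noteq> 0 \<longrightarrow> \<not> nonzero_path p)"
  by (subst I_eq) blast

lemma path_elem_in_I_iff: "p \<in> paths Q \<Longrightarrow> path_elem p \<in> I \<longleftrightarrow> \<not> nonzero_path p"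
  by (cases p, subst I_eq) (auto simp: path_elem_def path_algebra_simps(1) split: if_splits)

lemma arrow_mult_in_I:
  assumes "(a, b) \<in> R"
  shows "arrow_elem Q a \<otimes>\<^bsub>PI\<^esub> arrow_elem Q b \<notin> I"
  using assms by (auto simp: R_def arrow_elem_def path_elem_mult)

text \<open>The two halves of (S1), for successors and for predecessors.\<close>

lemma R_single_valued: "single_valued R" "single_valued (R\<inverse>)"
proof -
  have S1: "cond_S1 Q I"
    using presentation by (simp add: almost_gentle_presentation_def)
  have arcs: "a \<in> arcs Q" "b \<in> arcs Q" if "(a, b) \<in> R" for a b
    using that by (auto simp: R_def)
  show "single_valued R"
  proof (rule single_valuedI)
    fix a b c assume bc: "(a, b) \<in> R" "(a, c) \<in> R"
    have "\<exists>\<^sub>\<le>\<^sub>1b. b \<in> arcs Q \<and> arrow_elem Q a \<otimes>\<^bsub>PI\<^esub> arrow_elem Q b \<notin> I"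
      using S1 arcs(1)[OF bc(1)] by (simp add: cond_S1_def)
    then show "b = c"
      by (rule Uniq_D) (use bc arcs arrow_mult_in_I in auto)
  qed
  show "single_valued (R\<inverse>)"
  proof (rule single_valuedI)
    fix a b c assume bc: "(a, b) \<in> R\<inverse>" "(a, c) \<in> R\<inverse>"
    have "\<exists>\<^sub>\<le>\<^sub>1b. b \<in> arcs Q \<and> arrow_elem Q b \<otimes>\<^bsub>PI\<^esub> arrow_elem Q a \<notin> I"
      using S1 arcs(2)[of b a] bc by (simp add: cond_S1_def)
    then show "b = c"
      by (rule Uniq_D) (use bc arcs arrow_mult_in_I in auto)
  qed
qed

lemma R_list_path:
  assumes "successively (\<lambda>a b. (a, b) \<in> R) as" "as \<noteq> []" "hd as \<in> arcs Q"
  shows "(tail Q (hd as), as) \<in> paths Q"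
  using assms
proof (induction as rule: rev_induct)
  case (snoc a as)
  note IH = snoc.IH and prems = snoc.prems
  show ?case
  proof (cases as rule: rev_cases)
    case Nil
    then show ?thesis using prems by simp
  next
    case (snoc cs c)
    then have hd: "as \<noteq> []" "hd (as @ [a]) = hd as"
      by (auto simp: hd_append)
    have "(c, a) \<in> R" "successively (\<lambda>a b. (a, b) \<in> R) as"
      using prems(1) snoc by (auto simp: successively_append_iff)
    moreover have "path_end Q (tail Q (hd as), as) = head Q c"
      unfolding snoc by simp
    moreover have "(tail Q (hd as), as) \<in> paths Q"
      using IH calculation hd prems(3) by simp
    moreover note hd
    ultimately show ?thesis
      by (auto simp: paths_snoc_iff R_def)
  qed
qed simp

text \<open>Running around a cycle of \<open>R\<close> would produce nonzero paths of every length,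
  whereas admissibility puts all sufficiently long paths into \<open>I\<close>.\<close>

lemma R_acyclic: "acyclic R"
proof (rule acyclicI, intro allI notI)
  fix a assume a: "(a, a) \<in> R\<^sup>+"
  then have a_arc: "a \<in> arcs Q"
    by (auto simp: R_def dest!: tranclD)
  have long: "\<exists>as. length as = Suc n \<and> hd as = a \<and> successively (\<lambda>a b. (a, b) \<in> R) as \<and> (last as, a) \<in> R\<^sup>+" for n
  proof (induction n)
    case 0
    show ?case using a by (intro exI[of _ "[a]"]) simp
  next
    case (Suc n)
    then obtain as where as: "length as = Suc n" "hd as = a" "successively (\<lambda>a b. (a, b) \<in> R) as" "(last as, a) \<in> R\<^sup>+"
      by auto
    obtain c where c: "(last as, c) \<in> R" "(c, a) \<in> R\<^sup>*"
      using tranclD[OF as(4)] by auto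
    have "(c, a) \<in> R\<^sup>+"
      using c(2) a by (rule rtrancl_trancl_trancl)
    moreover have "as \<noteq> []" using as(1) by auto
    ultimately show ?case
      using as c by (intro exI[of _ "as @ [c]"]) (simp add: successively_append_iff)
  qed
  obtain m where m: "arrow_ideal_power Q m \<subseteq> I"
    using presentation by (auto simp: almost_gentle_presentation_def admissible_def)
  obtain as where as: "length as = Suc m" "hd as = a" "successively (\<lambda>a b. (a, b) \<in> R) as"
    using long by blast
  then have "as \<noteq> []" by auto
  then have p: "(tail Q a, as) \<in> paths Q"
    using R_list_path[OF as(3)] as a_arc by simp
  then have "path_elem (tail Q a, as) \<in> arrow_ideal_power Q m"
    using as by (auto simp: arrow_ideal_power_def path_elem_def path_algebra_simps(1))
  then show False
    using path_elem_in_I_iff[OF p] as m by auto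
qed

text \<open>The nonzero paths form a basis, whose coordinate functions read off the coefficient of a
  path in any representative.\<close>

lemma quotient_chain_algebra:
  obtains N M len b co w
  where "chain_algebra (quotient_algebra PI I) N M len b co w"
proof -
  interpret P: K_algebra PI by (rule path_algebra_K_algebra)
  interpret I: ideal I PI by (rule ideal_I)
  let ?A = "quotient_algebra PI I"
  interpret A: K_algebra ?A by (rule P.quotient_K_algebra[OF ideal_I])
  have R_arcs: "R \<subseteq> arcs Q \<times> arcs Q"
    by (auto simp: R_def)
  obtain M :: nat and L c where L': "\<forall>k<M. 0 < L k"
    and bij: "bij_betw (\<lambda>(k, i). c k i) {(k, i). k < M \<and> i < L k} (arcs Q)"
    and step': "\<forall>k<M. \<forall>i. Suc i < L k \<longrightarrow> (c k i, c k (Suc i)) \<in> R"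
    and next': "\<forall>k<M. \<forall>i<L k. \<forall>b. (c k i, b) \<in> R \<longrightarrow> Suc i < L k \<and> b = c k (Suc i)"
    by (rule chain_decomposition[OF finite_arcs R_arcs R_single_valued R_acyclic])
  note L = L'[rule_format] and step = step'[rule_format] and next_arc = next'[rule_format]
  have c_inj: "k = k' \<and> i = i'" if "c k i = c k' i'" "k < M" "k' < M" "i < L k" "i' < L k'" for k i k' i'
    using inj_onD[OF bij_betw_imp_inj_on[OF bij], of "(k, i)" "(k', i')"] that by auto
  have c_surj: "\<exists>k<M. \<exists>i<L k. a = c k i" if "a \<in> arcs Q" for a
  proof -
    have "a \<in> (\<lambda>(k, i). c k i) ` {(k, i). k < M \<and> i < L k}"
      unfolding bij_betw_imp_surj_on[OF bij] by (rule that)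
    then show ?thesis by auto
  qed
  have c_arc: "c k i \<in> arcs Q" if "k < M" "i < L k" for k i
    using bij_betwE[OF bij] that by auto
  \<comment> \<open>Vertices are numbered because the Brauer configuration has natural numbers as
    labels.\<close>
  obtain \<iota> where \<iota>: "bij_betw \<iota> (verts Q) {0..<card (verts Q)}"
    using ex_bij_betw_finite_nat[OF finite_verts] by blast
  define N where "N = card (verts Q)"
  define \<kappa> where "\<kappa> = inv_into (verts Q) \<iota>"
  have \<iota>_less: "\<iota> v < N" if "v \<in> verts Q" for v
    using bij_betwE[OF \<iota>] that by (auto simp: N_def)
  have \<kappa>\<iota>: "\<kappa> (\<iota> v) = v" if "v \<in> verts Q" for v
    using \<iota> that by (simp add: \<kappa>_def bij_betw_def)
  have \<kappa>: "\<kappa> n \<in> verts Q" "\<iota> (\<kappa> n) = n" if "n < N" for n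
    using \<iota> that by (auto simp: \<kappa>_def bij_betw_def N_def inv_into_into f_inv_into_f)
  \<comment> \<open>A chain of \<open>L k\<close> arrows has \<open>L k + 1\<close> vertices. The
    last one has no outgoing arrow in the chain and is read off as the head of the final
    arrow.\<close>
  define u where "u k i = (if i < L k then tail Q (c k i) else head Q (c k (i - 1)))" for k i
  have tail_c: "tail Q (c k i) = u k i" if "i < L k" for k i
    using that by (simp add: u_def)
  have head_c: "head Q (c k i) = u k (Suc i)" if "k < M" "i < L k" for k i
    using step[of k i] that by (auto simp: u_def R_def)
  have u_verts: "u k i \<in> verts Q" if "k < M" "i \<le> L k" for k i
    using that c_arc[of k i] c_arc[of k "i - 1"] L[of k] by (auto simp: u_def)
  define w where "w k i = \<iota> (u k i)" for k i
  define pth where "pth x = (case x of Vtx n \<Rightarrow> (\<kappa> n, []) | Seg k i j \<Rightarrow> (u k i, map (c k) [i..<j]))" for x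
  let ?X = "segments N M L"
  have seg_succ: "successively (\<lambda>a b. (a, b) \<in> R) (map (c k) [i..<j])" if "k < M" "j \<le> L k" for k i j
    using that by (auto simp: successively_conv_nth intro!: step)
  have seg_path: "(u k i, map (c k) [i..<j]) \<in> paths Q \<and> path_end Q (u k i, map (c k) [i..<j]) = u k j"
    if "k < M" "i \<le> j" "j \<le> L k" for k i j
    using that(2,3)
  proof (induction j rule: dec_induct)
    case base
    then show ?case using u_verts[of k i] that(1) by simp
  next
    case (step j)
    then show ?case
      using c_arc[of k j] tail_c[of j k] head_c[of k j] that(1) by (simp add: paths_snoc_iff)
  qed
  have pth_mem: "pth x \<in> paths Q" "nonzero_path (pth x)" if "x \<in> ?X" for x
    using that seg_path seg_succ \<kappa> by (auto simp: segments_def pth_def)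
  \<comment> \<open>A nontrivial segment is recovered from its first arrow, which fixes the chain
    and the position, and from its length.\<close>
  have pth_inj: "x = y" if "x \<in> ?X" "y \<in> ?X" "pth x = pth y" for x y
  proof (cases x)
    case (Vtx n)
    then show ?thesis
      using that \<kappa> by (cases y) (auto simp: segments_def pth_def, metis)
  next
    case x: (Seg k i j)
    show ?thesis
    proof (cases y)
      case (Vtx n)
      then show ?thesis using that x by (auto simp: segments_def pth_def)
    next
      case y: (Seg k' i' j')
      have kij: "k < M" "i < j" "j \<le> L k" "k' < M" "i' < j'" "j' \<le> L k'"
        using that x y by (auto simp: segments_def)
      have eq: "map (c k) [i..<j] = map (c k') [i'..<j']"
        using that x y by (simp add: pth_def)
      have "hd (map (c k) [i..<j]) = c k i" "hd (map (c k') [i'..<j']) = c k' i'"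
        using kij by (simp_all add: hd_map)
      then have "c k i = c k' i'"
        using eq by simp
      then have "k = k' \<and> i = i'"
        using c_inj kij by simp
      moreover have "j - i = j' - i'"
        using arg_cong[OF eq, of length] by simp
      ultimately show ?thesis
        using kij x y by auto
    qed
  qed
  \<comment> \<open>Each further arrow of a nonzero path is forced by maximality of the chain, so
    the path never leaves the chain of its first arrow.\<close>
  have chain_list: "\<exists>k i j. k < M \<and> i < j \<and> j \<le> L k \<and> as = map (c k) [i..<j]"
    if "successively (\<lambda>a b. (a, b) \<in> R) as" "as \<noteq> []" "set as \<subseteq> arcs Q" for as
    using that
  proof (induction as rule: rev_induct)
    case (snoc a as)
    show ?case
    proof (cases "as = []")
      case True
      then obtain k i where "k < M" "i < L k" "a = c k i"
        using snoc.prems c_surj[of a] by auto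
      then have "k < M \<and> i < Suc i \<and> Suc i \<le> L k \<and> as @ [a] = map (c k) [i..<Suc i]"
        using True by simp
      then show ?thesis by blast
    next
      case False
      then obtain k i j where *: "k < M" "i < j" "j \<le> L k" "as = map (c k) [i..<j]"
        using snoc by (auto simp: successively_append_iff)
      have "last as = c k (j - 1)"
        using * by (simp add: last_map)
      then have "(c k (j - 1), a) \<in> R"
        using snoc.prems False by (auto simp: successively_append_iff)
      then have "j < L k \<and> a = c k j"
        using next_arc[of k "j - 1" a] * by auto
      then have "k < M \<and> i < Suc j \<and> Suc j \<le> L k \<and> as @ [a] = map (c k) [i..<Suc j]"
        using * by simp
      then show ?thesis by blast
    qed
  qed simp
  have pth_surj: "\<exists>x\<in>?X. p = pth x" if p: "p \<in> paths Q" "nonzero_path p" for p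
  proof -
    obtain v as where va: "p = (v, as)" by (cases p) blast
    show ?thesis
    proof (cases "as = []")
      case True
      then have "v \<in> verts Q" using p va by simp
      then show ?thesis
        using True va \<kappa>\<iota> \<iota>_less by (intro bexI[of _ "Vtx (\<iota> v)"]) (auto simp: pth_def segments_def)
    next
      case False
      have "set as \<subseteq> arcs Q"
        using p va by (auto simp: paths_def awalk_def)
      then obtain k i j where *: "k < M" "i < j" "j \<le> L k" "as = map (c k) [i..<j]"
        using chain_list[of as] False p va by auto
      have "as = c k i # map (c k) [Suc i..<j]"
        using * by (simp add: upt_conv_Cons)
      then have "v = tail Q (c k i)"
        using p va paths_append_iff[of v "[c k i]"] by simp
      then show ?thesis
        using * va tail_c[of i k] by (intro bexI[of _ "Seg k i j"]) (auto simp: pth_def segments_def)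
    qed
  qed
  let ?q = "\<lambda>f. I +>\<^bsub>PI\<^esub> f"
  define b where "b x = ?q (path_elem (pth x))" for x
  define co where "co x = (\<lambda>U\<in>carrier ?A. (SOME f. f \<in> U) (pth x))" for x
  note q = P.quotient_hom[OF ideal_I] P.quotient_smult[OF ideal_I]
  have q_closed: "?q f \<in> carrier ?A" if "f \<in> carrier PI" for f
    using that P.quotient_carrier[OF ideal_I] by simp
  have q_ex: "\<exists>f\<in>carrier PI. U = ?q f" if "U \<in> carrier ?A" for U
    using that P.quotient_carrier[OF ideal_I] by auto
  have co_q: "co x (?q f) = f (pth x)" if "x \<in> ?X" "f \<in> carrier PI" for x f
  proof -
    define g where "g = (SOME g. g \<in> ?q f)"
    have "f \<in> ?q f"
      using that I.a_rcos_self by auto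
    then have "g \<in> ?q f"
      unfolding g_def by (rule someI[of "\<lambda>g. g \<in> ?q f"])
    then obtain i where i: "i \<in> I" "g = i \<oplus>\<^bsub>PI\<^esub> f"
      by (auto simp: a_r_coset_def')
    have "i (pth x) = 0"
      using in_I_iff[THEN iffD1, OF i(1)] pth_mem(2)[OF that(1)] by blast
    then have "g (pth x) = f (pth x)"
      using i by (simp add: path_algebra_simps)
    then show ?thesis
      using q_closed[OF that(2)] by (simp add: co_def g_def)
  qed
  have q_zero: "?q f = \<zero>\<^bsub>?A\<^esub>" if "f \<in> I" for f
    using that P.coset_eq_iff[OF ideal_I, of f "\<zero>\<^bsub>PI\<^esub>"] I.Icarr[OF that] q(3)
    by (simp add: P.M.minus_eq)
  have pe: "path_elem p \<in> carrier PI" if "p \<in> paths Q" for p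
    using that by simp
  have "chain_algebra ?A N M L b co w"
  proof
    show "finite ?X" by (rule finite_segments)
    show "b x \<in> carrier ?A" if "x \<in> ?X" for x
      unfolding b_def using pth_mem(1)[OF that] by (intro q_closed pe)
    show "co x \<in> dual ?A" if "x \<in> ?X" for x
    proof (rule dualI)
      show "co x (U \<oplus>\<^bsub>?A\<^esub> V) = co x U + co x V" if UV: "U \<in> carrier ?A" "V \<in> carrier ?A" for U V
      proof -
        obtain f g where fg: "f \<in> carrier PI" "U = ?q f" "g \<in> carrier PI" "V = ?q g"
          using q_ex[OF UV(1)] q_ex[OF UV(2)] by blast
        have "co x (U \<oplus>\<^bsub>?A\<^esub> V) = (f \<oplus>\<^bsub>PI\<^esub> g) (pth x)"
          unfolding fg q(1)[OF fg(1,3), symmetric] using fg \<open>x \<in> ?X\<close> by (intro co_q P.M.a_closed)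
        then show ?thesis
          using fg co_q[OF \<open>x \<in> ?X\<close>] by (simp add: path_algebra_simps(5))
      qed
      show "co x (d \<odot>\<^bsub>?A\<^esub> U) = d * co x U" if U: "U \<in> carrier ?A" for U d
      proof -
        obtain f where fg: "f \<in> carrier PI" "U = ?q f"
          using q_ex[OF U] by blast
        have "co x (d \<odot>\<^bsub>?A\<^esub> U) = (d \<odot>\<^bsub>PI\<^esub> f) (pth x)"
          unfolding fg q(5)[OF fg(1)] using fg \<open>x \<in> ?X\<close> by (intro co_q P.K_smult_closed)
        then show ?thesis
          using fg co_q[OF \<open>x \<in> ?X\<close>] by (simp add: path_algebra_simps(6))
      qed
    qed (simp add: co_def)
    show "co x (b y) = (if x = y then 1 else 0)" if "x \<in> ?X" "y \<in> ?X" for x y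
      using co_q[OF that(1) pe[OF pth_mem(1)[OF that(2)]]] pth_inj[OF that] by (auto simp: b_def path_elem_def)
    show "U = \<zero>\<^bsub>?A\<^esub>" if U: "U \<in> carrier ?A" and zero: "\<And>x. x \<in> ?X \<Longrightarrow> co x U = 0" for U
    proof -
      obtain f where f: "f \<in> carrier PI" "U = ?q f"
        using q_ex[OF U] by blast
      have "\<not> nonzero_path p" if "f p \<noteq> 0" for p
      proof
        assume "nonzero_path p"
        moreover have "p \<in> paths Q"
          using that f(1) by (auto simp: path_algebra_simps(1))
        ultimately obtain x where "x \<in> ?X" "p = pth x"
          using pth_surj by blast
        then show False
          using that zero co_q f by auto
      qed
      then have "f \<in> I"
        using in_I_iff[THEN iffD2, of f] f(1) by blast
      then show ?thesis
        unfolding f(2) by (rule q_zero)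
    qed
    show "0 < L k" if "k < M" for k by (rule L[OF that])
    show "w k i < N" if "k < M" "i \<le> L k" for k i
      unfolding w_def by (rule \<iota>_less[OF u_verts[OF that]])
    show "co x \<one>\<^bsub>?A\<^esub> = (case x of Vtx v \<Rightarrow> 1 | Seg k i j \<Rightarrow> 0)" if "x \<in> ?X" for x
    proof -
      have "co x \<one>\<^bsub>?A\<^esub> = \<one>\<^bsub>PI\<^esub> (pth x)"
        unfolding q(4)[symmetric] by (rule co_q[OF that P.A.one_closed])
      then show ?thesis
        using that \<kappa> by (auto simp: path_algebra_simps(3) pth_def segments_def)
    qed
    show "b x \<otimes>\<^bsub>?A\<^esub> b y = (case segment_mult w x y of None \<Rightarrow> \<zero>\<^bsub>?A\<^esub> | Some z \<Rightarrow> b z)"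
      if x: "x \<in> ?X" and y: "y \<in> ?X" for x y
    proof -
      have prod: "b x \<otimes>\<^bsub>?A\<^esub> b y = ?q (path_elem (pth x) \<otimes>\<^bsub>PI\<^esub> path_elem (pth y))"
        unfolding b_def using pth_mem(1)[OF x] pth_mem(1)[OF y] by (simp only: q(2)[OF pe pe])
      have prod': "path_elem (pth x) \<otimes>\<^bsub>PI\<^esub> path_elem (pth y)
          = (if path_end Q (pth x) = fst (pth y) then path_elem (fst (pth x), snd (pth x) @ snd (pth y)) else \<zero>\<^bsub>PI\<^esub>)"
        using pth_mem(1)[OF x] pth_mem(1)[OF y] by (rule path_elem_mult)
      have \<iota>_eq: "n = \<iota> v \<longleftrightarrow> \<kappa> n = v" if "n < N" "v \<in> verts Q" for n v
        using that \<kappa>\<iota> \<kappa> by auto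
      have \<kappa>_eq: "\<kappa> n = \<kappa> n' \<longleftrightarrow> n = n'" if "n < N" "n' < N" for n n'
        using that \<kappa> by metis
      show ?thesis
      proof (cases x)
        case x': (Vtx n)
        then have n: "n < N" using x by (auto simp: segments_def)
        show ?thesis
        proof (cases y)
          case y': (Vtx n')
          then have "n' < N" using y by (auto simp: segments_def)
          then show ?thesis
            using prod prod' n x' y' q(3) by (auto simp: pth_def \<kappa>_eq b_def)
        next
          case y': (Seg k i j)
          then have kij: "k < M" "i < j" "j \<le> L k" using y by (auto simp: segments_def)
          then show ?thesis
            using prod prod' n x' y' q(3) \<iota>_eq[OF n u_verts[of k i]] by (auto simp: pth_def b_def w_def)
        qed
      next
        case x': (Seg k i j)
        then have kij: "k < M" "i < j" "j \<le> L k" using x by (auto simp: segments_def)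
        have end_x: "path_end Q (pth x) = u k j"
          using seg_path[of k i j] kij x' by (simp add: pth_def)
        show ?thesis
        proof (cases y)
          case y': (Vtx n)
          then have "n < N" using y by (auto simp: segments_def)
          then show ?thesis
            using prod prod' x' y' kij q(3) \<iota>_eq[of n "u k j"] u_verts[of k j] end_x
            by (auto simp: pth_def b_def w_def)
        next
          case y': (Seg k' i' j')
          then have kij': "k' < M" "i' < j'" "j' \<le> L k'" using y by (auto simp: segments_def)
          show ?thesis
          proof (cases "k = k' \<and> j = i'")
            case True
            then have "[i..<j] @ [i'..<j'] = [i..<j']"
              using kij kij' upt_add_eq_append[of i j "j' - j"] by simp
            then have "map (c k) [i..<j] @ map (c k) [i'..<j'] = map (c k) [i..<j']"
              by (metis map_append)
            then show ?thesis
              using True prod prod' x' y' end_x by (simp add: pth_def b_def)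
          next
            case False
            \<comment> \<open>The segments may still compose in the quiver without being adjacent on
              a chain. Then the two arrows at the junction are not related by \<open>R\<close>,
              which puts the concatenation into \<open>I\<close>.\<close>
            have "path_elem (pth x) \<otimes>\<^bsub>PI\<^esub> path_elem (pth y) \<in> I"
            proof (cases "path_end Q (pth x) = fst (pth y)")
              case comp: True
              let ?as = "map (c k) [i..<j]" and ?bs = "map (c k') [i'..<j']"
              have ends: "last ?as = c k (j - 1)" "hd ?bs = c k' i'"
                using kij kij' by (simp_all add: last_map hd_map)
              have "(c k (j - 1), c k' i') \<notin> R"
              proof
                assume "(c k (j - 1), c k' i') \<in> R"
                then have "j < L k \<and> c k' i' = c k j"
                  using next_arc[of k "j - 1" "c k' i'"] kij by auto
                then show False
                  using c_inj[of k' i' k j] kij kij' False by auto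
              qed
              then have "\<not> successively (\<lambda>a b. (a, b) \<in> R) (?as @ ?bs)"
                using ends kij kij' by (auto simp: successively_append_iff)
              moreover have "(u k i, ?as @ ?bs) \<in> paths Q"
                using seg_path[of k i j] seg_path[of k' i' j'] kij kij' comp end_x y'
                by (simp add: paths_append_iff pth_def)
              ultimately have "path_elem (u k i, ?as @ ?bs) \<in> I"
                by (simp add: path_elem_in_I_iff)
              then show ?thesis
                using prod' comp x' y' by (simp add: pth_def)
            next
              case False
              then show ?thesis
                using prod' P.ideal_zero[OF ideal_I] by simp
            qed
            then have "b x \<otimes>\<^bsub>?A\<^esub> b y = \<zero>\<^bsub>?A\<^esub>"
              unfolding prod by (rule q_zero)
            then show ?thesis
              using False x' y' by auto
          qed
        qed
      qed
    qed
  qed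
  then show ?thesis
    by (rule that)
qed

end

section \<open>The Brauer configuration of an almost gentle algebra\<close>

context chain_algebra
begin

abbreviation "segs \<equiv> segments N M len"
abbreviation "T \<equiv> trivial_extension A"

sublocale T: based_algebra T "segs <+> segs" T_basis T_coord
  by (rule T_based)

text \<open>Allowing an empty segment, read as a trivial path, lets the formulas for products
  include the ends of a chain.\<close>

definition seg :: "nat \<Rightarrow> nat \<Rightarrow> nat \<Rightarrow> segment" where
  "seg k i j = (if i = j then Vtx (w k i) else Seg k i j)"

lemma seg_mem: "\<lbrakk>k < M; i \<le> j; j \<le> len k\<rbrakk> \<Longrightarrow> seg k i j \<in> segs"
  using w_less[of k i] by (auto simp: seg_def segments_def)

lemma Seg_mem [simp]: "Seg k i j \<in> segs \<longleftrightarrow> k < M \<and> i < j \<and> j \<le> len k"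
  and Vtx_mem [simp]: "Vtx v \<in> segs \<longleftrightarrow> v < N"
  by (auto simp: segments_def)

lemma Plus_iff [simp]: "Inl x \<in> C <+> D \<longleftrightarrow> x \<in> C" "Inr y \<in> C <+> D \<longleftrightarrow> y \<in> D"
  by auto

lemma segment_mult_closed:
  "\<lbrakk>x \<in> segs; y \<in> segs; segment_mult w x y = Some z\<rbrakk> \<Longrightarrow> z \<in> segs"
  by (cases x; cases y) (auto split: if_splits)

lemma T_basis_simps:
  "T_basis (Inl x) = (b x, \<lambda>a\<in>carrier A. 0)"
  "T_basis (Inr x) = (\<zero>, co x)"
  by (simp_all add: T_basis_def)

lemma T_basis_mult_LL:
  assumes "x \<in> segs" "y \<in> segs"
  shows "T_basis (Inl x) \<otimes>\<^bsub>T\<^esub> T_basis (Inl y)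
    = (case segment_mult w x y of None \<Rightarrow> \<zero>\<^bsub>T\<^esub> | Some z \<Rightarrow> T_basis (Inl z))"
  using assms
  by (auto simp: T_basis_simps trivial_extension_mult trivial_extension_simps b_closed b_mult
      split: option.split intro!: restrict_ext)

lemma co_segment_mult:
  assumes "x \<in> segs" "y \<in> segs" "z \<in> segs"
  shows "co z (b x \<otimes> b y) = (if segment_mult w x y = Some z then 1 else 0)"
  using assms segment_mult_closed[OF assms(1,2)]
  by (auto simp: b_mult co_b dual_zero_apply[OF co_dual] split: option.split)

text \<open>A dual basis element multiplied by a basis element takes only the values 0 and 1 on the
  basis. It is identified by finding the basis elements where it is 1.\<close>

lemma indicator_functional:
  assumes f: "f \<in> dual A" and f_b: "\<And>z. z \<in> segs \<Longrightarrow> f (b z) = (if P z then 1 else 0)"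
  shows "\<lbrakk>r \<in> segs; \<And>z. z \<in> segs \<Longrightarrow> P z \<longleftrightarrow> z = r\<rbrakk> \<Longrightarrow> (\<zero>, f) = T_basis (Inr r)"
    and "(\<And>z. z \<in> segs \<Longrightarrow> \<not> P z) \<Longrightarrow> (\<zero>, f) = \<zero>\<^bsub>T\<^esub>"
proof -
  show "(\<zero>, f) = T_basis (Inr r)" if "r \<in> segs" "\<And>z. z \<in> segs \<Longrightarrow> P z \<longleftrightarrow> z = r"
    using dual_basis_eqI[OF f co_dual[OF that(1)]] that by (auto simp: T_basis_simps f_b co_b)
  show "(\<zero>, f) = \<zero>\<^bsub>T\<^esub>" if "\<And>z. z \<in> segs \<Longrightarrow> \<not> P z"
    using dual_basis_eqI[OF f zero_dual] that by (simp add: trivial_extension_simps f_b b_closed)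
qed

text \<open>Multiplying the dual of \<open>y\<close> by \<open>x\<close> from the left gives the
  dual of what remains of \<open>y\<close> once a final part \<open>x\<close> is removed, or zero if
  \<open>y\<close> does not end in \<open>x\<close>.\<close>

lemma T_basis_mult_LR:
  assumes x: "x \<in> segs" and y: "y \<in> segs"
  shows "\<lbrakk>r \<in> segs; \<And>z. z \<in> segs \<Longrightarrow> segment_mult w z x = Some y \<longleftrightarrow> z = r\<rbrakk> \<Longrightarrow>
      T_basis (Inl x) \<otimes>\<^bsub>T\<^esub> T_basis (Inr y) = T_basis (Inr r)" (is "PROP ?A")
    and "(\<And>z. z \<in> segs \<Longrightarrow> segment_mult w z x \<noteq> Some y) \<Longrightarrow>
      T_basis (Inl x) \<otimes>\<^bsub>T\<^esub> T_basis (Inr y) = \<zero>\<^bsub>T\<^esub>" (is "PROP ?B")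
proof -
  let ?f = "\<lambda>z\<in>carrier A. co y (z \<otimes> b x)"
  have prod: "T_basis (Inl x) \<otimes>\<^bsub>T\<^esub> T_basis (Inr y) = (\<zero>, ?f)"
    using x y by (auto simp: T_basis_simps trivial_extension_mult b_closed intro!: restrict_ext)
  have f: "?f \<in> dual A"
    by (rule dual_extend(1)[OF b_closed[OF x] co_dual[OF y]])
  have f_b: "?f (b z) = (if segment_mult w z x = Some y then 1 else 0)" if "z \<in> segs" for z
    using that x y co_segment_mult[OF that x y] by (simp add: b_closed)
  show "PROP ?A" "PROP ?B"
    unfolding prod by (rule indicator_functional[OF f f_b]; assumption)+
qed

text \<open>The mirror image: multiplication from the right removes an initial part \<open>x\<close>
  from \<open>y\<close>.\<close>

lemma T_basis_mult_RL:
  assumes x: "x \<in> segs" and y: "y \<in> segs"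
  shows "\<lbrakk>r \<in> segs; \<And>z. z \<in> segs \<Longrightarrow> segment_mult w x z = Some y \<longleftrightarrow> z = r\<rbrakk> \<Longrightarrow>
      T_basis (Inr y) \<otimes>\<^bsub>T\<^esub> T_basis (Inl x) = T_basis (Inr r)" (is "PROP ?A")
    and "(\<And>z. z \<in> segs \<Longrightarrow> segment_mult w x z \<noteq> Some y) \<Longrightarrow>
      T_basis (Inr y) \<otimes>\<^bsub>T\<^esub> T_basis (Inl x) = \<zero>\<^bsub>T\<^esub>" (is "PROP ?B")
proof -
  let ?f = "\<lambda>z\<in>carrier A. co y (b x \<otimes> z)"
  have prod: "T_basis (Inr y) \<otimes>\<^bsub>T\<^esub> T_basis (Inl x) = (\<zero>, ?f)"
    using x y by (auto simp: T_basis_simps trivial_extension_mult b_closed intro!: restrict_ext)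
  have f: "?f \<in> dual A"
    by (rule dual_extend(2)[OF b_closed[OF x] co_dual[OF y]])
  have f_b: "?f (b z) = (if segment_mult w x z = Some y then 1 else 0)" if "z \<in> segs" for z
    using that x y co_segment_mult[OF x that y] by (simp add: b_closed)
  show "PROP ?A" "PROP ?B"
    unfolding prod by (rule indicator_functional[OF f f_b]; assumption)+
qed

lemma T_basis_mult_RR:
  assumes "x \<in> segs" "y \<in> segs"
  shows "T_basis (Inr x) \<otimes>\<^bsub>T\<^esub> T_basis (Inr y) = \<zero>\<^bsub>T\<^esub>"
  using assms
  by (auto simp: T_basis_simps trivial_extension_mult trivial_extension_simps
      dual_zero_apply[OF co_dual] intro!: restrict_ext)

definition idem :: "nat \<Rightarrow> 'a \<times> ('a \<Rightarrow> 'k)" where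
  "idem v = T_basis (Inl (Vtx v))"

text \<open>Position \<open>len k\<close>, one past the arrows of the maximal path, is that of the
  new arrow closing the cycle.\<close>

definition arr :: "nat \<times> nat \<Rightarrow> 'a \<times> ('a \<Rightarrow> 'k)" where
  "arr = (\<lambda>(k, i). T_basis (if i < len k then Inl (Seg k i (Suc i)) else Inr (Seg k 0 (len k))))"

lemma idem_mult: "\<lbrakk>u < N; v < N\<rbrakk> \<Longrightarrow> idem u \<otimes>\<^bsub>T\<^esub> idem v = (if u = v then idem u else \<zero>\<^bsub>T\<^esub>)"
  by (simp add: idem_def T_basis_mult_LL)

lemma idem_sum: "(\<Oplus>\<^bsub>T\<^esub>v\<in>{..<N}. idem v) = \<one>\<^bsub>T\<^esub>"
proof (rule T.coords_eqI)
  have idem: "idem \<in> {..<N} \<rightarrow> carrier T"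
    by (auto simp: idem_def intro!: T.b_closed)
  then show "(\<Oplus>\<^bsub>T\<^esub>v\<in>{..<N}. idem v) \<in> carrier T"
    by (rule T.M.finsum_closed)
  fix x assume x: "x \<in> segs <+> segs"
  have "T_coord x (\<Oplus>\<^bsub>T\<^esub>v\<in>{..<N}. idem v) = (\<Sum>v<N. T_coord x (idem v))"
    by (rule T.dual_finsum[OF T.co_dual[OF x] _ idem]) simp
  also have "\<dots> = (\<Sum>v<N. if x = Inl (Vtx v) then 1 else 0)"
    unfolding idem_def by (intro sum.cong) (auto simp: T.co_b[OF x])
  also have "\<dots> = (case x of Inl (Vtx v) \<Rightarrow> 1 | _ \<Rightarrow> 0)"
    using x by (auto split: segment.split)
  also have "\<dots> = T_coord x \<one>\<^bsub>T\<^esub>"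
    using x by (auto simp: T_coord_def trivial_extension_simps zero_dual co_one b_closed split: segment.split)
  finally show "T_coord x (\<Oplus>\<^bsub>T\<^esub>v\<in>{..<N}. idem v) = T_coord x \<one>\<^bsub>T\<^esub>" .
qed (rule T.A.one_closed)

text \<open>\<open>tseg k i l\<close> indexes the image in \<open>T(A)\<close> of the path of length \<open>l\<close> that starts at the \<open>i\<close>-th
  vertex of the \<open>k\<close>-th special cycle. A path that runs through the new arrow corresponds to the
  dual of the part of the maximal path that it leaves out.\<close>

definition tseg :: "nat \<Rightarrow> nat \<Rightarrow> nat \<Rightarrow> segment + segment" where
  "tseg k i l = (if i + l \<le> len k then Inl (seg k i (i + l)) else Inr (seg k (i + l - Suc (len k)) i))"

lemma tseg_mem: "\<lbrakk>k < M; i \<le> len k; l \<le> Suc (len k)\<rbrakk> \<Longrightarrow> tseg k i l \<in> segs <+> segs"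
  by (auto simp: tseg_def intro!: seg_mem)

lemma arr_tseg: "\<lbrakk>k < M; i \<le> len k\<rbrakk> \<Longrightarrow> arr (k, i) = T_basis (tseg k i 1)"
  using len_pos[of k] by (cases "i = len k") (auto simp: arr_def tseg_def seg_def)

lemma arr_closed: "\<lbrakk>k < M; i \<le> len k\<rbrakk> \<Longrightarrow> arr (k, i) \<in> carrier T"
  by (simp add: arr_tseg T.b_closed tseg_mem)

lemma idem_arr:
  assumes "k < M" "i \<le> len k"
  shows "idem (w k i) \<otimes>\<^bsub>T\<^esub> arr (k, i) = arr (k, i)"
proof (cases "i < len k")
  case True
  then show ?thesis
    using assms w_less[OF assms] by (simp add: idem_def arr_def T_basis_mult_LL)
next
  case False
  then have "T_basis (Inl (Vtx (w k i))) \<otimes>\<^bsub>T\<^esub> T_basis (Inr (Seg k 0 (len k))) = T_basis (Inr (Seg k 0 (len k)))"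
    using assms w_less[OF assms] len_pos[of k]
    by (intro T_basis_mult_LR(1)) (auto elim!: segment_mult.elims split: if_splits)
  then show ?thesis
    using False by (simp add: idem_def arr_def)
qed

lemma arr_idem:
  assumes "k < M" "i \<le> len k"
  shows "arr (k, i) \<otimes>\<^bsub>T\<^esub> idem (w k (Suc i mod Suc (len k))) = arr (k, i)"
proof (cases "i < len k")
  case True
  then show ?thesis
    using assms w_less[of k "Suc i"] by (simp add: idem_def arr_def T_basis_mult_LL)
next
  case False
  then have "T_basis (Inr (Seg k 0 (len k))) \<otimes>\<^bsub>T\<^esub> T_basis (Inl (Vtx (w k 0))) = T_basis (Inr (Seg k 0 (len k)))"
    using assms w_less[of k 0] len_pos[of k]
    by (intro T_basis_mult_RL(1)) (auto elim!: segment_mult.elims split: if_splits)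
  moreover have "Suc i mod Suc (len k) = 0"
    using False assms by simp
  ultimately show ?thesis
    using False by (simp add: idem_def arr_def)
qed

text \<open>Before the new arrow the segment grows. Crossing it turns the final part from
  \<open>i\<close> onward into the dual of the initial part up to \<open>i\<close>. After it, each
  arrow shortens the omitted part from the left.\<close>

lemma tseg_arr:
  assumes k: "k < M" and i: "i \<le> len k" and l: "l \<le> len k"
  shows "T_basis (tseg k i l) \<otimes>\<^bsub>T\<^esub> arr (k, (i + l) mod Suc (len k)) = T_basis (tseg k i (Suc l))"
proof -
  note pos = len_pos[OF k]
  consider "i + l < len k" | "i + l = len k" | "len k < i + l" by linarith
  then show ?thesis
  proof cases
    case 1
    then show ?thesis
      using k i w_less[of k i] by (auto simp: tseg_def arr_def seg_def T_basis_mult_LL)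
  next
    case 2
    have "T_basis (Inl (seg k i (len k))) \<otimes>\<^bsub>T\<^esub> T_basis (Inr (Seg k 0 (len k))) = T_basis (Inr (seg k 0 i))"
    proof (rule T_basis_mult_LR(1))
      show "segment_mult w z (seg k i (len k)) = Some (Seg k 0 (len k)) \<longleftrightarrow> z = seg k 0 i" if "z \<in> segs" for z
        using k i pos that by (cases z) (auto simp: seg_def)
    qed (use k i pos in \<open>auto intro!: seg_mem\<close>)
    then show ?thesis
      using 2 by (simp add: tseg_def arr_def)
  next
    case 3
    define j where "j = i + l - Suc (len k)"
    have j: "i + l = j + Suc (len k)" "j < i"
      using 3 l by (auto simp: j_def)
    have "T_basis (Inr (seg k j i)) \<otimes>\<^bsub>T\<^esub> T_basis (Inl (Seg k j (Suc j))) = T_basis (Inr (seg k (Suc j) i))"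
    proof (rule T_basis_mult_RL(1))
      show "segment_mult w (Seg k j (Suc j)) z = Some (seg k j i) \<longleftrightarrow> z = seg k (Suc j) i" if "z \<in> segs" for z
        using k i j that by (cases z) (auto simp: seg_def)
    qed (use k i j in \<open>auto intro!: seg_mem\<close>)
    moreover have "(i + l) mod Suc (len k) = j"
      unfolding j(1) mod_add_self2 using j(2) i by simp
    ultimately show ?thesis
      using j i by (simp add: tseg_def arr_def)
  qed
qed

text \<open>A full turn gives the dual of a trivial path. No product beginning with an arrow is a
  trivial path, so an old arrow kills it; the new arrow does so because the dual has square
  zero.\<close>

lemma full_cycle_arr:
  assumes k: "k < M" and i: "i \<le> len k"
  shows "T_basis (tseg k i (Suc (len k))) \<otimes>\<^bsub>T\<^esub> arr (k, i) = \<zero>\<^bsub>T\<^esub>"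
proof -
  have tseg: "tseg k i (Suc (len k)) = Inr (Vtx (w k i))"
    by (simp add: tseg_def seg_def)
  show ?thesis
  proof (cases "i < len k")
    case True
    have "T_basis (Inr (Vtx (w k i))) \<otimes>\<^bsub>T\<^esub> T_basis (Inl (Seg k i (Suc i))) = \<zero>\<^bsub>T\<^esub>"
    proof (rule T_basis_mult_RL(2))
      show "segment_mult w (Seg k i (Suc i)) z \<noteq> Some (Vtx (w k i))" if "z \<in> segs" for z
        by (cases z) auto
    qed (use k i True w_less[of k i] in auto)
    then show ?thesis
      using True by (simp add: tseg arr_def)
  next
    case False
    then show ?thesis
      unfolding tseg using k i w_less[of k i] len_pos[OF k] by (simp add: arr_def T_basis_mult_RR)
  qed
qed

text \<open>Two old arrows have a nonzero product only when adjacent on a chain. A new arrow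
  survives only after the last arrow, or before the first arrow, of its own maximal path. Two new
  arrows multiply to zero.\<close>

lemma arr_arr_zero:
  assumes k: "k < M" "i \<le> len k" and k': "k' < M" "i' \<le> len k'" and ne: "(k', i') \<noteq> (k, Suc i mod Suc (len k))"
  shows "arr (k, i) \<otimes>\<^bsub>T\<^esub> arr (k', i') = \<zero>\<^bsub>T\<^esub>"
proof (cases "i < len k"; cases "i' < len k'")
  assume i: "i < len k" and i': "i' < len k'"
  then show ?thesis
    using k k' ne by (auto simp: arr_def T_basis_mult_LL)
next
  assume i: "i < len k" and i': "\<not> i' < len k'"
  have "T_basis (Inl (Seg k i (Suc i))) \<otimes>\<^bsub>T\<^esub> T_basis (Inr (Seg k' 0 (len k'))) = \<zero>\<^bsub>T\<^esub>"
  proof (rule T_basis_mult_LR(2))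
    show "segment_mult w z (Seg k i (Suc i)) \<noteq> Some (Seg k' 0 (len k'))" if "z \<in> segs" for z
      using ne i i' k' by (cases z) auto
  qed (use k k' i len_pos[of k'] in auto)
  then show ?thesis
    using i i' by (simp add: arr_def)
next
  assume i: "\<not> i < len k" and i': "i' < len k'"
  have "T_basis (Inr (Seg k 0 (len k))) \<otimes>\<^bsub>T\<^esub> T_basis (Inl (Seg k' i' (Suc i'))) = \<zero>\<^bsub>T\<^esub>"
  proof (rule T_basis_mult_RL(2))
    have "Suc i mod Suc (len k) = 0"
      using i k by simp
    then show "segment_mult w (Seg k' i' (Suc i')) z \<noteq> Some (Seg k 0 (len k))" if "z \<in> segs" for z
      using ne by (cases z) auto
  qed (use k k' i' len_pos[of k] in auto)
  then show ?thesis
    using i i' by (simp add: arr_def)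
next
  assume i: "\<not> i < len k" and i': "\<not> i' < len k'"
  then show ?thesis
    using k k' len_pos by (simp add: arr_def T_basis_mult_RR)
qed

text \<open>The vertices \<open>k < M\<close> of the Brauer configuration are the maximal paths; a polygon that would
  otherwise have a single element receives the additional truncated vertex \<open>M + v\<close>.\<close>

definition occ :: "nat \<Rightarrow> nat" where
  "occ v = (\<Sum>k<M. count_list (map (w k) [0..<Suc (len k)]) v)"

text \<open>The cyclic ordering at \<open>k\<close> lists all \<open>len k + 1\<close> vertices of
  the maximal path with repetitions, so closing it up adds one arrow from the last vertex to the
  first.\<close>

definition \<Gamma> :: "(nat, nat) brauer_config" where
  "\<Gamma> = \<lparr>bverts = {..<M} \<union> {M + v | v. v < N \<and> occ v = 1},
    bpolys = {..<N},
    polygon = (\<lambda>v. (\<Sum>k<M. replicate_mset (count_list (map (w k) [0..<Suc (len k)]) v) k)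
      + (if occ v = 1 then {#M + v#} else {#})),
    bmult = (\<lambda>_. 1),
    orient = (\<lambda>\<alpha>. if \<alpha> < M then map (w \<alpha>) [0..<Suc (len \<alpha>)] else [\<alpha> - M])\<rparr>"

lemma count_polygon:
  "k < M \<Longrightarrow> count (polygon \<Gamma> v) k = count_list (map (w k) [0..<Suc (len k)]) v"
  "count (polygon \<Gamma> v) (M + u) = (if occ v = 1 \<and> u = v then 1 else 0)"
  by (auto simp: \<Gamma>_def count_sum sum.delta not_in_iff simp del: upt_Suc)

lemma orient_set: "k < M \<Longrightarrow> set (map (w k) [0..<Suc (len k)]) \<subseteq> {..<N}"
  using w_less by (auto simp: less_Suc_eq_le simp del: upt_Suc)

lemma \<Gamma>_simps [simp]:
  "bmult \<Gamma> \<alpha> = 1" "bpolys \<Gamma> = {..<N}" "k < M \<Longrightarrow> orient \<Gamma> k = map (w k) [0..<Suc (len k)]"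
  "orient \<Gamma> (M + v) = [v]"
  by (simp_all add: \<Gamma>_def)

lemma val_simps [simp]:
  "k < M \<Longrightarrow> val \<Gamma> k = Suc (len k)"
  "\<lbrakk>v < N; occ v = 1\<rbrakk> \<Longrightarrow> val \<Gamma> (M + v) = 1"
proof -
  assume k: "k < M"
  have "val \<Gamma> k = (\<Sum>v<N. count_list (map (w k) [0..<Suc (len k)]) v)"
    unfolding val_def by (rule sum.cong) (simp_all add: count_polygon(1)[OF k] del: upt_Suc)
  also have "\<dots> = length (map (w k) [0..<Suc (len k)])"
    by (rule sum_count_set[OF orient_set[OF k]]) simp
  finally show "val \<Gamma> k = Suc (len k)"
    by simp
next
  assume v: "v < N" "occ v = 1"
  have "val \<Gamma> (M + v) = (\<Sum>u<N. if u = v then 1 else 0)"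
    unfolding val_def using v by (intro sum.cong) (auto simp: count_polygon(2))
  then show "val \<Gamma> (M + v) = 1"
    using v by simp
qed

lemma bverts_\<Gamma>: "bverts \<Gamma> = {..<M} \<union> {M + v | v. v < N \<and> occ v = 1}"
  by (simp add: \<Gamma>_def)

text \<open>A maximal path has an arrow, hence at least two vertex positions, so its valency exceeds
  one; the added vertices have valency and multiplicity one.\<close>

lemma nontruncated: "nontruncated \<Gamma> = {..<M}"
proof -
  have len_eq: "(len k = 0) = False" if "k < M" for k
    using len_pos[OF that] by simp
  show ?thesis
    by (auto simp: nontruncated_def bverts_\<Gamma> len_eq)
qed

lemma size_polygon: "size (polygon \<Gamma> v) = occ v + (if occ v = 1 then 1 else 0)"
  by (simp add: \<Gamma>_def occ_def del: upt_Suc)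

text \<open>A vertex on some maximal path gets a polygon of size at least two, thanks to the added
  truncated element. A vertex on none would get an empty polygon, which is what \<open>cover\<close>
  excludes.\<close>

lemma brauer_configuration_\<Gamma>:
  assumes cover: "\<And>v. v < N \<Longrightarrow> \<exists>k<M. \<exists>i\<le>len k. v = w k i"
  shows "brauer_configuration \<Gamma>"
proof -
  have in_polygon: "k \<in># polygon \<Gamma> (w k i)" if "k < M" "i \<le> len k" for k i
  proof -
    have "w k i \<in> set (map (w k) [0..<Suc (len k)])"
      using that by (auto simp: less_Suc_eq_le simp del: upt_Suc)
    then have "count_list (map (w k) [0..<Suc (len k)]) (w k i) \<noteq> 0"
      by (simp add: count_list_0_iff del: upt_Suc)
    then show ?thesis
      using that by (simp add: count_polygon flip: count_greater_zero_iff del: upt_Suc)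
  qed
  have polygon_subset: "set_mset (polygon \<Gamma> v) \<subseteq> bverts \<Gamma>" if "v < N" for v
    using that by (auto simp: \<Gamma>_def set_mset_sum split: if_splits)
  have occ_pos: "0 < occ v" if v: "v < N" for v
  proof -
    obtain k i where ki: "k < M" "i \<le> len k" "v = w k i"
      using cover[OF v] by blast
    have "size (polygon \<Gamma> v) \<noteq> 0"
      using in_polygon[OF ki(1,2)] ki(3) by auto
    then show ?thesis
      by (auto simp: size_polygon split: if_splits)
  qed
  show ?thesis
    unfolding brauer_configuration_def
  proof (intro conjI ballI)
    show "finite (bverts \<Gamma>)"
      by (auto simp: \<Gamma>_def)
    show "finite (bpolys \<Gamma>)" by simp
    fix v assume v: "v \<in> bpolys \<Gamma>"
    show "set_mset (polygon \<Gamma> v) \<subseteq> bverts \<Gamma>"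
      using polygon_subset v by simp
    show "2 \<le> size (polygon \<Gamma> v)"
      using occ_pos[of v] v by (auto simp: size_polygon)
    obtain k i where ki: "k < M" "i \<le> len k" "v = w k i"
      using cover[of v] v by auto
    then show "\<exists>\<alpha>. \<alpha> \<in># polygon \<Gamma> v \<and> 1 < val \<Gamma> \<alpha> * bmult \<Gamma> \<alpha>"
      using in_polygon len_pos by (intro exI[of _ k]) auto
  next
    fix \<alpha> assume \<alpha>: "\<alpha> \<in> bverts \<Gamma>"
    show "0 < bmult \<Gamma> \<alpha>" by simp
    then consider "\<alpha> < M" | u where "u < N" "occ u = 1" "\<alpha> = M + u"
      using \<alpha> by (auto simp: bverts_\<Gamma>)
    note \<alpha>_cases = this
    show "set (orient \<Gamma> \<alpha>) \<subseteq> bpolys \<Gamma>"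
      using \<alpha>_cases by cases (use orient_set in auto)
    show "\<exists>V\<in>bpolys \<Gamma>. \<alpha> \<in># polygon \<Gamma> V"
      using \<alpha>_cases
    proof cases
      case 1
      then show ?thesis
        using in_polygon[of \<alpha> 0] w_less[of \<alpha> 0] by auto
    next
      case 2
      then show ?thesis
        by (intro bexI[of _ u]) (auto simp: count_polygon simp flip: count_greater_zero_iff)
    qed
    fix v assume "v \<in> bpolys \<Gamma>"
    show "count_list (orient \<Gamma> \<alpha>) v = count (polygon \<Gamma> v) \<alpha>"
      using \<alpha>_cases by cases (auto simp: count_polygon simp del: upt_Suc)
  qed
qed

end

section \<open>The Brauer quiver, its special cycles and its relations\<close>

context chain_algebra
begin

abbreviation "BQ \<equiv> brauer_quiver \<Gamma>"

lemma verts_BQ: "verts BQ = {..<N}"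
  and arcs_BQ: "(k, i) \<in> arcs BQ \<longleftrightarrow> k < M \<and> i \<le> len k"
  and tail_BQ: "\<lbrakk>k < M; i \<le> len k\<rbrakk> \<Longrightarrow> tail BQ (k, i) = w k i"
  and head_BQ: "\<lbrakk>k < M; i \<le> len k\<rbrakk> \<Longrightarrow> head BQ (k, i) = w k (Suc i mod Suc (len k))"
proof -
  have nth: "map (w k) [0..<Suc (len k)] ! j = w k j" if "j \<le> len k" for k j
    using that by (simp add: less_Suc_eq_le nth_append del: upt_Suc)
  show "verts BQ = {..<N}"
    by (simp add: brauer_quiver_def)
  show "(k, i) \<in> arcs BQ \<longleftrightarrow> k < M \<and> i \<le> len k"
    by (auto simp: brauer_quiver_def nontruncated)
  show "tail BQ (k, i) = w k i" if "k < M" "i \<le> len k"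
    using that nth by (simp add: brauer_quiver_def del: upt_Suc)
  show "head BQ (k, i) = w k (Suc i mod Suc (len k))" if "k < M" "i \<le> len k"
    using that nth[of "Suc i mod Suc (len k)" k] mod_less_divisor[of "Suc (len k)" "Suc i"]
    by (simp add: brauer_quiver_def less_Suc_eq_le del: upt_Suc mod_less_divisor)
qed

lemma quiver_BQ: "quiver BQ"
proof -
  have "arcs BQ \<subseteq> (SIGMA k:{..<M}. {..len k})"
    using arcs_BQ by auto
  then have "finite (arcs BQ)"
    by (rule finite_subset) auto
  moreover have "tail BQ a \<in> verts BQ \<and> head BQ a \<in> verts BQ" if "a \<in> arcs BQ" for a
  proof (cases a)
    case (Pair k i)
    then show ?thesis
      using that w_less[of k i] w_less[of k "Suc i mod Suc (len k)"] mod_less_divisor[of "Suc (len k)" "Suc i"]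
      by (simp add: arcs_BQ tail_BQ head_BQ verts_BQ less_Suc_eq_le del: mod_less_divisor)
  qed
  ultimately show ?thesis
    by unfold_locales (auto simp: verts_BQ)
qed

sublocale BQ: quiver BQ
  by (rule quiver_BQ)

text \<open>\<open>rep.lin\<close> is now the homomorphism from the path algebra of the Brauer
  quiver to T(A).\<close>

sublocale rep: path_representation BQ T "segs <+> segs" T_basis T_coord idem arr
proof
  show "idem v \<in> carrier T" if "v \<in> verts BQ" for v
    using that by (simp add: idem_def verts_BQ T.b_closed)
  show "arr a \<in> carrier T" if "a \<in> arcs BQ" for a
    using that by (cases a) (simp add: arcs_BQ arr_closed)
  show "idem u \<otimes>\<^bsub>T\<^esub> idem v = (if u = v then idem u else \<zero>\<^bsub>T\<^esub>)" if "u \<in> verts BQ" "v \<in> verts BQ" for u v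
    using that by (simp add: idem_mult verts_BQ)
  show "idem (tail BQ a) \<otimes>\<^bsub>T\<^esub> arr a = arr a" if "a \<in> arcs BQ" for a
    using that by (cases a) (simp add: arcs_BQ idem_arr tail_BQ)
  show "arr a \<otimes>\<^bsub>T\<^esub> idem (head BQ a) = arr a" if "a \<in> arcs BQ" for a
    using that by (cases a) (simp add: arcs_BQ arr_idem head_BQ)
  show "(\<Oplus>\<^bsub>T\<^esub>v\<in>verts BQ. idem v) = \<one>\<^bsub>T\<^esub>"
    by (simp add: verts_BQ idem_sum)
qed

abbreviation BA :: "('k, (nat, nat \<times> nat) path \<Rightarrow> 'k) module" where
  "BA \<equiv> path_algebra BQ"

text \<open>Winds around the special cycle of \<open>k\<close> from position \<open>i\<close>; the
  length \<open>l\<close> may exceed one turn, and \<open>l = Suc (len k)\<close> is the special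
  cycle itself.\<close>

definition cyc :: "nat \<Rightarrow> nat \<Rightarrow> nat \<Rightarrow> (nat, nat \<times> nat) path" where
  "cyc k i l = (w k i, map (\<lambda>t. (k, (i + t) mod Suc (len k))) [0..<l])"

lemma cyc_0 [simp]: "cyc k i 0 = (w k i, [])"
  and cyc_Suc: "cyc k i (Suc l) = (w k i, snd (cyc k i l) @ [(k, (i + l) mod Suc (len k))])"
  and fst_cyc [simp]: "fst (cyc k i l) = w k i"
  and length_cyc [simp]: "length (snd (cyc k i l)) = l"
  by (simp_all add: cyc_def)

lemma hd_cyc: "\<lbrakk>i \<le> len k; 0 < l\<rbrakk> \<Longrightarrow> hd (snd (cyc k i l)) = (k, i)"
  by (cases l) (simp_all add: cyc_def upt_conv_Cons del: upt_Suc)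

lemma mod_len_le [simp]: "i mod Suc (len k) \<le> len k"
  using mod_less_divisor[of "Suc (len k)" i] by (simp add: less_Suc_eq_le del: mod_less_divisor)

lemma cyc_path:
  assumes "k < M" "i \<le> len k"
  shows "cyc k i l \<in> paths BQ \<and> path_end BQ (cyc k i l) = w k ((i + l) mod Suc (len k))"
proof (induction l)
  case 0
  then show ?case
    using assms w_less[of k i] by (simp add: verts_BQ)
next
  case (Suc l)
  have cyc: "cyc k i l = (w k i, snd (cyc k i l))"
    by (simp add: prod_eq_iff)
  show ?case
    using Suc assms unfolding cyc_Suc
    by (subst (asm) (1 2) cyc) (simp add: BQ.paths_snoc_iff arcs_BQ tail_BQ head_BQ mod_Suc_eq)
qed

lemma cyc_image:
  assumes "k < M" "i \<le> len k" "l \<le> Suc (len k)"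
  shows "rep.path_image (cyc k i l) = T_basis (tseg k i l)"
  using assms(3)
proof (induction l)
  case 0
  then show ?case
    using assms by (simp add: tseg_def seg_def flip: idem_def)
next
  case (Suc l)
  have cyc: "cyc k i l = (w k i, snd (cyc k i l))"
    by (simp add: prod_eq_iff)
  have "rep.path_image (cyc k i (Suc l)) = rep.path_image (cyc k i l) \<otimes>\<^bsub>T\<^esub> arr (k, (i + l) mod Suc (len k))"
    unfolding cyc_Suc rep.path_image_snoc using cyc by simp
  then show ?case
    using Suc assms tseg_arr[of k i l] by simp
qed

abbreviation full :: "nat \<Rightarrow> nat \<Rightarrow> (nat, nat \<times> nat) path" where
  "full k i \<equiv> cyc k i (Suc (len k))"

definition relators :: "((nat, nat \<times> nat) path \<Rightarrow> 'k) set" where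
  "relators =
    {path_elem (full k i) \<ominus>\<^bsub>BA\<^esub> path_elem (full k' i') | k i k' i'.
      k < M \<and> i \<le> len k \<and> k' < M \<and> i' \<le> len k' \<and> w k i = w k' i'} \<union>
    {path_elem (full k i) \<otimes>\<^bsub>BA\<^esub> arrow_elem BQ (k, i) | k i. k < M \<and> i \<le> len k} \<union>
    {arrow_elem BQ (k, i) \<otimes>\<^bsub>BA\<^esub> arrow_elem BQ (k', i') | k i k' i'.
      k < M \<and> i \<le> len k \<and> k' < M \<and> i' \<le> len k' \<and> (k', i') \<noteq> (k, Suc i mod Suc (len k))}"

lemma special_cycles_\<Gamma>: "k < M \<Longrightarrow> special_cycles \<Gamma> k = full k ` {..len k}"
proof -
  assume k: "k < M"
  have "(orient \<Gamma> k ! i, rotate i (map (Pair k) [0..<val \<Gamma> k])) = full k i" if "i \<le> len k" for i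
  proof -
    have "orient \<Gamma> k ! i = w k i"
      using k that by (simp add: less_Suc_eq_le nth_append del: upt_Suc)
    moreover have "rotate i (map (Pair k) [0..<Suc (len k)]) = map (\<lambda>t. (k, (i + t) mod Suc (len k))) [0..<Suc (len k)]"
      by (rule nth_equalityI) (auto simp: nth_rotate simp del: upt_Suc)
    ultimately show ?thesis
      using k by (simp add: cyc_def del: upt_Suc)
  qed
  then show ?thesis
    unfolding special_cycles_def using k by (simp add: lessThan_Suc_atMost cong: image_cong_simp)
qed

text \<open>Every rotation of the cycle counts as special, so the pair across the seam is a subpath
  too: the rotation starting at \<open>(k, i)\<close> begins with the pair, having at least two
  arrows.\<close>

lemma sublist_full_iff:
  assumes "k < M" "i \<le> len k" "k' < M" "i' \<le> len k'"
  shows "(\<exists>\<alpha>\<in>nontruncated \<Gamma>. \<exists>C\<in>special_cycles \<Gamma> \<alpha>. sublist [(k, i), (k', i')] (snd C))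
    \<longleftrightarrow> (k', i') = (k, Suc i mod Suc (len k))"
proof
  assume "\<exists>\<alpha>\<in>nontruncated \<Gamma>. \<exists>C\<in>special_cycles \<Gamma> \<alpha>. sublist [(k, i), (k', i')] (snd C)"
  then obtain \<alpha> j where \<alpha>: "\<alpha> < M" "j \<le> len \<alpha>" and "sublist [(k, i), (k', i')] (snd (full \<alpha> j))"
    by (auto simp: nontruncated special_cycles_\<Gamma>)
  then obtain ps ss where ps: "snd (full \<alpha> j) = ps @ [(k, i), (k', i')] @ ss"
    by (auto simp: sublist_def)
  let ?t = "length ps"
  have "Suc (len \<alpha>) = ?t + (2 + length ss)"
    using arg_cong[OF ps, of length] by simp
  then have t: "?t < Suc (len \<alpha>)" "Suc ?t < Suc (len \<alpha>)"
    by auto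
  have nth: "snd (full \<alpha> j) ! t = (\<alpha>, (j + t) mod Suc (len \<alpha>))" if "t < Suc (len \<alpha>)" for t
    using that by (simp add: cyc_def del: upt_Suc)
  have "(k, i) = (\<alpha>, (j + ?t) mod Suc (len \<alpha>))" "(k', i') = (\<alpha>, (j + Suc ?t) mod Suc (len \<alpha>))"
    using nth[OF t(1)] nth[OF t(2)] unfolding ps by (simp_all add: nth_append)
  then show "(k', i') = (k, Suc i mod Suc (len k))"
    by (simp add: mod_Suc_eq)
next
  assume eq: "(k', i') = (k, Suc i mod Suc (len k))"
  have "snd (full k i) = map (\<lambda>t. (k, (i + t) mod Suc (len k))) ([0, 1] @ [2..<Suc (len k)])"
    using len_pos[OF assms(1)] by (simp add: cyc_def upt_conv_Cons numeral_2_eq_2 del: upt_Suc)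
  then have "snd (full k i) = [] @ [(k, i), (k', i')] @ map (\<lambda>t. (k, (i + t) mod Suc (len k))) [2..<Suc (len k)]"
    using eq assms by simp
  then have "sublist [(k, i), (k', i')] (snd (full k i))"
    unfolding sublist_def by blast
  then show "\<exists>\<alpha>\<in>nontruncated \<Gamma>. \<exists>C\<in>special_cycles \<Gamma> \<alpha>. sublist [(k, i), (k', i')] (snd C)"
    using assms special_cycles_\<Gamma>[OF assms(1)] nontruncated by blast
qed

lemma brauer_relations_\<Gamma>: "brauer_relations \<Gamma> = relators"
proof -
  interpret P: K_algebra "BA"
    by (rule BQ.path_algebra_K_algebra)
  have pow: "path_elem C [^]\<^bsub>BA\<^esub> bmult \<Gamma> \<alpha> = (path_elem C :: _ \<Rightarrow> 'k)" if "C \<in> paths BQ" for C \<alpha>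
    using that by simp
  have cyc_iff: "\<alpha> \<in> nontruncated \<Gamma> \<and> C \<in> special_cycles \<Gamma> \<alpha> \<longleftrightarrow> \<alpha> < M \<and> (\<exists>i\<le>len \<alpha>. C = full \<alpha> i)" for \<alpha> C
    by (auto simp: nontruncated special_cycles_\<Gamma>)
  have full: "full k i \<in> paths BQ" if "k < M" "i \<le> len k" for k i
    using cyc_path[OF that] by blast
  have ex: "(\<exists>\<alpha> \<beta> C C'. x = path_elem C [^]\<^bsub>BA\<^esub> bmult \<Gamma> \<alpha> \<ominus>\<^bsub>BA\<^esub>
          path_elem C' [^]\<^bsub>BA\<^esub> bmult \<Gamma> \<beta> \<and>
        \<alpha> \<in> nontruncated \<Gamma> \<and> \<beta> \<in> nontruncated \<Gamma> \<and>
        C \<in> special_cycles \<Gamma> \<alpha> \<and> C' \<in> special_cycles \<Gamma> \<beta> \<and> fst C = fst C')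
    \<longleftrightarrow> (\<exists>k i k' i'. x = path_elem (full k i) \<ominus>\<^bsub>BA\<^esub> path_elem (full k' i') \<and>
      k < M \<and> i \<le> len k \<and> k' < M \<and> i' \<le> len k' \<and> w k i = w k' i')" (is "?L \<longleftrightarrow> ?R")
    for x :: "_ \<Rightarrow> 'k"
  proof
    assume ?L
    then obtain k k' C C' where x: "x = path_elem C [^]\<^bsub>BA\<^esub> bmult \<Gamma> k \<ominus>\<^bsub>BA\<^esub>
          path_elem C' [^]\<^bsub>BA\<^esub> bmult \<Gamma> k'"
        and *: "k \<in> nontruncated \<Gamma>" "C \<in> special_cycles \<Gamma> k" "k' \<in> nontruncated \<Gamma>"
          "C' \<in> special_cycles \<Gamma> k'" "fst C = fst C'"
      by blast
    obtain i i' where i: "k < M" "i \<le> len k" "C = full k i" "k' < M" "i' \<le> len k'" "C' = full k' i'"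
      using * cyc_iff by blast
    have "x = path_elem (full k i) \<ominus>\<^bsub>BA\<^esub> path_elem (full k' i')"
      unfolding x i(3,6) pow[OF full[OF i(1,2)]] pow[OF full[OF i(4,5)]] ..
    then show ?R
      using i * by (metis fst_cyc)
  next
    assume ?R
    then obtain k i k' i' where x: "x = path_elem (full k i) \<ominus>\<^bsub>BA\<^esub> path_elem (full k' i')"
      and i: "k < M" "i \<le> len k" "k' < M" "i' \<le> len k'" "w k i = w k' i'"
      by blast
    have "x = path_elem (full k i) [^]\<^bsub>BA\<^esub> bmult \<Gamma> k \<ominus>\<^bsub>BA\<^esub>
          path_elem (full k' i') [^]\<^bsub>BA\<^esub> bmult \<Gamma> k'"
      unfolding x pow[OF full[OF i(1,2)]] pow[OF full[OF i(3,4)]] ..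
    moreover have "fst (full k i) = fst (full k' i')"
      using i by simp
    ultimately show ?L
      using i cyc_iff by blast
  qed
  have ex2: "(\<exists>\<alpha> C. x = path_elem C [^]\<^bsub>BA\<^esub> bmult \<Gamma> \<alpha> \<otimes>\<^bsub>BA\<^esub>
          arrow_elem BQ (hd (snd C)) \<and> \<alpha> \<in> nontruncated \<Gamma> \<and> C \<in> special_cycles \<Gamma> \<alpha>)
    \<longleftrightarrow> (\<exists>k i. x = path_elem (full k i) \<otimes>\<^bsub>BA\<^esub> arrow_elem BQ (k, i) \<and> k < M \<and> i \<le> len k)" (is "?L \<longleftrightarrow> ?R")
    for x :: "_ \<Rightarrow> 'k"
  proof
    assume ?L
    then obtain k C where x: "x = path_elem C [^]\<^bsub>BA\<^esub> bmult \<Gamma> k \<otimes>\<^bsub>BA\<^esub>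
          arrow_elem BQ (hd (snd C))" and *: "k \<in> nontruncated \<Gamma>" "C \<in> special_cycles \<Gamma> k"
      by blast
    obtain i where i: "k < M" "i \<le> len k" "C = full k i"
      using * cyc_iff by blast
    have "x = path_elem (full k i) \<otimes>\<^bsub>BA\<^esub> arrow_elem BQ (k, i)"
      unfolding x i(3) pow[OF full[OF i(1,2)]] hd_cyc[OF i(2) zero_less_Suc] ..
    then show ?R
      using i by blast
  next
    assume ?R
    then obtain k i where x: "x = path_elem (full k i) \<otimes>\<^bsub>BA\<^esub> arrow_elem BQ (k, i)"
      and i: "k < M" "i \<le> len k"
      by blast
    have "x = path_elem (full k i) [^]\<^bsub>BA\<^esub> bmult \<Gamma> k \<otimes>\<^bsub>BA\<^esub>
          arrow_elem BQ (hd (snd (full k i)))"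
      unfolding x pow[OF full[OF i]] hd_cyc[OF i(2) zero_less_Suc] ..
    then show ?L
      using i cyc_iff by blast
  qed
  \<comment> \<open>A special cycle has at least two arrows. This discharges the condition on loops
    in the third family of relations.\<close>
  have loop: "\<not> (\<exists>\<alpha>\<in>nontruncated \<Gamma>. \<exists>C\<in>special_cycles \<Gamma> \<alpha>. snd C = [a])" for a
  proof
    assume "\<exists>\<alpha>\<in>nontruncated \<Gamma>. \<exists>C\<in>special_cycles \<Gamma> \<alpha>. snd C = [a]"
    then obtain k i where "k < M" "snd (full k i) = [a]"
      by (auto simp: nontruncated special_cycles_\<Gamma>)
    then show False
      using length_cyc[of k i "Suc (len k)"] len_pos[of k] by simp
  qed
  have no_sublist: "(\<forall>\<alpha>\<in>nontruncated \<Gamma>. \<forall>C\<in>special_cycles \<Gamma> \<alpha>. \<not> sublist [a, c] (snd C)) \<longleftrightarrow>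
      c \<noteq> (fst a, Suc (snd a) mod Suc (len (fst a)))" if "a \<in> arcs BQ" "c \<in> arcs BQ" for a c
    using sublist_full_iff[of "fst a" "snd a" "fst c" "snd c"] that arcs_BQ[of "fst a" "snd a"]
      arcs_BQ[of "fst c" "snd c"] by (simp only: prod.collapse) blast
  have ex3: "(\<exists>a c. x = arrow_elem BQ a \<otimes>\<^bsub>BA\<^esub> arrow_elem BQ c \<and> a \<in> arcs BQ \<and> c \<in> arcs BQ \<and>
       (\<forall>\<alpha>\<in>nontruncated \<Gamma>. \<forall>C\<in>special_cycles \<Gamma> \<alpha>. \<not> sublist [a, c] (snd C)) \<and>
       \<not> (a = c \<and> (\<exists>\<alpha>\<in>nontruncated \<Gamma>. \<exists>C\<in>special_cycles \<Gamma> \<alpha>. snd C = [a])))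
    \<longleftrightarrow> (\<exists>k i k' i'. x = arrow_elem BQ (k, i) \<otimes>\<^bsub>BA\<^esub> arrow_elem BQ (k', i') \<and>
      k < M \<and> i \<le> len k \<and> k' < M \<and> i' \<le> len k' \<and> (k', i') \<noteq> (k, Suc i mod Suc (len k)))" (is "?L \<longleftrightarrow> ?R")
    for x :: "_ \<Rightarrow> 'k"
  proof
    assume ?L
    then obtain a c where x: "x = arrow_elem BQ a \<otimes>\<^bsub>BA\<^esub> arrow_elem BQ c"
      and ac: "a \<in> arcs BQ" "c \<in> arcs BQ"
      and s: "\<forall>\<alpha>\<in>nontruncated \<Gamma>. \<forall>C\<in>special_cycles \<Gamma> \<alpha>. \<not> sublist [a, c] (snd C)"
      by (elim exE conjE) (rule that)
    obtain k i k' i' where a: "a = (k, i)" and c: "c = (k', i')"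
      by (metis surj_pair)
    have "x = arrow_elem BQ (k, i) \<otimes>\<^bsub>BA\<^esub> arrow_elem BQ (k', i') \<and>
      k < M \<and> i \<le> len k \<and> k' < M \<and> i' \<le> len k' \<and> (k', i') \<noteq> (k, Suc i mod Suc (len k))"
      using x ac s[unfolded no_sublist[OF ac]] arcs_BQ unfolding a c fst_conv snd_conv by blast
    then show ?R
      by (intro exI)
  next
    assume ?R
    then obtain k i k' i' where x: "x = arrow_elem BQ (k, i) \<otimes>\<^bsub>BA\<^esub> arrow_elem BQ (k', i')"
      and "k < M" "i \<le> len k" "k' < M" "i' \<le> len k'" and ne: "(k', i') \<noteq> (k, Suc i mod Suc (len k))"
      by (elim exE conjE) (rule that)
    then have ac: "(k, i) \<in> arcs BQ" "(k', i') \<in> arcs BQ"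
      by (simp_all add: arcs_BQ)
    have "\<forall>\<alpha>\<in>nontruncated \<Gamma>. \<forall>C\<in>special_cycles \<Gamma> \<alpha>. \<not> sublist [(k, i), (k', i')] (snd C)"
      unfolding no_sublist[OF ac] using ne by simp
    then have "x = arrow_elem BQ (k, i) \<otimes>\<^bsub>BA\<^esub> arrow_elem BQ (k', i') \<and>
       (k, i) \<in> arcs BQ \<and> (k', i') \<in> arcs BQ \<and>
       (\<forall>\<alpha>\<in>nontruncated \<Gamma>. \<forall>C\<in>special_cycles \<Gamma> \<alpha>. \<not> sublist [(k, i), (k', i')] (snd C)) \<and>
       \<not> ((k, i) = (k', i') \<and> (\<exists>\<alpha>\<in>nontruncated \<Gamma>. \<exists>C\<in>special_cycles \<Gamma> \<alpha>. snd C = [(k, i)]))"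
      using x ac loop by blast
    then show ?L
      by (intro exI)
  qed
  show ?thesis
    unfolding brauer_relations_def relators_def Let_def
    by (intro arg_cong2[where f = "(\<union>)"] Collect_cong) (rule ex ex2 ex3)+
qed

end

section \<open>The Brauer ideal as the kernel\<close>

context chain_algebra
begin

interpretation P: K_algebra BA
  by (rule BQ.path_algebra_K_algebra)

abbreviation J :: "((nat, nat \<times> nat) path \<Rightarrow> 'k) set" where
  "J \<equiv> brauer_ideal \<Gamma>"

lemma full_path: "\<lbrakk>k < M; i \<le> len k\<rbrakk> \<Longrightarrow> full k i \<in> paths BQ"
  using cyc_path by blast

lemma relatorsI:
  "\<lbrakk>k < M; i \<le> len k; k' < M; i' \<le> len k'; w k i = w k' i'\<rbrakk> \<Longrightarrow>
    path_elem (full k i) \<ominus>\<^bsub>BA\<^esub> path_elem (full k' i') \<in> relators"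
  "\<lbrakk>k < M; i \<le> len k\<rbrakk> \<Longrightarrow> path_elem (full k i) \<otimes>\<^bsub>BA\<^esub> arrow_elem BQ (k, i) \<in> relators"
  "\<lbrakk>k < M; i \<le> len k; k' < M; i' \<le> len k'; (k', i') \<noteq> (k, Suc i mod Suc (len k))\<rbrakk> \<Longrightarrow>
    arrow_elem BQ (k, i) \<otimes>\<^bsub>BA\<^esub> arrow_elem BQ (k', i') \<in> relators"
  unfolding relators_def
    apply (rule UnI1, rule UnI1, rule CollectI, intro exI conjI, rule refl, assumption+)
   apply (rule UnI1, rule UnI2, rule CollectI, intro exI conjI, rule refl, assumption+)
  apply (rule UnI2, rule CollectI, intro exI conjI, rule refl, assumption+)
  done

lemma relators_arrow_ideal: "relators \<subseteq> arrow_ideal_power BQ 2"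
proof -
  interpret I2: ideal "arrow_ideal_power BQ 2" BA
    by (rule BQ.arrow_ideal_power_ideal)
  have full: "path_elem (full k i) \<in> (arrow_ideal_power BQ 2 :: (_ \<Rightarrow> 'k) set)" if "k < M" "i \<le> len k" for k i
    using full_path[OF that] len_pos[OF that(1)] by (intro BQ.path_elem_in_arrow_ideal_power) auto
  have minus: "f \<ominus>\<^bsub>BA\<^esub> g \<in> arrow_ideal_power BQ 2"
    if "f \<in> arrow_ideal_power BQ 2" "g \<in> arrow_ideal_power BQ 2" for f g
    using that I2.a_closed I2.a_inv_closed by (simp add: P.M.minus_eq)
  have r1: "path_elem (full k i) \<ominus>\<^bsub>BA\<^esub> path_elem (full k' i') \<in> arrow_ideal_power BQ 2"
    if "k < M" "i \<le> len k" "k' < M" "i' \<le> len k'" for k i k' i'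
    by (rule minus[OF full[OF that(1,2)] full[OF that(3,4)]])
  have r2: "path_elem (full k i) \<otimes>\<^bsub>BA\<^esub> arrow_elem BQ (k, i) \<in> arrow_ideal_power BQ 2"
    if "k < M" "i \<le> len k" for k i
    using that by (intro I2.I_r_closed full BQ.arrow_elem_closed) (simp_all add: arcs_BQ)
  have r3: "arrow_elem BQ (k, i) \<otimes>\<^bsub>BA\<^esub> arrow_elem BQ (k', i') \<in> arrow_ideal_power BQ 2"
    if "k < M" "i \<le> len k" "k' < M" "i' \<le> len k'" for k i k' i'
    using that by (intro BQ.arrow_mult_in_arrow_ideal) (simp_all add: arcs_BQ)
  show ?thesis
    unfolding relators_def by (intro Un_least subsetI; elim CollectE exE conjE; hypsubst; rule r1 r2 r3; assumption)
qed

lemma relators_closed: "relators \<subseteq> carrier BA"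
  using relators_arrow_ideal by (auto simp: arrow_ideal_power_def)

lemma J_eq: "J = Idl\<^bsub>BA\<^esub> relators"
  by (simp add: brauer_ideal_def brauer_relations_\<Gamma>)

lemma J_ideal: "ideal J BA"
  unfolding J_eq by (rule P.genideal_ideal[OF relators_closed])

interpretation J: ideal J BA
  by (rule J_ideal)

lemma relators_J: "relators \<subseteq> J"
  unfolding J_eq by (rule P.genideal_self[OF relators_closed])

lemma lin_arrow: "a \<in> arcs BQ \<Longrightarrow> rep.lin (arrow_elem BQ a) = arr a"
  by (simp add: arrow_elem_def rep.lin_path_elem rep.path_image_single)

lemma lin_full: "\<lbrakk>k < M; i \<le> len k\<rbrakk> \<Longrightarrow> rep.lin (path_elem (full k i)) = T_basis (Inr (Vtx (w k i)))"
  by (simp add: rep.lin_path_elem full_path cyc_image) (simp add: tseg_def seg_def)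

text \<open>The kernel is an ideal, so only the generators are checked. The difference of two full
  cycles vanishes because both go to the dual of the trivial path at their common vertex.\<close>

lemma J_lin: "f \<in> J \<Longrightarrow> rep.lin f = \<zero>\<^bsub>T\<^esub>"
proof -
  have "rep.lin f = \<zero>\<^bsub>T\<^esub>" if "f \<in> relators" for f
  proof -
    from that consider
      k i k' i' where "f = path_elem (full k i) \<ominus>\<^bsub>BA\<^esub> path_elem (full k' i')"
        "k < M" "i \<le> len k" "k' < M" "i' \<le> len k'" "w k i = w k' i'"
      | k i where "f = path_elem (full k i) \<otimes>\<^bsub>BA\<^esub> arrow_elem BQ (k, i)" "k < M" "i \<le> len k"
      | k i k' i' where "f = arrow_elem BQ (k, i) \<otimes>\<^bsub>BA\<^esub> arrow_elem BQ (k', i')"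
        "k < M" "i \<le> len k" "k' < M" "i' \<le> len k'" "(k', i') \<noteq> (k, Suc i mod Suc (len k))"
      unfolding relators_def by blast
    then show ?thesis
    proof cases
      case 1
      have pe: "path_elem (full k i) \<in> carrier BA" "path_elem (full k' i') \<in> carrier BA"
        using 1 full_path by auto
      have "f = path_elem (full k i) \<oplus>\<^bsub>BA\<^esub> (-1) \<odot>\<^bsub>BA\<^esub> path_elem (full k' i')"
        using 1 pe by (simp add: P.K_smult_minus P.M.minus_eq)
      then have "rep.lin f = rep.lin (path_elem (full k i)) \<oplus>\<^bsub>T\<^esub> (-1) \<odot>\<^bsub>T\<^esub> rep.lin (path_elem (full k' i'))"
        using pe by (simp only: rep.lin_add rep.lin_smult P.K_smult_closed)
      also have "\<dots> = \<zero>\<^bsub>T\<^esub>"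
        using 1 w_less[of k' i'] T.b_closed[of "Inr (Vtx (w k' i'))"]
        by (simp add: lin_full T.K_smult_minus T.M.r_neg)
      finally show ?thesis .
    next
      case 2
      then have "rep.lin f = rep.lin (path_elem (full k i)) \<otimes>\<^bsub>T\<^esub> arr (k, i)"
        using full_path arcs_BQ by (simp add: rep.lin_mult lin_arrow BQ.arrow_elem_closed)
      then show ?thesis
        using full_cycle_arr[OF 2(2,3)] 2 by (simp add: lin_full tseg_def seg_def)
    next
      case 3
      then show ?thesis
        using arcs_BQ by (simp add: rep.lin_mult lin_arrow BQ.arrow_elem_closed arr_arr_zero)
    qed
  qed
  then have "J \<subseteq> {f \<in> carrier BA. rep.lin f = \<zero>\<^bsub>T\<^esub>}"
    unfolding J_eq using relators_closed by (intro P.genideal_minimal[OF rep.lin_kernel_ideal]) blast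
  then show "f \<in> J \<Longrightarrow> rep.lin f = \<zero>\<^bsub>T\<^esub>"
    by blast
qed

text \<open>The normal form modulo \<open>J\<close>, by appending one arrow. An arrow lies on
  exactly one special cycle, so the first arrow selects the cycle. A later arrow either continues on
  it or completes a zero relation with its predecessor.\<close>

lemma path_cases:
  assumes "(v, as) \<in> paths BQ"
  shows "path_elem (v, as) \<in> J \<or> as = [] \<or>
    (\<exists>k i. k < M \<and> i \<le> len k \<and> (v, as) = cyc k i (length as) \<and> 0 < length as \<and> length as \<le> Suc (len k))"
  using assms
proof (induction as rule: rev_induct)
  case (snoc a as)
  note p = snoc.prems
  obtain k' i' where a: "a = (k', i')" by (cases a) blast
  have va: "(v, as) \<in> paths BQ" "k' < M" "i' \<le> len k'" "path_end BQ (v, as) = tail BQ a"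
    using p a arcs_BQ by (auto simp: BQ.paths_snoc_iff)
  have a_arc: "a \<in> arcs BQ"
    using va a arcs_BQ by simp
  have factor: "path_elem (v, as @ [a]) = path_elem (v, as) \<otimes>\<^bsub>BA\<^esub> arrow_elem BQ a"
    using BQ.path_elem_append[OF p] va(4) by (simp add: arrow_elem_def)
  consider "path_elem (v, as) \<in> J" | "as = []"
    | k i where "k < M" "i \<le> len k" "(v, as) = cyc k i (length as)" "0 < length as" "length as \<le> Suc (len k)"
    using snoc.IH[OF va(1)] by blast
  then show ?case
  proof cases
    case 1
    then have "path_elem (v, as @ [a]) \<in> J"
      unfolding factor by (rule J.I_r_closed[OF _ BQ.arrow_elem_closed[OF a_arc]])
    then show ?thesis ..
  next
    case 2
    then have "(v, as @ [a]) = cyc k' i' (length (as @ [a]))"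
      using va p a by (simp add: cyc_def tail_BQ)
    then show ?thesis
      using va 2 by auto
  next
    case 3
    define l where "l = length as"
    have v: "v = w k i" and as: "as = snd (cyc k i l)" and l: "0 < l" "l \<le> Suc (len k)"
      using arg_cong[OF 3(3), of fst] arg_cong[OF 3(3), of snd] 3(4,5) by (auto simp: l_def)
    show ?thesis
    proof (cases "a = (k, (i + l) mod Suc (len k))")
      case next_a: True
      have cyc: "(v, as @ [a]) = cyc k i (Suc l)"
        unfolding cyc_Suc as next_a v ..
      show ?thesis
      proof (cases "l \<le> len k")
        case True
        then show ?thesis
          using cyc 3 l_def by auto
      next
        \<comment> \<open>The path is already a full turn, so the next arrow repeats the first one
          and produces a relation of the second kind.\<close>
        case False
        then have l_eq: "l = Suc (len k)"
          using l by simp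
        then have "a = (k, i)"
          unfolding next_a l_eq mod_add_self2 using 3(2) by simp
        moreover have "(v, as) = full k i"
          using 3(3) l_eq l_def by simp
        ultimately have "path_elem (v, as @ [a]) \<in> relators"
          unfolding factor using relatorsI(2)[OF 3(1,2)] by (simp only:)
        then show ?thesis
          using relators_J by blast
      qed
    next
      case False
      \<comment> \<open>The last arrow \<open>c\<close> is split off, so that the zero relation
        \<open>c a\<close> appears as a factor at the end of the path.\<close>
      obtain l' where l': "l = Suc l'"
        using l by (cases l) auto
      define c where "c = (k, (i + l') mod Suc (len k))"
      have as_c: "as = snd (cyc k i l') @ [c]"
        unfolding as l' cyc_Suc c_def by simp
      have "(v, snd (cyc k i l')) \<in> paths BQ" "c \<in> arcs BQ" "path_end BQ (v, snd (cyc k i l')) = tail BQ c"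
        using va(1) unfolding as_c by (auto simp: BQ.paths_snoc_iff)
      note pc = this
      have "path_elem (v, as) = path_elem (v, snd (cyc k i l')) \<otimes>\<^bsub>BA\<^esub> arrow_elem BQ c"
        using BQ.path_elem_append[of v "snd (cyc k i l')" "[c]"] va(1) pc(3) unfolding as_c
        by (simp add: arrow_elem_def)
      then have "path_elem (v, as @ [a]) =
          path_elem (v, snd (cyc k i l')) \<otimes>\<^bsub>BA\<^esub> (arrow_elem BQ c \<otimes>\<^bsub>BA\<^esub> arrow_elem BQ a)"
        unfolding factor using pc a_arc by (simp add: P.A.m_assoc BQ.arrow_elem_closed)
      moreover have "(k', i') \<noteq> (k, Suc ((i + l') mod Suc (len k)) mod Suc (len k))"
        using False unfolding a l' mod_Suc_eq by simp
      then have "arrow_elem BQ c \<otimes>\<^bsub>BA\<^esub> arrow_elem BQ a \<in> relators"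
        unfolding c_def a by (intro relatorsI(3) 3(1) va(2,3) mod_len_le)
      ultimately have "path_elem (v, as @ [a]) \<in> J"
        using relators_J J.I_l_closed BQ.path_elem_closed[OF pc(1)] by auto
      then show ?thesis ..
    qed
  qed
qed simp

lemma J_admissible: "admissible BQ J"
  unfolding admissible_def
proof (intro conjI)
  show "ideal J BA" by (rule J_ideal)
  show "J \<subseteq> arrow_ideal_power BQ 2"
    unfolding J_eq by (rule P.genideal_minimal[OF BQ.arrow_ideal_power_ideal relators_arrow_ideal])
  \<comment> \<open>A path that avoids \<open>J\<close> has length at most
    \<open>Suc (len k)\<close> for some \<open>k\<close>. The sum dominates every
    \<open>len k\<close>, and adding 2 makes \<open>m\<close> strictly larger than these lengths and
    at least 2.\<close>
  define m where "m = 2 + (\<Sum>k<M. len k)"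
  have "arrow_ideal_power BQ m \<subseteq> J"
  proof
    fix f assume f: "f \<in> (arrow_ideal_power BQ m :: (_ \<Rightarrow> 'k) set)"
    show "f \<in> J"
    proof (rule BQ.ideal_supported_on[OF J_ideal])
      show "f \<in> carrier BA"
        using f by (simp add: arrow_ideal_power_def)
      fix p assume p: "p \<in> paths BQ" "f p \<noteq> 0"
      obtain v as where va: "p = (v, as)" by (cases p) blast
      have m: "m \<le> length as"
        using f p(2) va by (auto simp: arrow_ideal_power_def)
      have "\<not> length as \<le> Suc (len k)" if "k < M" for k
        using m member_le_sum[of k "{..<M}" len] that by (simp add: m_def)
      then show "path_elem p \<in> J"
        using path_cases[of v as] p va m by (auto simp: m_def)
    qed
  qed
  then show "\<exists>m\<ge>2. arrow_ideal_power BQ m \<subseteq> J"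
    by (intro exI[of _ m]) (simp add: m_def)
qed

text \<open>A product of two arrows outside \<open>J\<close> forces the second to be the cyclic
  successor of the first. Successors are thus unique, and predecessors as well because the cyclic
  shift is injective.\<close>

lemma J_S1: "cond_S1 BQ J"
proof -
  have next_arrow: "k' = k \<and> i' = Suc i mod Suc (len k)"
    if "(k, i) \<in> arcs BQ" "(k', i') \<in> arcs BQ"
      "arrow_elem BQ (k, i) \<otimes>\<^bsub>BA\<^esub> arrow_elem BQ (k', i') \<notin> J" for k i k' i'
  proof (rule ccontr)
    assume "\<not> (k' = k \<and> i' = Suc i mod Suc (len k))"
    then have "arrow_elem BQ (k, i) \<otimes>\<^bsub>BA\<^esub> arrow_elem BQ (k', i') \<in> relators"
      using that(1,2) arcs_BQ by (intro relatorsI(3)) auto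
    then show False
      using relators_J that(3) by blast
  qed
  have succ_inj: "i = i'" if "Suc i mod Suc n = Suc i' mod Suc n" "i \<le> n" "i' \<le> n" for i i' n
    using that by (cases "i = n"; cases "i' = n") auto
  show ?thesis
    unfolding cond_S1_def
  proof (intro ballI conjI Uniq_I)
    fix a c d
    assume a: "a \<in> arcs BQ"
      and c: "c \<in> arcs BQ \<and> arrow_elem BQ a \<otimes>\<^bsub>BA\<^esub> arrow_elem BQ c \<notin> J"
      and d: "d \<in> arcs BQ \<and> arrow_elem BQ a \<otimes>\<^bsub>BA\<^esub> arrow_elem BQ d \<notin> J"
    show "c = d"
      using next_arrow[of "fst a" "snd a" "fst c" "snd c"] next_arrow[of "fst a" "snd a" "fst d" "snd d"] a c d
      by (simp add: prod_eq_iff)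
  next
    fix a c d
    assume a: "a \<in> arcs BQ"
      and c: "c \<in> arcs BQ \<and> arrow_elem BQ c \<otimes>\<^bsub>BA\<^esub> arrow_elem BQ a \<notin> J"
      and d: "d \<in> arcs BQ \<and> arrow_elem BQ d \<otimes>\<^bsub>BA\<^esub> arrow_elem BQ a \<notin> J"
    obtain k i k' i' k'' i'' where e: "a = (k, i)" "c = (k', i')" "d = (k'', i'')"
      by (metis surj_pair)
    have "k = k' \<and> i = Suc i' mod Suc (len k')"
      by (rule next_arrow) (use a c e in simp_all)
    moreover have "k = k'' \<and> i = Suc i'' mod Suc (len k'')"
      by (rule next_arrow) (use a d e in simp_all)
    moreover have "i' \<le> len k'" "i'' \<le> len k''"
      using c d e arcs_BQ by simp_all
    ultimately show "c = d"
      using succ_inj[of i' "len k" i''] unfolding e by auto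
  qed
qed

text \<open>The set \<open>?N\<close> consists of the normal forms from \<open>path_cases\<close>,
  and \<open>\<beta>\<close> reads off the label of the image from the first arrow and the
  length.\<close>

lemma T_presentation:
  assumes cover: "\<And>v. v < N \<Longrightarrow> \<exists>k<M. \<exists>i\<le>len k. v = w k i"
  shows "algebra_isomorphic T (quotient_algebra BA J)"
proof -
  let ?cycs = "{cyc k i l | k i l. k < M \<and> i \<le> len k \<and> 0 < l \<and> l \<le> Suc (len k)}"
  let ?N = "(\<lambda>v. (v, [])) ` {..<N} \<union> ?cycs"
  define \<beta> :: "(nat, nat \<times> nat) path \<Rightarrow> segment + segment" where
    "\<beta> = (\<lambda>(v, as). if as = [] then Inl (Vtx v) else tseg (fst (hd as)) (snd (hd as)) (length as))"
  have \<beta>_Nil: "\<beta> (v, []) = Inl (Vtx v)" for v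
    by (simp add: \<beta>_def)
  have \<beta>_cyc: "\<beta> (cyc k i l) = tseg k i l" if "i \<le> len k" "0 < l" for k i l
  proof -
    have "snd (cyc k i l) \<noteq> []"
      using that(2) length_cyc[of k i l] by (metis length_0_conv less_numeral_extra(3))
    then show ?thesis
      using hd_cyc[OF that] by (simp add: \<beta>_def case_prod_unfold)
  qed
  have tseg_Vtx: "tseg k i l \<noteq> Inl (Vtx v)" if "0 < l" for k i l v
    using that by (auto simp: tseg_def seg_def)
  show ?thesis
  proof (rule rep.presentation[OF J_ideal J_lin, where N = "?N" and \<beta> = \<beta>])
    show "?N \<subseteq> paths BQ"
      using cyc_path by (auto simp: verts_BQ)
    show "path_elem p \<in> J" if "p \<in> paths BQ" "p \<notin> ?N" for p
    proof -
      obtain v as where va: "p = (v, as)" by (cases p) blast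
      have "as \<noteq> []"
        using that verts_BQ va by auto
      moreover have "\<not> (k < M \<and> i \<le> len k \<and> (v, as) = cyc k i (length as) \<and> 0 < length as \<and> length as \<le> Suc (len k))" for k i
        using that(2) unfolding va by blast
      ultimately show ?thesis
        using path_cases[of v as] that(1) unfolding va by blast
    qed
    show "\<beta> ` ?N = segs <+> segs"
    proof (intro equalityI subsetI)
      fix x assume "x \<in> \<beta> ` ?N"
      then show "x \<in> segs <+> segs"
        using tseg_mem by (auto simp: \<beta>_Nil \<beta>_cyc)
    next
      fix x assume x: "x \<in> segs <+> segs"
      have cyc_mem: "tseg k i l \<in> \<beta> ` ?cycs" if "k < M" "i \<le> len k" "0 < l" "l \<le> Suc (len k)" for k i l
        using that \<beta>_cyc[of i k l] by (intro image_eqI[of _ _ "cyc k i l"]) auto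
      have "x \<in> \<beta> ` (\<lambda>v. (v, [])) ` {..<N} \<or> x \<in> \<beta> ` ?cycs"
      proof (cases x)
        case (Inl y)
        show ?thesis
        proof (cases y)
          case (Vtx v)
          then show ?thesis
            using Inl x by (auto simp: \<beta>_Nil image_image)
        next
          case (Seg k i j)
          then have "x = tseg k i (j - i)" "k < M" "i < j" "j \<le> len k"
            using Inl x by (auto simp: tseg_def seg_def)
          then show ?thesis
            using cyc_mem[of k i "j - i"] by simp
        qed
      next
        case (Inr y)
        show ?thesis
        proof (cases y)
          \<comment> \<open>Here \<open>cover\<close> enters: the dual of the trivial path at
            \<open>v\<close> is reached by a full turn from a position of \<open>v\<close> on some
            maximal path.\<close>
          case (Vtx v)
          then obtain k i where "k < M" "i \<le> len k" "v = w k i"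
            using cover[of v] Inr x by auto
          then show ?thesis
            using cyc_mem[of k i "Suc (len k)"] Vtx Inr by (simp add: tseg_def seg_def)
        next
          \<comment> \<open>The dual of the segment from \<open>i\<close> to \<open>j\<close> comes
            from the complementary path, which starts at \<open>j\<close>, passes the new arrow and
            stops at \<open>i\<close>.\<close>
          case (Seg k i j)
          then have "x = tseg k j (Suc (len k) + i - j)" "k < M" "i < j" "j \<le> len k"
            using Inr x by (auto simp: tseg_def seg_def)
          then show ?thesis
            using cyc_mem[of k j "Suc (len k) + i - j"] by simp
        qed
      qed
      then show "x \<in> \<beta> ` ?N"
        unfolding image_Un by blast
    qed
    show "rep.path_image p = T_basis (\<beta> p)" if "p \<in> ?N" for p
      using that by (auto simp: \<beta>_Nil \<beta>_cyc cyc_image rep.path_image_Nil simp flip: idem_def)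
    show "path_elem p \<ominus>\<^bsub>BA\<^esub> path_elem q \<in> J"
      if p: "p \<in> ?N" and q: "q \<in> ?N"
        and eq: "\<beta> p = \<beta> q" for p q
    proof -
      have p_path: "p \<in> paths BQ"
        using p cyc_path by (auto simp: verts_BQ)
      have refl: ?thesis if "p = q"
        using that p_path P.ideal_zero[OF J_ideal] by (simp add: P.M.minus_eq P.M.r_neg)
      \<comment> \<open>Labels determine the path except after a full turn, where only the vertex is
        remembered; a nontrivial piece never has the label of a trivial path.\<close>
      have "p = q \<or> (\<exists>k i k' i'. p = full k i \<and> q = full k' i' \<and> k < M \<and> i \<le> len k \<and> k' < M \<and> i' \<le> len k' \<and> w k i = w k' i')"
      proof (cases "snd p = [] \<or> snd q = []")
        case True
        then show ?thesis
          using p q eq tseg_Vtx by (auto simp: \<beta>_Nil \<beta>_cyc) (metis length_cyc list.size(3) snd_conv less_numeral_extra(3))+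
      next
        case False
        then obtain k i l k' i' l' where pq: "p = cyc k i l" "k < M" "i \<le> len k" "0 < l" "l \<le> Suc (len k)"
          "q = cyc k' i' l'" "k' < M" "i' \<le> len k'" "0 < l'" "l' \<le> Suc (len k')"
          using p q by auto
        then have t: "tseg k i l = tseg k' i' l'"
          using eq \<beta>_cyc by simp
        show ?thesis
        proof (cases "l = Suc (len k) \<and> l' = Suc (len k')")
          case True
          then have "w k i = w k' i'"
            using t by (simp add: tseg_def seg_def)
          then show ?thesis
            using True pq by blast
        next
          case False
          then have "k = k' \<and> i = i' \<and> l = l'"
            using t pq by (auto simp: tseg_def seg_def split: if_splits)
          then show ?thesis
            using pq by simp
        qed
      qed
      then show ?thesis
      proof
        assume "\<exists>k i k' i'. p = full k i \<and> q = full k' i' \<and> k < M \<and> i \<le> len k \<and> k' < M \<and> i' \<le> len k' \<and> w k i = w k' i'"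
        then have "path_elem p \<ominus>\<^bsub>BA\<^esub> path_elem q \<in> relators"
          using relatorsI(1) by auto
        then show ?thesis
          using relators_J by blast
      qed (rule refl)
    qed
  qed
qed

text \<open>A vertex that lies on no arrow splits off as a factor \<open>K\<close>.\<close>

lemma uncovered_vertex:
  assumes ind: "indecomposable A" and v: "v < N" and unc: "\<And>k i. \<lbrakk>k < M; i \<le> len k\<rbrakk> \<Longrightarrow> v \<noteq> w k i"
  shows "segs = {Vtx v}"
proof -
  define e where "e = b (Vtx v)"
  define \<epsilon> where "\<epsilon> = co (Vtx v)"
  have e: "e \<in> carrier A" "\<epsilon> e = 1" and \<epsilon>: "\<epsilon> \<in> dual A"
    using v by (auto simp: e_def \<epsilon>_def b_closed co_b co_dual)
  \<comment> \<open>No segment starts or ends at \<open>v\<close>, so the trivial path at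
    \<open>v\<close> has a nonzero product only with itself.\<close>
  have mult_v: "segment_mult w (Vtx v) y = Some z \<longleftrightarrow> y = Vtx v \<and> z = Vtx v"
    "segment_mult w y (Vtx v) = Some z \<longleftrightarrow> y = Vtx v \<and> z = Vtx v" if "y \<in> segs" for y z
    using that unc by (cases y; auto)+
  \<comment> \<open>Both sides depend linearly on \<open>a\<close>, so their coordinates are
    compared as functionals on the basis, where \<open>mult_v\<close> leaves a single term. Thus
    \<open>e\<close> is central and spans an ideal.\<close>
  have e_mult: "e \<otimes> a = \<epsilon> a \<odot> e" "a \<otimes> e = \<epsilon> a \<odot> e" if a: "a \<in> carrier A" for a
  proof -
    have scaled: "(\<lambda>a\<in>carrier A. \<epsilon> a * co x e) \<in> dual A" for x
      using \<epsilon> by (intro dualI) (auto simp: dual_add_apply dual_smult_apply algebra_simps)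
    have "co x (e \<otimes> a) = co x (\<epsilon> a \<odot> e) \<and> co x (a \<otimes> e) = co x (\<epsilon> a \<odot> e)" if x: "x \<in> segs" for x
    proof -
      have "(\<lambda>z\<in>carrier A. co x (e \<otimes> z)) = (\<lambda>a\<in>carrier A. \<epsilon> a * co x e)"
        by (rule dual_basis_eqI[OF dual_extend(2)[OF e(1) co_dual[OF x]] scaled])
          (use x v in \<open>simp add: b_closed e_def \<epsilon>_def co_segment_mult mult_v co_b\<close>)
      moreover have "(\<lambda>z\<in>carrier A. co x (z \<otimes> e)) = (\<lambda>a\<in>carrier A. \<epsilon> a * co x e)"
        by (rule dual_basis_eqI[OF dual_extend(1)[OF e(1) co_dual[OF x]] scaled])
          (use x v in \<open>simp add: b_closed e_def \<epsilon>_def co_segment_mult mult_v co_b\<close>)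
      ultimately have "co x (e \<otimes> a) = \<epsilon> a * co x e" "co x (a \<otimes> e) = \<epsilon> a * co x e"
        using a by (simp_all add: fun_eq_iff restrict_def split: if_splits)
      then show ?thesis
        using e x by (simp add: dual_smult_apply[OF co_dual])
    qed
    then show "e \<otimes> a = \<epsilon> a \<odot> e" "a \<otimes> e = \<epsilon> a \<odot> e"
      using a e by (auto intro!: coords_eqI)
  qed
  have \<epsilon>_mult: "\<epsilon> (a \<otimes> c) = \<epsilon> a * \<epsilon> c" if "a \<in> carrier A" "c \<in> carrier A" for a c
  proof -
    have "\<epsilon> (a \<otimes> c) \<odot> e = (e \<otimes> a) \<otimes> c"
      using that e by (simp add: A.m_assoc e_mult(1)[symmetric])
    also have "\<dots> = (\<epsilon> a * \<epsilon> c) \<odot> e"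
      using that e by (simp add: e_mult(1) smult_mult_left K_smult_assoc)
    finally have "\<epsilon> (\<epsilon> (a \<otimes> c) \<odot> e) = \<epsilon> ((\<epsilon> a * \<epsilon> c) \<odot> e)"
      by (rule arg_cong)
    then show ?thesis
      unfolding dual_smult_apply[OF \<epsilon> e(1)] e(2) mult_1_right .
  qed
  \<comment> \<open>\<open>\<epsilon>\<close> is multiplicative and \<open>\<epsilon> e = 1\<close>,
    so its kernel is an ideal complementary to the line through \<open>e\<close>. Indecomposability
    makes the kernel zero, and every basis element other than \<open>e\<close> would lie in
    it.\<close>
  let ?I = "range (\<lambda>c. c \<odot> e)" and ?J = "{a \<in> carrier A. \<epsilon> a = 0}"
  have I: "ideal ?I A"
  proof (rule idealI[OF A.ring_axioms])
    show "subgroup ?I (add_monoid A)"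
    proof (rule M.add.subgroupI)
      show "\<ominus> a \<in> ?I" if a: "a \<in> ?I" for a
      proof -
        obtain c where "a = c \<odot> e" using a by blast
        then have "\<ominus> a = (- c) \<odot> e"
          using e by (simp add: K_smult_minus[symmetric] K_smult_assoc[symmetric])
        then show ?thesis by blast
      qed
      show "a \<oplus> d \<in> ?I" if ad: "a \<in> ?I" "d \<in> ?I" for a d
      proof -
        obtain c c' where "a = c \<odot> e" "d = c' \<odot> e" using ad by blast
        then have "a \<oplus> d = (c + c') \<odot> e"
          using e by (simp add: K_smult_distr)
        then show ?thesis by blast
      qed
    qed (use e in auto)
    show "x \<otimes> a \<in> ?I" "a \<otimes> x \<in> ?I" if a: "a \<in> ?I" and x: "x \<in> carrier A" for a x
    proof -
      obtain c where "a = c \<odot> e" using a by blast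
      then have "x \<otimes> a = (c * \<epsilon> x) \<odot> e" "a \<otimes> x = (c * \<epsilon> x) \<odot> e"
        using e x by (simp_all add: smult_mult_left smult_mult_right e_mult K_smult_assoc)
      then show "x \<otimes> a \<in> ?I" "a \<otimes> x \<in> ?I" by blast+
    qed
  qed
  have J: "ideal ?J A"
  proof (rule idealI[OF A.ring_axioms])
    show "subgroup ?J (add_monoid A)"
      by (rule M.add.subgroupI)
        (auto simp: dual_add_apply[OF \<epsilon>] dual_zero_apply[OF \<epsilon>] dual_smult_apply[OF \<epsilon>] simp flip: K_smult_minus)
  qed (auto simp: \<epsilon>_mult)
  have "?I \<inter> ?J = {\<zero>}"
    using e dual_smult_apply[OF \<epsilon> e(1)] dual_zero_apply[OF \<epsilon>] ideal_zero[OF I] by auto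
  moreover have "?I <+>\<^bsub>A\<^esub> ?J = carrier A"
  proof (intro equalityI subsetI)
    fix a assume a: "a \<in> carrier A"
    have "a = \<epsilon> a \<odot> e \<oplus> (a \<oplus> (- \<epsilon> a) \<odot> e)"
      using a e K_smult_distr(1)[OF e(1), of "\<epsilon> a" "- \<epsilon> a"]
      by (simp add: M.a_lcomm[of "\<epsilon> a \<odot> e" a])
    moreover have "a \<oplus> (- \<epsilon> a) \<odot> e \<in> ?J"
      using a e by (simp add: dual_add_apply[OF \<epsilon>] dual_smult_apply[OF \<epsilon>])
    ultimately show "a \<in> ?I <+>\<^bsub>A\<^esub> ?J"
      unfolding set_add_def' by blast
  qed (use e in \<open>auto simp: set_add_def'\<close>)
  ultimately have "?I = {\<zero>} \<or> ?J = {\<zero>}"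
    using ind I J unfolding indecomposable_def by blast
  moreover have "?I \<noteq> {\<zero>}"
  proof
    assume "?I = {\<zero>}"
    then have "1 \<odot> e = \<zero>" by blast
    then show False
      using e dual_zero_apply[OF \<epsilon>] by simp
  qed
  ultimately have J0: "?J = {\<zero>}" by blast
  have "x = Vtx v" if x: "x \<in> segs" for x
  proof (rule ccontr)
    assume "x \<noteq> Vtx v"
    then have "b x \<in> ?J"
      using x v by (simp add: b_closed \<epsilon>_def co_b)
    then have "b x = \<zero>"
      using J0 by blast
    then show False
      using co_b[OF x x] dual_zero_apply[OF co_dual[OF x]] by simp
  qed
  then show ?thesis
    using v by auto
qed

end

section \<open>The loop quiver and the exceptional case\<close>

lemma quiver_loop: "quiver loop_quiver"
  by unfold_locales (auto simp: loop_quiver_def)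

interpretation L: quiver loop_quiver
  by (rule quiver_loop)

lemma loop_quiver_simps [simp]:
  "verts loop_quiver = {0}" "arcs loop_quiver = {(0, 0)}" "tail loop_quiver a = 0" "head loop_quiver a = 0"
  by (simp_all add: loop_quiver_def)

abbreviation LA :: "('k::field, (nat, nat \<times> nat) path \<Rightarrow> 'k) module" where
  "LA \<equiv> path_algebra loop_quiver"

abbreviation loop_arrow :: "(nat, nat \<times> nat) path \<Rightarrow> 'k::field" where
  "loop_arrow \<equiv> arrow_elem loop_quiver (0, 0)"

lemma loop_paths: "(v, as) \<in> paths loop_quiver \<longleftrightarrow> v = 0 \<and> set as \<subseteq> {(0, 0)}"
  by (induction as rule: rev_induct) (auto simp: L.paths_snoc_iff path_end_def pre_digraph.awalk_verts_conv)

abbreviation loop_ideal :: "((nat, nat \<times> nat) path \<Rightarrow> 'k::field) set" where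
  "loop_ideal \<equiv> Idl\<^bsub>LA\<^esub>
    {loop_arrow \<otimes>\<^bsub>LA\<^esub> loop_arrow}"

lemma loop_square_closed:
  "{loop_arrow \<otimes>\<^bsub>LA\<^esub> loop_arrow}
    \<subseteq> (arrow_ideal_power loop_quiver 2 :: (_ \<Rightarrow> 'k::field) set)"
  using L.arrow_mult_in_arrow_ideal[of "(0, 0)" "(0, 0)"] by simp

lemma loop_ideal: "ideal (loop_ideal :: (_ \<Rightarrow> 'k::field) set) (LA)"
proof -
  interpret P: K_algebra "LA :: ('k, _) module"
    by (rule L.path_algebra_K_algebra)
  show ?thesis
    by (rule P.genideal_ideal) (use loop_square_closed in \<open>auto simp: arrow_ideal_power_def\<close>)
qed

lemma long_path_in_loop_ideal:
  assumes "p \<in> paths loop_quiver" "2 \<le> length (snd p)"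
  shows "path_elem p \<in> (loop_ideal :: (_ \<Rightarrow> 'k::field) set)"
proof -
  interpret P: K_algebra "LA :: ('k, _) module"
    by (rule L.path_algebra_K_algebra)
  interpret J: ideal "loop_ideal :: (_ \<Rightarrow> 'k) set" "LA"
    by (rule loop_ideal)
  let ?x = "loop_arrow :: _ \<Rightarrow> 'k"
  obtain a c as where p: "p = (0, a # c # as)" "a = (0, 0)" "c = (0, 0)" "set as \<subseteq> {(0, 0)}"
    using assms by (cases p; cases "snd p"; cases "tl (snd p)") (auto simp: loop_paths)
  have xx: "?x \<otimes>\<^bsub>LA\<^esub> ?x \<in> loop_ideal"
    by (rule P.genideal_self') (use loop_square_closed in \<open>auto simp: arrow_ideal_power_def\<close>)
  have path: "(0, as) \<in> paths loop_quiver"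
    using p by (simp add: loop_paths)
  have loop_end: "path_end loop_quiver (0, [(0, 0), (0, 0)]) = 0"
    by (simp add: path_end_def pre_digraph.awalk_verts_conv)
  have "path_elem p = (?x \<otimes>\<^bsub>LA\<^esub> ?x) \<otimes>\<^bsub>LA\<^esub> path_elem (0, as)"
    using path p loop_end by (simp add: arrow_elem_def L.path_elem_mult loop_paths)
  then show ?thesis
    using J.I_r_closed[OF xx, of "path_elem (0, as)"] path by simp
qed

text \<open>The ideal generated by the square of the loop is exactly the second power of the arrow
  ideal.\<close>

lemma loop_admissible: "admissible loop_quiver (loop_ideal :: (_ \<Rightarrow> 'k::field) set)"
proof -
  interpret P: K_algebra "LA :: ('k, _) module"
    by (rule L.path_algebra_K_algebra)
  have "arrow_ideal_power loop_quiver 2 \<subseteq> (loop_ideal :: (_ \<Rightarrow> 'k) set)"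
  proof
    fix f assume f: "f \<in> (arrow_ideal_power loop_quiver 2 :: (_ \<Rightarrow> 'k) set)"
    show "f \<in> loop_ideal"
      by (rule L.ideal_supported_on[OF loop_ideal])
        (use f in \<open>auto simp: arrow_ideal_power_def intro!: long_path_in_loop_ideal\<close>)
  qed
  moreover have "loop_ideal \<subseteq> (arrow_ideal_power loop_quiver 2 :: (_ \<Rightarrow> 'k) set)"
    by (rule P.genideal_minimal[OF L.arrow_ideal_power_ideal loop_square_closed])
  ultimately show ?thesis
    unfolding admissible_def using loop_ideal by blast
qed

lemma loop_S1: "cond_S1 loop_quiver (loop_ideal :: (_ \<Rightarrow> 'k::field) set)"
  by (auto simp: cond_S1_def Uniq_def)

context chain_algebra
begin

text \<open>With one segment, T(A) has the basis consisting of the unit and its dual element. The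
  loop goes to the latter, whose square is zero, and the paths of length 0 and 1 match the
  basis.\<close>

lemma T_dual_numbers:
  assumes segs: "segs = {Vtx v}"
  shows "algebra_isomorphic T (quotient_algebra (LA) loop_ideal)"
proof -
  have v: "v < N" using segs Vtx_mem[of v] by simp
  have N: "N = 1" "v = 0"
  proof -
    have "u = v" if "u < N" for u
      using that segs Vtx_mem[of u] by auto
    note all_eq = this
    show "N = 1" "v = 0"
      using v all_eq[of 0] all_eq[of 1] by linarith+
  qed
  let ?E = "\<lambda>v :: nat. idem 0" and ?ar = "\<lambda>a :: nat \<times> nat. T_basis (Inr (Vtx 0))"
  have V: "Vtx 0 \<in> segs" using segs N by simp
  have mult: "segment_mult w z (Vtx 0) = Some (Vtx 0) \<longleftrightarrow> z = Vtx 0"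
    "segment_mult w (Vtx 0) z = Some (Vtx 0) \<longleftrightarrow> z = Vtx 0" for z
    by (cases z; simp)+
  interpret L: path_representation loop_quiver T "segs <+> segs" T_basis T_coord ?E ?ar
  proof
    show "(\<Oplus>\<^bsub>T\<^esub>v\<in>verts loop_quiver. idem 0) = \<one>\<^bsub>T\<^esub>"
      using idem_sum N T.b_closed[of "Inl (Vtx 0)"] V
      by (simp add: idem_def lessThan_Suc)
    show "idem 0 \<otimes>\<^bsub>T\<^esub> T_basis (Inr (Vtx 0)) = T_basis (Inr (Vtx 0))"
      unfolding idem_def by (rule T_basis_mult_LR(1)[OF V V V mult(1)])
    show "T_basis (Inr (Vtx 0)) \<otimes>\<^bsub>T\<^esub> idem 0 = T_basis (Inr (Vtx 0))"
      unfolding idem_def by (rule T_basis_mult_RL(1)[OF V V V mult(2)])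
  qed (use N V in \<open>auto simp: T_basis_mult_LL idem_def T.b_closed\<close>)
  define \<beta> :: "(nat, nat \<times> nat) path \<Rightarrow> segment + segment" where
    "\<beta> = (\<lambda>(v, as). if as = [] then Inl (Vtx 0) else Inr (Vtx 0))"
  interpret P: K_algebra "LA :: ('k, _) module"
    by (rule quiver.path_algebra_K_algebra[OF quiver_loop])
  let ?N = "{(0, []), (0, [(0, 0)])} :: (nat, nat \<times> nat) path set"
  have N_paths: "?N \<subseteq> paths loop_quiver"
    by (auto simp: loop_paths)
  show ?thesis
  proof (rule L.presentation[OF loop_ideal, where N = ?N and \<beta> = \<beta>])
    have "(loop_ideal :: (_ \<Rightarrow> 'k) set) \<subseteq> {f \<in> carrier (LA). L.lin f = \<zero>\<^bsub>T\<^esub>}"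
    proof (rule P.genideal_minimal[OF L.lin_kernel_ideal])
      have arrow: "loop_arrow \<in> carrier (LA :: ('k, _) module)"
        by (simp add: L.arrow_elem_closed)
      have "L.lin (loop_arrow) = T_basis (Inr (Vtx 0))"
        using L.path_image_single[of "(0, 0)"] by (simp add: arrow_elem_def L.lin_path_elem loop_paths)
      then show "{loop_arrow \<otimes>\<^bsub>LA\<^esub> loop_arrow}
          \<subseteq> {f \<in> carrier (LA). L.lin f = \<zero>\<^bsub>T\<^esub>}"
        using arrow V by (simp add: L.lin_mult L.path_algebra_mult_closed T_basis_mult_RR)
    qed
    then show "L.lin f = \<zero>\<^bsub>T\<^esub>" if "f \<in> loop_ideal" for f
      using that by blast
    show "path_elem p \<in> (loop_ideal :: (_ \<Rightarrow> 'k) set)" if "p \<in> paths loop_quiver" "p \<notin> ?N" for p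
    proof (rule long_path_in_loop_ideal[OF that(1)])
      obtain v as where p: "p = (v, as)" by (cases p) blast
      show "2 \<le> length (snd p)"
        using that unfolding p by (cases as; cases "tl as") (auto simp: loop_paths)
    qed
    show "\<beta> ` ?N = segs <+> segs"
      using segs N by (auto simp: \<beta>_def)
    show "L.path_image p = T_basis (\<beta> p)" if "p \<in> ?N" for p
      using that L.path_image_single[of "(0, 0)"] by (auto simp: \<beta>_def simp flip: idem_def)
    show "path_elem p \<ominus>\<^bsub>LA\<^esub> path_elem q \<in> (loop_ideal :: (_ \<Rightarrow> 'k) set)"
      if "p \<in> ?N" "q \<in> ?N" "\<beta> p = \<beta> q" for p q
    proof -
      have "p = q"
        using that by (auto simp: \<beta>_def split: if_splits)
      moreover have "q \<in> paths loop_quiver"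
        using that(2) N_paths by blast
      ultimately show ?thesis
        using P.ideal_zero[OF loop_ideal] L.path_elem_closed[of q] by (simp add: P.M.minus_eq P.M.r_neg)
    qed
  qed (rule N_paths)
qed

theorem T_brauer:
  assumes "indecomposable A"
  shows "special_multiserial T \<and> brauer_configuration_algebra T"
proof (cases "\<forall>v<N. \<exists>k<M. \<exists>i\<le>len k. v = w k i")
  case True
  then have iso: "algebra_isomorphic T (quotient_algebra BA J)"
    by (intro T_presentation) blast
  have "brauer_configuration \<Gamma>"
    using True by (intro brauer_configuration_\<Gamma>) blast
  then have "brauer_configuration_algebra T"
    using iso unfolding brauer_configuration_algebra_def by blast
  moreover have "special_multiserial T"
    unfolding special_multiserial_def
    using J_admissible J_S1 BQ.fin_digraph_axioms
      algebra_isomorphic_imp_morita_equivalent[OF iso T.K_algebra_axioms] by blast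
  ultimately show ?thesis by blast
next
  case False
  then obtain v where "v < N" "\<And>k i. \<lbrakk>k < M; i \<le> len k\<rbrakk> \<Longrightarrow> v \<noteq> w k i"
    by blast
  then have "segs = {Vtx v}"
    by (rule uncovered_vertex[OF assms])
  then have iso: "algebra_isomorphic T (quotient_algebra (LA) loop_ideal)"
    by (rule T_dual_numbers)
  then have "brauer_configuration_algebra T"
    unfolding brauer_configuration_algebra_def dual_numbers_def Let_def by blast
  moreover have "special_multiserial T"
    unfolding special_multiserial_def
    using loop_admissible loop_S1 L.fin_digraph_axioms
      algebra_isomorphic_imp_morita_equivalent[OF iso T.K_algebra_axioms] by blast
  ultimately show ?thesis by blast
qed

end

theorem corollary4p4:
  fixes Q :: "('v, 'e) pre_digraph"
    and I :: "(('v, 'e) path \<Rightarrow> 'k::field) set"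
    and A :: "('k, (('v, 'e) path \<Rightarrow> 'k) set) module"
  assumes almost_gentle: "almost_gentle_presentation Q I"
    and A_def: "A = quotient_algebra (path_algebra Q) I"
    and indec: "indecomposable A"
  shows "K_algebra (trivial_extension A) \<and>
    finite_dimensional (trivial_extension A) \<and>
    indecomposable (trivial_extension A) \<and>
    symmetric_algebra (trivial_extension A) \<and>
    special_multiserial (trivial_extension A) \<and>
    brauer_configuration_algebra (trivial_extension A)"
proof -
  have "fin_digraph Q"
    using almost_gentle by (simp add: almost_gentle_presentation_def)
  then interpret almost_gentle Q I
    using almost_gentle by (simp add: almost_gentle_def almost_gentle_axioms_def quiver_def)
  \<comment> \<open>The quotient algebra itself is kept as \<open>A\<close>; only its description by
    segments enters what follows, so no Morita equivalence is needed on this side.\<close>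
  obtain N M len b co w where "chain_algebra A N M len b co w"
    unfolding A_def by (rule quotient_chain_algebra)
  then interpret chain_algebra A N M len b co w .
  show ?thesis
    using T.K_algebra_axioms T.finite_dimensional trivial_extension_indecomposable[OF indec]
      T_symmetric T_brauer[OF indec] by blast
qed

end
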